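(* Let $S_j$ be local potentials satisfying (A)–(E) and let $\omega\in\mathbb{Q}^d$. Then there exists a ghost circle $\Gamma_\omega\subset\overline{\mathcal{B}}_\omega$ for the $S_j$ that contains a global minimizer.
   Context: Notation: $\|i\|=\sum_{k=1}^d|i_k|$, $B_j^r=\{k:\|k-j\|\le r\}$, $(\tau_{k,l}x)_i=x_{i+k}+l$. Local potentials $S_j:\mathbb{R}^{\mathbb{Z}^d}\to\mathbb{R}$, $j\in\mathbb{Z}^d$, satisfy: (A) there is $r\in(0,\infty)$ and $C^2$ functions $s_j:\mathbb{R}^{B_j^r}\to\mathbb{R}$ with $S_j(x)=s_j(x|_{B_j^r})$; (B) $S_j(\tau_{k,l}x)=S_{j+k}(x)$; (C) each $S_j$ is bounded below and $S_j(x)\to\infty$ as $|x_k-x_j|\to\infty$ whenever $\|k-j\|=1$; (D) $\partial_{i,k}S_j\le0$ for $i\ne k$, and $\partial_{i,k}S_i<0$ when $\|i-k\|=1$; (E) $|\partial_{i,k}S_j|\le C$ uniformly. Birkhoff: $\tau_{k,l}x\ge x$ or $\tau_{k,l}x\le x$ (pointwise) for all $(k,l)$; rotation vector $\omega$: $\lim_nx_{ni}/n=\langle\omega,i\rangle$. $\overline{\mathcal{B}}_\omega$: Birkhoff configurations with rotation vector $\omega$ and $\tau_{k,l}x=x$ whenever $\langle\omega,k\rangle+l=0$. $\mathbb{X}=\{x:\sum_i2^{-\|i\|}|x_i|<\infty\}$; $(\nabla W(x))_i=\sum_{\|j-i\|\le r}\partial_iS_j(x)$; $\Psi_t$ the complete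 flow of $\dot x=-\nabla W(x)$ on $\mathbb{X}$. A ghost circle is a set $\Gamma\subset\mathbb{R}^{\mathbb{Z}^d}$ that is nonempty, closed and connected (pointwise topology), strictly ordered (for $x,y\in\Gamma$: $x\ll y$, $x=y$ or $y\ll x$, where $\ll$ means strict inequality in every coordinate), shift-invariant ($\tau_{k,l}\Gamma\subset\Gamma$), and satisfies $\Psi_t(\Gamma)=\Gamma$ for all $t\in\mathbb{R}$. Global minimizer: $W_B(x+y)\ge W_B(x)$ for every finite $B$ and every $y$ supported in $\mathring{B}^{(r)}=\{i\in B:B_i^r\subset B\}$, $W_B=\sum_{j\in B}S_j$. *)

theory Defs
  imports "HOL-Analysis.Analysis"
begin

(* Lattice sites are elements of Z^d, rendered as 'd \<Rightarrow> int for a finite type 'd.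
   Configurations are elements of R^(Z^d), rendered as ('d \<Rightarrow> int) \<Rightarrow> real,
   carrying the product (pointwise) topology from Function_Topology. *)

type_synonym 'd site = "'d \<Rightarrow> int"
type_synonym 'd config = "('d \<Rightarrow> int) \<Rightarrow> real"

definition norm1 :: "('d::finite) site \<Rightarrow> real" where
  "norm1 i = (\<Sum>m\<in>UNIV. real_of_int \<bar>i m\<bar>)"

definition site_add :: "'d site \<Rightarrow> 'd site \<Rightarrow> 'd site" where
  "site_add i k = (\<lambda>m. i m + k m)"

definition site_diff :: "'d site \<Rightarrow> 'd site \<Rightarrow> 'd site" where
  "site_diff i k = (\<lambda>m. i m - k m)"

definition ball1 :: "('d::finite) site \<Rightarrow> real \<Rightarrow> 'd site set" where
  "ball1 j r = {k. norm1 (site_diff k j) \<le> r}"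

definition tau :: "'d site \<Rightarrow> int \<Rightarrow> 'd config \<Rightarrow> 'd config" where
  "tau k l x = (\<lambda>i. x (site_add i k) + of_int l)"

definition pd :: "('d config \<Rightarrow> real) \<Rightarrow> 'd site \<Rightarrow> 'd config \<Rightarrow> real" where
  "pd F i x = deriv (\<lambda>t. F (x(i := t))) (x i)"

definition pd2 :: "('d config \<Rightarrow> real) \<Rightarrow> 'd site \<Rightarrow> 'd site \<Rightarrow> 'd config \<Rightarrow> real" where
  "pd2 F i k x = pd (pd F i) k x"

(* F is C^2 in the coordinates: all first and second partials exist everywhere and are
   continuous (product topology). For functions depending on finitely many coordinates
   this is exactly C^2 of the induced function on R^B. *)
definition C2_coord :: "('d config \<Rightarrow> real) \<Rightarrow> bool" where
  "C2_coord F \<longleftrightarrow>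
     (\<forall>x i. (\<lambda>t. F (x(i := t))) differentiable (at (x i))) \<and>
     (\<forall>x i k. (\<lambda>t. pd F i (x(k := t))) differentiable (at (x k))) \<and>
     (\<forall>i. continuous_on UNIV (pd F i)) \<and>
     (\<forall>i k. continuous_on UNIV (pd2 F i k))"

definition depends_only_on :: "('d config \<Rightarrow> real) \<Rightarrow> 'd site set \<Rightarrow> bool" where
  "depends_only_on F B \<longleftrightarrow> (\<forall>x y. (\<forall>k\<in>B. x k = y k) \<longrightarrow> F x = F y)"

definition local_potentials :: "real \<Rightarrow> (('d::finite) site \<Rightarrow> 'd config \<Rightarrow> real) \<Rightarrow> bool" where
  "local_potentials r S \<longleftrightarrow>
     \<comment> \<open>(A)\<close>
     0 < r \<and> (\<forall>j. depends_only_on (S j) (ball1 j r) \<and> C2_coord (S j)) \<and>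
     \<comment> \<open>(B)\<close>
     (\<forall>j k l x. S j (tau k l x) = S (site_add j k) x) \<and>
     \<comment> \<open>(C)\<close>
     (\<forall>j. \<exists>c. \<forall>x. c \<le> S j x) \<and>
     (\<forall>j k. norm1 (site_diff k j) = 1 \<longrightarrow>
        (\<forall>M. \<exists>R. \<forall>x. R \<le> \<bar>x k - x j\<bar> \<longrightarrow> M \<le> S j x)) \<and>
     \<comment> \<open>(D)\<close>
     (\<forall>i k j x. i \<noteq> k \<longrightarrow> pd2 (S j) i k x \<le> 0) \<and>
     (\<forall>i k x. norm1 (site_diff i k) = 1 \<longrightarrow> pd2 (S i) i k x < 0) \<and>
     \<comment> \<open>(E)\<close>
     (\<exists>C. \<forall>i k j x. \<bar>pd2 (S j) i k x\<bar> \<le> C)"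

definition inner_site :: "('d::finite \<Rightarrow> real) \<Rightarrow> 'd site \<Rightarrow> real" where
  "inner_site \<omega> k = (\<Sum>m\<in>UNIV. \<omega> m * real_of_int (k m))"

definition birkhoff :: "'d config \<Rightarrow> bool" where
  "birkhoff x \<longleftrightarrow> (\<forall>k l. (\<forall>i. tau k l x i \<ge> x i) \<or> (\<forall>i. tau k l x i \<le> x i))"

definition has_rotation_vector :: "('d::finite) config \<Rightarrow> ('d \<Rightarrow> real) \<Rightarrow> bool" where
  "has_rotation_vector x \<omega> \<longleftrightarrow>
     (\<forall>i. (\<lambda>n::nat. x (\<lambda>m. int n * i m) / real n) \<longlonglongrightarrow> inner_site \<omega> i)"

definition Bbar :: "('d::finite \<Rightarrow> real) \<Rightarrow> 'd config set" where
  "Bbar \<omega> = {x. birkhoff x \<and> has_rotation_vector x \<omega> \<and>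
              (\<forall>k l. inner_site \<omega> k + real_of_int l = 0 \<longrightarrow> tau k l x = x)}"

definition weight :: "('d::finite) site \<Rightarrow> real" where
  "weight i = 2 powr (- norm1 i)"

definition Xspace :: "('d::finite) config set" where
  "Xspace = {x. (\<lambda>i. weight i * \<bar>x i\<bar>) summable_on UNIV}"

definition wnorm :: "('d::finite) config \<Rightarrow> real" where
  "wnorm x = (\<Sum>\<^sub>\<infinity>i. weight i * \<bar>x i\<bar>)"

definition gradW :: "real \<Rightarrow> (('d::finite) site \<Rightarrow> 'd config \<Rightarrow> real) \<Rightarrow> 'd config \<Rightarrow> 'd config" where
  "gradW r S x = (\<lambda>i. \<Sum>j\<in>ball1 i r. pd (S j) i x)"

definition X_has_deriv :: "(real \<Rightarrow> ('d::finite) config) \<Rightarrow> 'd config \<Rightarrow> real \<Rightarrow> bool" where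
  "X_has_deriv \<gamma> v t \<longleftrightarrow>
     ((\<lambda>h. wnorm (\<lambda>i. \<gamma> (t + h) i - \<gamma> t i - h * v i) / \<bar>h\<bar>) \<longlongrightarrow> 0) (at 0)"

definition grad_flow_solution :: "real \<Rightarrow> (('d::finite) site \<Rightarrow> 'd config \<Rightarrow> real) \<Rightarrow> (real \<Rightarrow> 'd config) \<Rightarrow> bool" where
  "grad_flow_solution r S \<gamma> \<longleftrightarrow>
     (\<forall>s. \<gamma> s \<in> Xspace \<and> X_has_deriv \<gamma> (\<lambda>i. - gradW r S (\<gamma> s) i) s)"

(* the flow \<Psi>_t on \<X> (solutions are unique, so this is the complete flow) *)
definition Psi :: "real \<Rightarrow> (('d::finite) site \<Rightarrow> 'd config \<Rightarrow> real) \<Rightarrow> real \<Rightarrow> 'd config \<Rightarrow> 'd config" where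
  "Psi r S t x = (THE y. \<exists>\<gamma>. grad_flow_solution r S \<gamma> \<and> \<gamma> 0 = x \<and> \<gamma> t = y)"

definition strictly_less :: "'d config \<Rightarrow> 'd config \<Rightarrow> bool" where
  "strictly_less x y \<longleftrightarrow> (\<forall>i. x i < y i)"

definition ghost_circle :: "real \<Rightarrow> (('d::finite) site \<Rightarrow> 'd config \<Rightarrow> real) \<Rightarrow> 'd config set \<Rightarrow> bool" where
  "ghost_circle r S \<Gamma> \<longleftrightarrow>
     \<Gamma> \<noteq> {} \<and> closed \<Gamma> \<and> connected \<Gamma> \<and>
     (\<forall>x\<in>\<Gamma>. \<forall>y\<in>\<Gamma>. strictly_less x y \<or> x = y \<or> strictly_less y x) \<and>
     (\<forall>k l. tau k l ` \<Gamma> \<subseteq> \<Gamma>) \<and>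
     (\<forall>t. Psi r S t ` \<Gamma> = \<Gamma>)"

definition W_B :: "(('d::finite) site \<Rightarrow> 'd config \<Rightarrow> real) \<Rightarrow> 'd site set \<Rightarrow> 'd config \<Rightarrow> real" where
  "W_B S B x = (\<Sum>j\<in>B. S j x)"

definition interior_r :: "('d::finite) site set \<Rightarrow> real \<Rightarrow> 'd site set" where
  "interior_r B r = {i\<in>B. ball1 i r \<subseteq> B}"

definition global_minimizer :: "real \<Rightarrow> (('d::finite) site \<Rightarrow> 'd config \<Rightarrow> real) \<Rightarrow> 'd config \<Rightarrow> bool" where
  "global_minimizer r S x \<longleftrightarrow>
     (\<forall>B y. finite B \<longrightarrow> (\<forall>i. i \<notin> interior_r B r \<longrightarrow> y i = 0) \<longrightarrow>
        W_B S B (\<lambda>i. x i + y i) \<ge> W_B S B x)"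

end

(* The configurations with tau k l x = x whenever <w,k> + l = 0 form a finite-dimensional affine
   space E on which the negative gradient flow is complete and strongly order preserving, and in E
   a configuration is Birkhoff as soon as x <= tau k l x whenever <w,k> + l >= 0.

   A global minimiser of this kind is a limit, for growing periods, of minimisers of the periodic
   action: submodularity makes the pointwise minimum of finitely many minimisers a minimiser, so
   the infimum over all translates of nonnegative height is again one.

   The ghost circle is a maximal totally ordered set of such Birkhoff configurations containing
   the minimiser and invariant under translations and flow (Zorn). It is closed by maximality and
   strictly ordered by strong monotonicity. If it were disconnected, it would have a gap whose end
   points a < b are equilibria, and the translates of any totally ordered entire orbit strictly
   between a and b could be added. Such an orbit exists: minimising the action on level sets of the
   coordinate sum within [a,b] gives sub- or supersolutions at every level. If all are
   subsolutions, orbits starting near a increase to b and accumulate at a monotone entire orbit;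
   if all are supersolutions, argue from b. If both kinds occur, a and b both attract, and a point
   of the segment from a to b outside both basins leads to a third equilibrium because the action
   is a Lyapunov function. *)
theory Submission
  imports Defs
begin

section \<open>Mean values in coordinates\<close>

text \<open>Equilibria may be degenerate, so linearisation and unstable manifolds are out of reach;
  this is why orbits between equilibria come from a constrained minimisation. Configurations in
  \<open>E\<close> are unbounded, but two of them differ by a \<open>q\<close>-periodic function.
  Hence estimates along the flow concern differences in the supremum norm, and pointwise limits
  within \<open>E\<close> are uniform. \<open>Psi\<close> is a definite description over curves
  differentiable in the weighted norm. Uniqueness must therefore hold for all such curves, whereas
  existence is needed only for bounded gradient: a Picard iteration in the supremum norm, lifted to
  the weighted norm afterwards. Existence, comparison and continuous dependence start from a crude
  exponential bound and improve it by a factor two per pass; the rates \<open>2 * L\<close> and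
  \<open>2 * L + K\<close> are chosen to produce that factor. Connectedness of the chain is read off
  from a parametrisation: the coordinate sum \<open>\<phi>\<close> is injective on it, onto the
  reals once gaps are excluded, and has a Lipschitz inverse.\<close>

lemma depends_only_onD: "depends_only_on F B \<Longrightarrow> (\<And>k. k \<in> B \<Longrightarrow> x k = y k) \<Longrightarrow> F x = F y"
  unfolding depends_only_on_def by blast

lemma depends_only_on_pd:
  assumes "depends_only_on F B" shows "depends_only_on (pd F i) B"
  unfolding depends_only_on_def
proof (intro allI impI)
  fix x y :: "'a config" assume xy: "\<forall>k\<in>B. x k = y k"
  show "pd F i x = pd F i y"
  proof (cases "i \<in> B")
    case True
    have "F (x(i:=t)) = F (y(i:=t))" for t
      by (rule depends_only_onD[OF assms]) (use xy in auto)
    then show ?thesis using xy True by (simp add: pd_def)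
  next
    case False
    have "F (x(i:=t)) = F x" "F (y(i:=t)) = F y" for t
      by (rule depends_only_onD[OF assms]; use False in auto)+
    then show ?thesis by (simp add: pd_def)
  qed
qed

definition coord_differentiable :: "('d config \<Rightarrow> real) \<Rightarrow> bool" where
  "coord_differentiable F \<longleftrightarrow> (\<forall>x i. (\<lambda>t. F (x(i := t))) differentiable (at (x i)))"

lemma pd_has_deriv:
  assumes "coord_differentiable F"
  shows "((\<lambda>t. F (x(i := t))) has_real_derivative pd F i (x(i := s))) (at s)"
proof -
  have "(\<lambda>t. F ((x(i:=s))(i := t))) differentiable (at ((x(i:=s)) i))"
    using assms unfolding coord_differentiable_def by blast
  then have "(\<lambda>t. F (x(i := t))) differentiable (at s)" by simp
  then have "((\<lambda>t. F (x(i := t))) has_real_derivative deriv (\<lambda>t. F (x(i := t))) s) (at s)"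
    by (simp add: DERIV_deriv_iff_real_differentiable)
  then show ?thesis by (simp add: pd_def)
qed

lemma coord_mvt_step:
  assumes "coord_differentiable F"
  shows "\<exists>\<xi>\<in>closed_segment (x i) c. F (x(i := c)) - F x = pd F i (x(i := \<xi>)) * (c - x i)"
proof -
  let ?f = "\<lambda>t. F (x(i := t))"
  have d: "(?f has_real_derivative pd F i (x(i := s))) (at s)" for s
    by (rule pd_has_deriv[OF assms])
  consider "x i < c" | "x i = c" | "c < x i" by linarith
  then show ?thesis
  proof cases
    case 1
    obtain z where "z > x i" "z < c" "?f c - ?f (x i) = (c - x i) * pd F i (x(i := z))"
      using MVT2[OF 1, of ?f "\<lambda>s. pd F i (x(i := s))"] d by blast
    then show ?thesis by (intro bexI[of _ z]) (auto simp: closed_segment_eq_real_ivl)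
  next
    case 2 then show ?thesis by auto
  next
    case 3
    obtain z where "z > c" "z < x i" "?f (x i) - ?f c = (x i - c) * pd F i (x(i := z))"
      using MVT2[OF 3, of ?f "\<lambda>s. pd F i (x(i := s))"] d by blast
    then show ?thesis
      by (intro bexI[of _ z]) (auto simp: closed_segment_eq_real_ivl algebra_simps)
  qed
qed

text \<open>Coordinates are replaced one at a time, which uses only derivatives along the axes. The
  price is a separate intermediate point for each coordinate; the box constraint makes all of them
  converge when \<open>y\<close> tends to \<open>x\<close>.\<close>

lemma coord_mvt_on:
  assumes "coord_differentiable F" "finite A"
  shows "\<exists>\<xi>. F (override_on x y A) - F x = (\<Sum>k\<in>A. pd F k (\<xi> k) * (y k - x k)) \<and>
             (\<forall>k i. \<xi> k i \<in> closed_segment (x i) (y i))"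
  using assms(2)
proof (induction A rule: finite_induct)
  case empty
  then show ?case by (intro exI[of _ "\<lambda>_. x"]) auto
next
  case (insert a A)
  then obtain \<xi> where \<xi>: "F (override_on x y A) - F x = (\<Sum>k\<in>A. pd F k (\<xi> k) * (y k - x k))"
     "\<And>k i. \<xi> k i \<in> closed_segment (x i) (y i)" by blast
  let ?z = "override_on x y A"
  have za: "?z a = x a" using insert by simp
  obtain c where c: "c \<in> closed_segment (x a) (y a)"
     "F (?z(a := y a)) - F ?z = pd F a (?z(a := c)) * (y a - x a)"
    using coord_mvt_step[OF assms(1), of ?z a "y a"] za by auto
  have e: "?z(a := y a) = override_on x y (insert a A)"
    by (auto simp: override_on_def)
  have "(\<Sum>k\<in>A. pd F k ((\<xi>(a := ?z(a:=c))) k) * (y k - x k)) = (\<Sum>k\<in>A. pd F k (\<xi> k) * (y k - x k))"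
    using insert(2) by (intro sum.cong) auto
  then have "F (override_on x y (insert a A)) - F x =
      (\<Sum>k\<in>insert a A. pd F k ((\<xi>(a := ?z(a:=c))) k) * (y k - x k))"
    using \<xi>(1) c(2) unfolding e[symmetric] sum.insert[OF insert(1,2)] by simp
  moreover have "(\<xi>(a := ?z(a:=c))) k i \<in> closed_segment (x i) (y i)" for k i
    using \<xi>(2) c(1) by (auto simp: override_on_def)
  ultimately show ?case by blast
qed

lemma coord_mvt:
  assumes "coord_differentiable F" "finite B" "depends_only_on F B"
  obtains \<xi> where "F y - F x = (\<Sum>k\<in>B. pd F k (\<xi> k) * (y k - x k))"
             "\<And>k i. \<xi> k i \<in> closed_segment (x i) (y i)"
proof -
  have "F (override_on x y B) = F y"
    by (rule depends_only_onD[OF assms(3)]) auto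
  then show ?thesis using coord_mvt_on[OF assms(1,2), of x y] that by auto
qed

lemma tendsto_config_iff:
  fixes f :: "'a \<Rightarrow> 'i \<Rightarrow> real"
  shows "(f \<longlongrightarrow> l) G \<longleftrightarrow> (\<forall>i. ((\<lambda>t. f t i) \<longlongrightarrow> l i) G)"
  using limitin_componentwise[of "\<lambda>_::'i. euclideanreal" UNIV f l G]
  by (simp add: euclidean_product_topology)

lemma closed_segment_tendsto:
  fixes x :: real
  assumes "\<And>t. z t \<in> closed_segment x (y t)" "(y \<longlongrightarrow> x) G"
  shows "(z \<longlongrightarrow> x) G"
proof -
  have "norm (z t - x) \<le> norm (y t - x)" for t
    using assms(1)[of t] by (auto simp: closed_segment_eq_real_ivl split: if_splits)
  moreover have "((\<lambda>t. norm (y t - x)) \<longlongrightarrow> 0) G"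
    using assms(2) by (intro tendsto_norm_zero LIM_zero)
  ultimately have "((\<lambda>t. z t - x) \<longlongrightarrow> 0) G"
    using Lim_null_comparison[of "\<lambda>t. z t - x" "\<lambda>t. norm (y t - x)" G] by (simp add: always_eventually)
  then show ?thesis by (rule LIM_zero_cancel)
qed

text \<open>A substitute for total differentiability: the coefficients are partial derivatives at
  the intermediate points, which are squeezed to \<open>x\<close>. Continuity and the chain rule
  both follow from this expansion.\<close>

lemma coord_expansion:
  fixes F :: "('d::finite) config \<Rightarrow> real"
  assumes "coord_differentiable F" "finite B" "depends_only_on F B"
    "\<And>i. continuous_on UNIV (pd F i)" "(y \<longlongrightarrow> x) G"
  obtains c where "\<And>t. F (y t) - F x = (\<Sum>k\<in>B. c k t * (y t k - x k))"
     "\<And>k. ((c k) \<longlongrightarrow> pd F k x) G"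
proof -
  have "\<exists>\<xi>. F (y t) - F x = (\<Sum>k\<in>B. pd F k (\<xi> k) * (y t k - x k)) \<and>
         (\<forall>k i. \<xi> k i \<in> closed_segment (x i) (y t i))" for t
    using coord_mvt[OF assms(1-3), of "y t" x] by metis
  then obtain \<xi> where \<xi>: "\<And>t. F (y t) - F x = (\<Sum>k\<in>B. pd F k (\<xi> t k) * (y t k - x k))"
      "\<And>t k i. \<xi> t k i \<in> closed_segment (x i) (y t i)" by metis
  have "((\<lambda>t. \<xi> t k) \<longlongrightarrow> x) G" for k
    unfolding tendsto_config_iff
  proof
    fix i
    have "((\<lambda>t. y t i) \<longlongrightarrow> x i) G" using assms(5) unfolding tendsto_config_iff by blast
    then show "((\<lambda>t. \<xi> t k i) \<longlongrightarrow> x i) G"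
      by (rule closed_segment_tendsto[rotated]) (rule \<xi>(2))
  qed
  moreover have "isCont (pd F k) x" for k
    using assms(4) by (simp add: continuous_on_eq_continuous_at)
  ultimately have "((\<lambda>t. pd F k (\<xi> t k)) \<longlongrightarrow> pd F k x) G" for k
    using isCont_tendsto_compose by blast
  then show ?thesis using that[of "\<lambda>k t. pd F k (\<xi> t k)"] \<xi>(1) by blast
qed

lemma coord_continuous:
  fixes F :: "('d::finite) config \<Rightarrow> real"
  assumes "coord_differentiable F" "finite B" "depends_only_on F B"
    "\<And>i. continuous_on UNIV (pd F i)"
  shows "continuous_on UNIV F"
  unfolding continuous_on_def
proof
  fix x :: "'d config"
  have "((\<lambda>y. y) \<longlongrightarrow> x) (at x)" by simp
  then obtain c where c: "\<And>y. F y - F x = (\<Sum>k\<in>B. c k y * (y k - x k))"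
     "\<And>k. ((c k) \<longlongrightarrow> pd F k x) (at x)"
    using coord_expansion[OF assms, of "\<lambda>y. y" x "at x"] by blast
  have "((\<lambda>y. y k) \<longlongrightarrow> x k) (at x)" for k
    using tendsto_config_iff[of "\<lambda>y. y" x "at x"] by simp
  then have "((\<lambda>y. \<Sum>k\<in>B. c k y * (y k - x k)) \<longlongrightarrow> (\<Sum>k\<in>B. pd F k x * (x k - x k))) (at x)"
    by (intro tendsto_intros c)
  then have "((\<lambda>y. F y - F x) \<longlongrightarrow> 0) (at x)" by (simp add: c(1))
  then show "(F \<longlongrightarrow> F x) (at x within UNIV)" by (rule LIM_zero_cancel)
qed

lemma coord_chain_rule:
  fixes F :: "('d::finite) config \<Rightarrow> real"
  assumes "coord_differentiable F" "finite B" "depends_only_on F B"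
    "\<And>i. continuous_on UNIV (pd F i)"
    "\<And>i. ((\<lambda>s. \<gamma> s i) has_real_derivative v i) (at t)"
  shows "((\<lambda>s. F (\<gamma> s)) has_real_derivative (\<Sum>k\<in>B. pd F k (\<gamma> t) * v k)) (at t)"
proof -
  have "((\<lambda>s. \<gamma> s i) \<longlongrightarrow> \<gamma> t i) (at t)" for i
    using DERIV_isCont[OF assms(5)] by (simp add: isCont_def)
  then have "(\<gamma> \<longlongrightarrow> \<gamma> t) (at t)" unfolding tendsto_config_iff by blast
  then obtain c where c: "\<And>s. F (\<gamma> s) - F (\<gamma> t) = (\<Sum>k\<in>B. c k s * (\<gamma> s k - \<gamma> t k))"
     "\<And>k. ((c k) \<longlongrightarrow> pd F k (\<gamma> t)) (at t)"
    using coord_expansion[OF assms(1-4), of \<gamma> "\<gamma> t" "at t"] by blast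
  have "((\<lambda>s. \<Sum>k\<in>B. c k s * ((\<gamma> s k - \<gamma> t k) / (s - t))) \<longlongrightarrow> (\<Sum>k\<in>B. pd F k (\<gamma> t) * v k)) (at t)"
    using assms(5) by (intro tendsto_intros c) (auto simp: has_field_derivative_iff)
  then show ?thesis
    by (simp add: has_field_derivative_iff c(1) sum_divide_distrib)
qed

section \<open>Local potentials and the gradient field\<close>

abbreviation origin :: "'d site" where "origin \<equiv> (\<lambda>_. 0)"

section \<open>Geometry of the lattice and of the translations\<close>

lemma norm1_triangle: "norm1 (site_add a b) \<le> norm1 a + norm1 b"
  unfolding norm1_def site_add_def sum.distrib[symmetric]
  by (intro sum_mono) linarith

lemma site_diff_self: "site_diff i i = origin"
  by (simp add: site_diff_def)

lemma norm1_origin: "norm1 origin = 0"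
  by (simp add: norm1_def)

lemma norm1_diff_commute: "norm1 (site_diff a b) = norm1 (site_diff b a)"
  unfolding norm1_def site_diff_def by (intro sum.cong) auto

lemma norm1_ge_coord: "real_of_int \<bar>i m\<bar> \<le> norm1 i"
  unfolding norm1_def by (intro member_le_sum) auto

lemma site_simps:
  "site_add i origin = i"
  "site_add origin i = i"
  "site_diff (site_add i k) k = i"
  "site_diff (site_add k i) k = i"
  "site_add (site_diff i k) k = i"
  "site_add k (site_diff i k) = i"
  "site_diff i origin = i"
  "site_diff (site_add i k) (site_add j k) = site_diff i j"
  "site_diff (site_add k i) (site_add k j) = site_diff i j"
  by (auto simp: site_add_def site_diff_def)

lemma site_add_assoc: "site_add (site_add i j) k = site_add i (site_add j k)"
  by (simp add: site_add_def add.assoc)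

lemma site_add_commute: "site_add i j = site_add j i"
  by (simp add: site_add_def add.commute)

lemma mem_ball1_sym: "k \<in> ball1 j s \<longleftrightarrow> j \<in> ball1 k s"
  by (simp add: ball1_def norm1_diff_commute)

lemma mem_ball1_self: "0 \<le> s \<Longrightarrow> i \<in> ball1 i s"
  by (simp add: ball1_def site_diff_self norm1_origin)

lemma mem_ball1_trans: "k \<in> ball1 j s \<Longrightarrow> j \<in> ball1 i t \<Longrightarrow> k \<in> ball1 i (s + t)"
  using norm1_triangle[of "site_diff k j" "site_diff j i"]
  by (auto simp: ball1_def site_add_def site_diff_def)

lemma mem_ball1_shift: "site_add k a \<in> ball1 (site_add j a) s \<longleftrightarrow> k \<in> ball1 j s"
  by (simp add: ball1_def site_simps)

lemma ball1_eq_image: "ball1 i s = (\<lambda>k. site_add k i) ` ball1 origin s"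
proof
  show "ball1 i s \<subseteq> (\<lambda>k. site_add k i) ` ball1 origin s"
  proof
    fix k assume "k \<in> ball1 i s"
    then have "site_diff k i \<in> ball1 origin s" by (simp add: ball1_def site_simps)
    then show "k \<in> (\<lambda>k. site_add k i) ` ball1 origin s"
      by (intro image_eqI[of _ _ "site_diff k i"]) (auto simp: site_simps)
  qed
qed (auto simp: ball1_def site_simps)

lemma inj_site_add: "inj (\<lambda>k. site_add k i)"
  by (rule inj_on_inverseI[of _ "\<lambda>k. site_diff k i"]) (simp add: site_simps)

lemma finite_ball1: "finite (ball1 i s)"
proof -
  have "ball1 origin s \<subseteq> PiE UNIV (\<lambda>_. {-\<lceil>s\<rceil>..\<lceil>s\<rceil>})"
  proof (intro subsetI PiE_I)
    fix k m assume "k \<in> ball1 origin s"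
    then have "real_of_int \<bar>k m\<bar> \<le> s"
      using norm1_ge_coord[of k m] by (simp add: ball1_def site_simps)
    then show "k m \<in> {-\<lceil>s\<rceil>..\<lceil>s\<rceil>}" by (auto simp: abs_if split: if_splits; linarith)
  qed auto
  then have "finite (ball1 (origin :: 'a site) s)"
    by (rule finite_subset) (auto intro!: finite_PiE)
  then show ?thesis by (subst ball1_eq_image) simp
qed

lemma card_ball1: "card (ball1 (i :: ('d::finite) site) s) = card (ball1 (origin :: 'd site) s)"
proof -
  have "inj_on (\<lambda>k. site_add k i) (ball1 origin s)"
    by (rule inj_on_subset[OF inj_site_add]) simp
  then show ?thesis by (simp add: ball1_eq_image[of i] card_image)
qed

lemma tau_apply: "tau k l x i = x (site_add i k) + of_int l"
  by (simp add: tau_def)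

lemma tau_tau: "tau k l (tau k' l' x) = tau (site_add k k') (l + l') x"
  by (simp add: tau_def site_add_assoc add_ac)

lemma tau_zero: "tau origin 0 x = x"
  by (simp add: tau_def site_simps)

lemma tau_mono: "x \<le> y \<Longrightarrow> tau k l x \<le> tau k l y"
  by (simp add: le_fun_def tau_def)

text \<open>With \<open>v = x - inf x y\<close> one has \<open>sup x y = y + v\<close> and
  \<open>x = inf x y + v\<close>, so the claim compares the increment \<open>H\<close> of
  \<open>F\<close> in direction \<open>v\<close> at \<open>y\<close> and at \<open>inf x y\<close>.
  The vectors \<open>v\<close> and \<open>y - inf x y\<close> have disjoint supports, hence only
  mixed second derivatives enter and \<open>H\<close> decreases from \<open>inf x y\<close> to
  \<open>y\<close>.\<close>

lemma submodular_of_pd2_nonpos: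
  fixes F :: "('d::finite) config \<Rightarrow> real"
  assumes F: "coord_differentiable F" "\<And>i. coord_differentiable (pd F i)"
    "finite B" "depends_only_on F B" "\<And>i k x. i \<noteq> k \<Longrightarrow> pd2 F i k x \<le> 0"
  shows "F (inf x y) + F (sup x y) \<le> F x + F y"
proof -
  have mono: "pd F i b \<le> pd F i a" if "a \<le> b" "a i = b i" for a b i
  proof -
    obtain \<xi> where \<xi>: "pd F i b - pd F i a = (\<Sum>k\<in>B. pd (pd F i) k (\<xi> k) * (b k - a k))"
      using coord_mvt[OF F(2) F(3) depends_only_on_pd[OF F(4)]] by metis
    have "(\<Sum>k\<in>B. pd (pd F i) k (\<xi> k) * (b k - a k)) \<le> 0"
    proof (rule sum_nonpos)
      fix k
      show "pd (pd F i) k (\<xi> k) * (b k - a k) \<le> 0"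
        using that F(5)[of i k "\<xi> k"]
        by (cases "i = k") (auto simp: pd2_def le_fun_def mult_le_0_iff)
    qed
    then show ?thesis using \<xi> by linarith
  qed
  define v where "v = (\<lambda>i. x i - inf x y i)"
  define H where "H = (\<lambda>z. F (\<lambda>i. z i + v i) - F z)"
  have der: "((\<lambda>t. H (z(i := t))) has_real_derivative
        pd F i (\<lambda>j. (z(i:=s)) j + v j) - pd F i (z(i:=s))) (at s)" for z i s
  proof -
    have e: "(\<lambda>j. (z(i := t)) j + v j) = (\<lambda>j. z j + v j)(i := t + v i)" for t by auto
    have "((\<lambda>t. F ((\<lambda>j. z j + v j)(i := t))) has_real_derivative
        pd F i ((\<lambda>j. z j + v j)(i := s + v i))) (at (s + v i))"
      by (rule pd_has_deriv[OF F(1)])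
    then have "((\<lambda>t. F ((\<lambda>j. z j + v j)(i := t + v i))) has_real_derivative
        pd F i ((\<lambda>j. z j + v j)(i := s + v i))) (at s)"
      by (simp add: DERIV_shift)
    then show ?thesis unfolding H_def e
      by (intro DERIV_diff pd_has_deriv[OF F(1)])
  qed
  have pdH: "pd H i z = pd F i (\<lambda>j. z j + v j) - pd F i z" for i z
    using der[of z i "z i"] unfolding pd_def[of H] by (intro DERIV_imp_deriv) simp
  have Hd: "coord_differentiable H"
    unfolding coord_differentiable_def using der real_differentiable_def by blast
  have Hdep: "depends_only_on H B"
    unfolding depends_only_on_def H_def
  proof (intro allI impI)
    fix a b :: "'d config" assume ab: "\<forall>k\<in>B. a k = b k"
    have "F a = F b" "F (\<lambda>i. a i + v i) = F (\<lambda>i. b i + v i)"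
      by (rule depends_only_onD[OF F(4)]; use ab in simp)+
    then show "F (\<lambda>i. a i + v i) - F a = F (\<lambda>i. b i + v i) - F b" by simp
  qed
  obtain \<xi> where \<xi>: "H y - H (inf x y) = (\<Sum>k\<in>B. pd H k (\<xi> k) * (y k - inf x y k))"
    using coord_mvt[OF Hd F(3) Hdep] by metis
  have vn: "0 \<le> v i" for i by (simp add: v_def)
  have "(\<Sum>k\<in>B. pd H k (\<xi> k) * (y k - inf x y k)) \<le> 0"
  proof (rule sum_nonpos)
    fix k
    show "pd H k (\<xi> k) * (y k - inf x y k) \<le> 0"
    proof (cases "y k \<le> x k")
      case True then show ?thesis by (simp add: inf_min min_def)
    next
      case False
      then have "v k = 0" by (simp add: v_def inf_min)
      then have "pd H k (\<xi> k) \<le> 0"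
        unfolding pdH using mono[of "\<xi> k" "\<lambda>j. \<xi> k j + v j" k] vn by (simp add: le_fun_def)
      then show ?thesis by (simp add: mult_nonpos_nonneg)
    qed
  qed
  moreover have "(\<lambda>i. y i + v i) = sup x y" "(\<lambda>i. inf x y i + v i) = x"
    by (auto simp: v_def inf_min sup_max)
  ultimately show ?thesis using \<xi> by (simp add: H_def)
qed

section \<open>The gradient field: equivariance, Lipschitz bounds, cooperativity\<close>

locale lattice_potentials =
  fixes r :: real and S :: "('d::finite) site \<Rightarrow> 'd config \<Rightarrow> real"
  assumes lp: "local_potentials r S"
begin

abbreviation g :: "'d config \<Rightarrow> 'd config" where "g \<equiv> gradW r S"

lemma r_pos: "0 < r"
  using lp by (simp add: local_potentials_def)

lemma S_dep: "depends_only_on (S j) (ball1 j r)"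
  using lp by (simp add: local_potentials_def)

lemma S_C2: "C2_coord (S j)"
  using lp by (simp add: local_potentials_def)

lemma S_diff: "coord_differentiable (S j)"
  using S_C2[of j] by (simp add: C2_coord_def coord_differentiable_def)

lemma pdS_diff: "coord_differentiable (pd (S j) i)"
  using S_C2[of j] by (simp add: C2_coord_def coord_differentiable_def)

lemma pdS_cont: "continuous_on UNIV (pd (S j) i)"
  using S_C2[of j] by (simp add: C2_coord_def)

lemma S_cont: "continuous_on UNIV (S j)"
  using coord_continuous[OF S_diff finite_ball1 S_dep pdS_cont] .

lemma S_tau: "S j (tau k l x) = S (site_add j k) x"
  using lp by (simp add: local_potentials_def)

lemma S_bdd_below: "\<exists>c. \<forall>x. c \<le> S j x"
  using lp by (simp add: local_potentials_def)

lemma S_coercive: "norm1 (site_diff k j) = 1 \<Longrightarrow> \<exists>R. \<forall>x. R \<le> \<bar>x k - x j\<bar> \<longrightarrow> M \<le> S j x"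
  using lp by (simp add: local_potentials_def)

lemma S_pd2_nonpos: "i \<noteq> k \<Longrightarrow> pd2 (S j) i k x \<le> 0"
  using lp by (simp add: local_potentials_def)

lemma S_pd2_neg: "norm1 (site_diff i k) = 1 \<Longrightarrow> pd2 (S i) i k x < 0"
  using lp by (simp add: local_potentials_def)

lemma S_submodular: "S j (inf x y) + S j (sup x y) \<le> S j x + S j y"
  by (rule submodular_of_pd2_nonpos[OF S_diff pdS_diff finite_ball1 S_dep S_pd2_nonpos])

lemma pdS_tau: "pd (S j) i (tau k l x) = pd (S (site_add j k)) (site_add i k) x"
proof -
  have e: "(tau k l x)(i := t) = tau k l (x(site_add i k := t - of_int l))" for t
  proof
    fix m
    show "((tau k l x)(i := t)) m = tau k l (x(site_add i k := t - of_int l)) m"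
      using injD[OF inj_site_add, of m k i] by (auto simp: tau_apply)
  qed
  let ?h = "\<lambda>t. S (site_add j k) (x(site_add i k := t))"
  have "(?h has_real_derivative pd (S (site_add j k)) (site_add i k) (x(site_add i k := x (site_add i k))))
       (at (x (site_add i k)))"
    by (rule pd_has_deriv[OF S_diff])
  then have "((\<lambda>t. ?h (t + (- of_int l))) has_real_derivative pd (S (site_add j k)) (site_add i k) x)
      (at (x (site_add i k) + of_int l))"
    using DERIV_shift[of ?h _ "x (site_add i k) + of_int l" "- of_int l"] by simp
  then show ?thesis
    unfolding pd_def[of "S j" i] e S_tau
    by (intro DERIV_imp_deriv) (simp add: tau_apply)
qed

lemma g_tau: "g (tau k l x) i = g x (site_add i k)"
proof -
  have "(\<Sum>j\<in>ball1 i r. pd (S j) i (tau k l x)) = (\<Sum>j\<in>ball1 i r. pd (S (site_add j k)) (site_add i k) x)"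
    by (simp add: pdS_tau)
  also have "\<dots> = (\<Sum>j\<in>(\<lambda>j. site_add j k) ` ball1 i r. pd (S j) (site_add i k) x)"
    by (subst sum.reindex) (auto intro: inj_on_subset[OF inj_site_add])
  also have "(\<lambda>j. site_add j k) ` ball1 i r = ball1 (site_add i k) r"
    by (simp add: ball1_eq_image[of i] ball1_eq_image[of "site_add i k"] image_image site_add_assoc)
  finally show ?thesis by (simp add: gradW_def)
qed

lemma g_dep: "depends_only_on (\<lambda>x. g x i) (ball1 i (2 * r))"
  unfolding depends_only_on_def gradW_def
proof (intro allI impI sum.cong refl)
  fix x y :: "'d config" and j assume xy: "\<forall>k\<in>ball1 i (2 * r). x k = y k" and j: "j \<in> ball1 i r"
  show "pd (S j) i x = pd (S j) i y"
  proof (rule depends_only_onD[OF depends_only_on_pd[OF S_dep]])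
    fix k assume "k \<in> ball1 j r"
    then have "k \<in> ball1 i (r + r)" using j by (rule mem_ball1_trans)
    then show "x k = y k" using xy by simp
  qed
qed

lemma g_has_deriv:
  "((\<lambda>t. g (x(k := t)) i) has_real_derivative (\<Sum>j\<in>ball1 i r. pd2 (S j) i k (x(k := s)))) (at s)"
  unfolding gradW_def pd2_def
  by (intro DERIV_sum pd_has_deriv[OF pdS_diff])

lemma g_diff: "coord_differentiable (\<lambda>x. g x i)"
  unfolding coord_differentiable_def using g_has_deriv real_differentiable_def by blast

lemma pd_g: "pd (\<lambda>x. g x i) k x = (\<Sum>j\<in>ball1 i r. pd2 (S j) i k x)"
  using g_has_deriv[of x k i "x k"] unfolding pd_def[of "\<lambda>x. g x i"]
  by (intro DERIV_imp_deriv) simp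

lemma g_cont: "continuous_on UNIV (\<lambda>x. g x i)"
  unfolding gradW_def by (intro continuous_on_sum pdS_cont)

lemma g_mvt:
  obtains \<xi> where "g y i - g x i =
     (\<Sum>k\<in>ball1 i (2 * r). (\<Sum>j\<in>ball1 i r. pd2 (S j) i k (\<xi> k)) * (y k - x k))"
proof (rule coord_mvt[OF g_diff finite_ball1 g_dep, of y i x])
qed (unfold pd_g, rule that)

lemma g_lipschitz_ex:
  "\<exists>K>0. \<forall>x y i. \<bar>g y i - g x i\<bar> \<le> K * (\<Sum>k\<in>ball1 i (2 * r). \<bar>y k - x k\<bar>)"
proof -
  have "\<exists>C. \<forall>i k j x. \<bar>pd2 (S j) i k x\<bar> \<le> C"
    using lp unfolding local_potentials_def by (elim conjE)
  then obtain C where "\<forall>i k j x. \<bar>pd2 (S j) i k x\<bar> \<le> C" ..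
  then have C: "\<bar>pd2 (S j) i k x\<bar> \<le> C" for i k j x by simp
  define N where "N = real (card (ball1 (origin :: 'd site) r))"
  have C0: "C \<ge> 0" using C[of origin origin origin "\<lambda>_. 0"] by linarith
  have N0: "N \<ge> 0" by (simp add: N_def)
  show ?thesis
  proof (intro exI[of _ "N * C + 1"] conjI allI)
    show "N * C + 1 > 0" using C0 N0 by (simp add: add_nonneg_pos)
    fix x y :: "'d config" and i
    obtain \<xi> where \<xi>: "g y i - g x i =
     (\<Sum>k\<in>ball1 i (2 * r). (\<Sum>j\<in>ball1 i r. pd2 (S j) i k (\<xi> k)) * (y k - x k))"
      by (rule g_mvt)
    have b: "\<bar>\<Sum>j\<in>ball1 i r. pd2 (S j) i k z\<bar> \<le> N * C" for k z
    proof -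
      have "\<bar>\<Sum>j\<in>ball1 i r. pd2 (S j) i k z\<bar> \<le> (\<Sum>j\<in>ball1 i r. C)"
        using C by (intro order_trans[OF sum_abs] sum_mono)
      then show ?thesis by (simp add: N_def card_ball1[of i])
    qed
    have "\<bar>g y i - g x i\<bar> \<le> (\<Sum>k\<in>ball1 i (2 * r). \<bar>(\<Sum>j\<in>ball1 i r. pd2 (S j) i k (\<xi> k)) * (y k - x k)\<bar>)"
      unfolding \<xi> by (rule sum_abs)
    also have "\<dots> \<le> (\<Sum>k\<in>ball1 i (2 * r). (N * C + 1) * \<bar>y k - x k\<bar>)"
      unfolding abs_mult by (intro sum_mono mult_right_mono order_trans[OF b]) auto
    finally show "\<bar>g y i - g x i\<bar> \<le> (N * C + 1) * (\<Sum>k\<in>ball1 i (2 * r). \<bar>y k - x k\<bar>)"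
      by (simp add: sum_distrib_left)
  qed
qed

text \<open>\<open>K\<close> controls the change of one coordinate and serves in the one-sided
  bounds; the constant \<open>L\<close> below is its counterpart for the supremum norm. All
  exponential rates are built from these two.\<close>

definition K :: real where
  "K = (SOME K. K > 0 \<and> (\<forall>x y i. \<bar>g y i - g x i\<bar> \<le> K * (\<Sum>k\<in>ball1 i (2 * r). \<bar>y k - x k\<bar>)))"

lemma K_pos: "K > 0"
  and g_lipschitz: "\<bar>g y i - g x i\<bar> \<le> K * (\<Sum>k\<in>ball1 i (2 * r). \<bar>y k - x k\<bar>)"
proof -
  have "K > 0 \<and> (\<forall>x y i. \<bar>g y i - g x i\<bar> \<le> K * (\<Sum>k\<in>ball1 i (2 * r). \<bar>y k - x k\<bar>))"
    unfolding K_def using g_lipschitz_ex by (rule someI_ex)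
  then show "K > 0" "\<bar>g y i - g x i\<bar> \<le> K * (\<Sum>k\<in>ball1 i (2 * r). \<bar>y k - x k\<bar>)" by blast+
qed

definition L :: real where "L = K * real (card (ball1 (origin :: 'd site) (2 * r)))"

lemma L_pos: "L > 0"
proof -
  have "origin \<in> ball1 (origin :: 'd site) (2 * r)" using r_pos by (intro mem_ball1_self) simp
  then have "card (ball1 (origin :: 'd site) (2 * r)) > 0"
    using finite_ball1 card_gt_0_iff by blast
  then show ?thesis using K_pos by (simp add: L_def)
qed

lemma g_lipschitz_sup:
  assumes "\<And>k. \<bar>y k - x k\<bar> \<le> c"
  shows "\<bar>g y i - g x i\<bar> \<le> L * c"
proof -
  have "(\<Sum>k\<in>ball1 i (2 * r). \<bar>y k - x k\<bar>) \<le> (\<Sum>k\<in>ball1 i (2 * r). c)"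
    using assms by (intro sum_mono)
  then have "K * (\<Sum>k\<in>ball1 i (2 * r). \<bar>y k - x k\<bar>) \<le> K * (real (card (ball1 (origin :: 'd site) (2 * r))) * c)"
    using K_pos by (simp add: card_ball1[of i])
  then show ?thesis using g_lipschitz[of y i x] by (simp add: L_def)
qed

text \<open>The Kamke condition for the field \<open>- g\<close>: off-diagonal derivatives of
  \<open>g\<close> are sums of mixed second derivatives of the potentials, which (D) makes
  nonpositive, and the diagonal one is multiplied by zero.\<close>

lemma g_antimono:
  assumes "x \<le> y" "x i = y i" shows "g y i \<le> g x i"
proof -
  obtain \<xi> where \<xi>: "g y i - g x i =
     (\<Sum>k\<in>ball1 i (2 * r). (\<Sum>j\<in>ball1 i r. pd2 (S j) i k (\<xi> k)) * (y k - x k))"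
    by (rule g_mvt)
  have "(\<Sum>k\<in>ball1 i (2 * r). (\<Sum>j\<in>ball1 i r. pd2 (S j) i k (\<xi> k)) * (y k - x k)) \<le> 0"
  proof (rule sum_nonpos)
    fix k
    show "(\<Sum>j\<in>ball1 i r. pd2 (S j) i k (\<xi> k)) * (y k - x k) \<le> 0"
    proof (cases "k = i")
      case True then show ?thesis using assms by simp
    next
      case False
      then have "(\<Sum>j\<in>ball1 i r. pd2 (S j) i k (\<xi> k)) \<le> 0"
        using S_pd2_nonpos by (intro sum_nonpos) auto
      then show ?thesis using assms by (simp add: le_fun_def mult_nonpos_nonneg)
    qed
  qed
  then show ?thesis using \<xi> by linarith
qed

lemma g_strict_antimono:
  assumes "x \<le> y" "x i = y i" "norm1 (site_diff i k) = 1" "x k < y k"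
  shows "g y i < g x i"
proof -
  define z where "z = x(k := y k)"
  have ki: "k \<noteq> i" using assms(3) by (auto simp: site_diff_self norm1_origin)
  have "g y i \<le> g z i"
    using assms ki by (intro g_antimono) (auto simp: z_def le_fun_def)
  also have "g z i < g (x(k := x k)) i"
    unfolding z_def
  proof (rule DERIV_neg_imp_decreasing[OF assms(4)])
    fix t
    have i: "i \<in> ball1 i r" using r_pos by (intro mem_ball1_self) simp
    \<comment> \<open>Strict negativity is assumed only for the potential centred at
      \<open>i\<close> itself; the other summands are merely nonpositive.\<close>
    have "(\<Sum>j\<in>ball1 i r. pd2 (S j) i k (x(k := t))) =
      pd2 (S i) i k (x(k := t)) + (\<Sum>j\<in>ball1 i r - {i}. pd2 (S j) i k (x(k := t)))"
      using i finite_ball1 by (rule sum.remove[rotated])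
    also have "\<dots> < 0"
      using S_pd2_neg[OF assms(3), of "x(k := t)"] ki
      by (intro add_neg_nonpos sum_nonpos S_pd2_nonpos) auto
    finally show "\<exists>y. ((\<lambda>t. g (x(k := t)) i) has_real_derivative y) (at t) \<and> y < 0"
      using g_has_deriv by blast
  qed
  finally show ?thesis by simp
qed

lemma g_upd_lipschitz: "\<bar>g y i - g (y(i := c)) i\<bar> \<le> K * \<bar>y i - c\<bar>"
proof -
  have "(\<Sum>k\<in>ball1 i (2 * r). \<bar>y k - (y(i := c)) k\<bar>) = (\<Sum>k\<in>{i}. \<bar>y k - (y(i := c)) k\<bar>)"
    using r_pos finite_ball1 by (intro sum.mono_neutral_right) (auto intro: mem_ball1_self)
  then show ?thesis using g_lipschitz[of y i "y(i := c)"] by simp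
qed

text \<open>Lowering the coordinate \<open>i\<close> of \<open>y\<close> to \<open>x i\<close> costs
  at most \<open>K * (y i - x i)\<close>; what remains is \<open>g_antimono\<close>. As a
  consequence \<open>exp (K * s)\<close> times the difference of two ordered solutions is
  nondecreasing in time.\<close>

lemma g_one_sided:
  assumes "x \<le> y" shows "g y i - g x i \<le> K * (y i - x i)"
proof -
  have "x \<le> y(i := x i)" using assms by (simp add: le_fun_def)
  then have "g (y(i := x i)) i \<le> g x i" by (rule g_antimono) simp
  moreover have "x i \<le> y i" using assms by (rule le_funD)
  ultimately show ?thesis using g_upd_lipschitz[of y i "x i"] by simp
qed

lemma g_one_sided_strict:
  assumes "x \<le> y" "norm1 (site_diff i k) = 1" "x k < y k"
  shows "g y i - g x i < K * (y i - x i)"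
proof -
  have "k \<noteq> i" using assms(2) by (auto simp: site_diff_self norm1_origin)
  have "x \<le> y(i := x i)" using assms by (simp add: le_fun_def)
  then have "g (y(i := x i)) i < g x i"
    by (rule g_strict_antimono) (use assms \<open>k \<noteq> i\<close> in auto)
  moreover have "x i \<le> y i" using assms(1) by (rule le_funD)
  ultimately show ?thesis using g_upd_lipschitz[of y i "x i"] by simp
qed

end

section \<open>Uniqueness of the flow\<close>

text \<open>The exponential form is preserved by integration and gains the factor
  \<open>1 / \<rho>\<close>. Against a Lipschitz constant \<open>L\<close>, the rate
  \<open>\<rho> = 2 * L\<close> turns each integration into a contraction by one half on an
  unbounded time interval.\<close>

lemma growth_bound_above:
  fixes u :: "real \<Rightarrow> real"
  assumes "0 \<le> t" "0 < \<rho>"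
    and d: "\<And>s. 0 \<le> s \<Longrightarrow> s \<le> t \<Longrightarrow> (u has_real_derivative u' s) (at s)"
    and b: "\<And>s. 0 \<le> s \<Longrightarrow> s \<le> t \<Longrightarrow> u' s \<le> A * exp (\<rho> * s)"
  shows "u t - u 0 \<le> A / \<rho> * (exp (\<rho> * t) - 1)"
proof -
  let ?v = "\<lambda>s. A / \<rho> * exp (\<rho> * s) - u s"
  have "?v 0 \<le> ?v t"
  proof (rule DERIV_nonneg_imp_nondecreasing[OF assms(1)])
    fix s assume s: "0 \<le> s" "s \<le> t"
    have "(?v has_real_derivative (A / \<rho> * (exp (\<rho> * s) * \<rho>) - u' s)) (at s)"
      by (auto intro!: derivative_eq_intros d s)
    moreover have "A / \<rho> * (exp (\<rho> * s) * \<rho>) - u' s \<ge> 0"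
      using b[OF s] assms(2) by simp
    ultimately show "\<exists>y. (?v has_real_derivative y) (at s) \<and> 0 \<le> y" by blast
  qed
  then show ?thesis by (simp add: right_diff_distrib)
qed

lemma growth_bound:
  fixes u :: "real \<Rightarrow> real"
  assumes "0 < \<rho>"
    and d: "\<And>s. (u has_real_derivative u' s) (at s)"
    and b: "\<And>s. \<bar>s\<bar> \<le> \<bar>t\<bar> \<Longrightarrow> \<bar>u' s\<bar> \<le> A * exp (\<rho> * \<bar>s\<bar>)"
  shows "\<bar>u t - u 0\<bar> \<le> A / \<rho> * (exp (\<rho> * \<bar>t\<bar>) - 1)"
proof -
  \<comment> \<open>Used for \<open>u\<close>, for \<open>- u\<close> and for the time reversals of
    both.\<close>
  have *: "w \<bar>t\<bar> - w 0 \<le> A / \<rho> * (exp (\<rho> * \<bar>t\<bar>) - 1)"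
    if "\<And>s. (w has_real_derivative w' s) (at s)" "\<And>s. \<bar>s\<bar> \<le> \<bar>t\<bar> \<Longrightarrow> \<bar>w' s\<bar> \<le> A * exp (\<rho> * \<bar>s\<bar>)"
    for w w' :: "real \<Rightarrow> real"
  proof (rule growth_bound_above[where u' = w'])
    fix s assume "0 \<le> s" "s \<le> \<bar>t\<bar>"
    then show "w' s \<le> A * exp (\<rho> * s)" using that(2)[of s] by simp
  qed (use that assms(1) in auto)
  have du: "((\<lambda>s. u (- s)) has_real_derivative - u' (- s)) (at s)" for s
    using d[of "- s"] by (simp add: DERIV_mirror)
  have 1: "u \<bar>t\<bar> - u 0 \<le> A / \<rho> * (exp (\<rho> * \<bar>t\<bar>) - 1)"
    using *[of u u'] d b by simp
  have 2: "- u \<bar>t\<bar> - - u 0 \<le> A / \<rho> * (exp (\<rho> * \<bar>t\<bar>) - 1)"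
    by (rule *[of "\<lambda>s. - u s" "\<lambda>s. - u' s"]) (auto intro!: DERIV_minus d b)
  have 3: "u (-\<bar>t\<bar>) - u 0 \<le> A / \<rho> * (exp (\<rho> * \<bar>t\<bar>) - 1)"
    using *[of "\<lambda>s. u (- s)" "\<lambda>s. - u' (- s)"] du b[of "- s" for s] by simp
  have 4: "- u (-\<bar>t\<bar>) - - u 0 \<le> A / \<rho> * (exp (\<rho> * \<bar>t\<bar>) - 1)"
    using *[of "\<lambda>s. - u (- s)" "\<lambda>s. u' (- s)"] DERIV_minus[OF du] b[of "- s" for s] by simp
  show ?thesis using 1 2 3 4 by (cases "t \<ge> 0") auto
qed

lemma geometric_convergence:
  fixes a :: "nat \<Rightarrow> real"
  assumes "\<And>n. \<bar>a (Suc n) - a n\<bar> \<le> B * (1/2) ^ n"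
  obtains l where "a \<longlonglongrightarrow> l" "\<And>n. \<bar>l - a n\<bar> \<le> 2 * B * (1/2) ^ n"
proof -
  have B: "B \<ge> 0" using assms[of 0] by simp
  have fin: "\<bar>a (n + k) - a n\<bar> \<le> 2 * B * (1/2) ^ n - 2 * B * (1/2) ^ (n + k)" for n k
  proof (induction k)
    case (Suc k)
    then show ?case using assms[of "n + k"] by simp
  qed simp
  have fin': "\<bar>a m - a n\<bar> \<le> 2 * B * (1/2) ^ n" if "n \<le> m" for m n
  proof -
    have "0 \<le> 2 * B * (1/2) ^ m" using B by simp
    then show ?thesis using fin[of n "m - n"] that by simp
  qed
  have lim0: "(\<lambda>n. 2 * B * (1/2) ^ n) \<longlonglongrightarrow> 0"
    by (auto intro!: tendsto_mult_right_zero LIMSEQ_power_zero)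
  have "Cauchy a"
  proof (rule metric_CauchyI)
    fix e :: real assume "e > 0"
    then have "\<forall>\<^sub>F n in sequentially. 2 * B * (1/2) ^ n < e / 2"
      using lim0 by (intro order_tendstoD(2)[OF lim0]) simp
    then obtain N where N: "2 * B * (1/2) ^ N < e / 2"
      by (auto simp: eventually_sequentially)
    have "dist (a m) (a n) < e" if "m \<ge> N" "n \<ge> N" for m n
      using fin'[OF that(1)] fin'[OF that(2)] N by (simp add: dist_real_def)
    then show "\<exists>M. \<forall>m\<ge>M. \<forall>n\<ge>M. dist (a m) (a n) < e" by blast
  qed
  then obtain l where l: "a \<longlonglongrightarrow> l" using Cauchy_convergent convergent_def by blast
  have "\<bar>l - a n\<bar> \<le> 2 * B * (1/2) ^ n" for n
  proof (rule tendsto_upperbound)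
    show "(\<lambda>m. \<bar>a m - a n\<bar>) \<longlonglongrightarrow> \<bar>l - a n\<bar>" by (intro tendsto_intros l)
    show "\<forall>\<^sub>F m in sequentially. \<bar>a m - a n\<bar> \<le> 2 * B * (1/2) ^ n"
      using eventually_ge_at_top[of n] by eventually_elim (rule fin')
  qed simp
  then show ?thesis using l that by blast
qed

text \<open>The summand factorises over the coordinates, so each finite partial sum is at most a
  product of two-sided geometric series. The base stays general because both \<open>2\<close> and
  \<open>sqrt 2\<close> occur.\<close>

lemma summable_on_powr_norm1:
  assumes "1 < b" shows "(\<lambda>i :: ('d::finite) site. b powr (- norm1 i)) summable_on UNIV"
proof -
  define f where "f = (\<lambda>j::int. b powr (- real_of_int \<bar>j\<bar>))"
  have geo: "(\<lambda>n::nat. b powr (- real n)) summable_on UNIV"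
  proof -
    have "b powr (- real n) = (1/b) ^ n" for n
      using assms by (simp add: powr_minus powr_realpow power_one_over inverse_eq_divide)
    moreover have "summable (\<lambda>n. (1/b) ^ n)" using assms by (intro summable_geometric) auto
    ultimately show ?thesis
      using assms by (intro norm_summable_imp_summable_on) (simp add: abs_if)
  qed
  have "f summable_on (range int)"
    by (subst summable_on_reindex) (use geo in \<open>auto simp: f_def o_def\<close>)
  moreover have "f summable_on (range (\<lambda>n. - int n))"
    by (subst summable_on_reindex) (use geo in \<open>auto simp: f_def o_def inj_on_def\<close>)
  moreover have "range int \<union> range (\<lambda>n. - int n) = UNIV"
  proof (intro equalityI subsetI UNIV_I)
    fix z show "z \<in> range int \<union> range (\<lambda>n. - int n)"
      by (cases z rule: int_cases2) auto
  qed
  ultimately have fs: "f summable_on UNIV" using summable_on_union by metis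
  have f0: "f j \<ge> 0" for j by (simp add: f_def)
  have w: "b powr (- norm1 i) = (\<Prod>m\<in>UNIV. f (i m))" for i :: "'d site"
    unfolding norm1_def f_def using assms by (simp add: powr_sum[symmetric] sum_negf)
  show ?thesis
  proof (rule nonneg_bdd_above_summable_on)
    show "bdd_above (sum (\<lambda>i :: 'd site. b powr (- norm1 i)) ` {F. F \<subseteq> UNIV \<and> finite F})"
    proof (rule bdd_aboveI2)
      fix F :: "'d site set" assume F: "F \<in> {F. F \<subseteq> UNIV \<and> finite F}"
      define G where "G = (\<lambda>m. (\<lambda>i. i m) ` F)"
      have "(\<Sum>i\<in>F. b powr (- norm1 i)) \<le> (\<Sum>i\<in>PiE UNIV G. \<Prod>m\<in>UNIV. f (i m))"
        unfolding w using F by (intro sum_mono2) (auto simp: G_def f0 intro!: prod_nonneg finite_PiE)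
      also have "\<dots> = (\<Prod>m\<in>UNIV. \<Sum>j\<in>G m. f j)"
        using F by (subst prod_sum_PiE) (auto simp: G_def)
      also have "\<dots> \<le> (\<Prod>m\<in>(UNIV :: 'd set). infsum f UNIV)"
        using F by (intro prod_mono conjI sum_nonneg finite_sum_le_infsum fs) (auto simp: G_def f0)
      finally show "(\<Sum>i\<in>F. b powr (- norm1 i)) \<le> (\<Prod>m\<in>(UNIV :: 'd set). infsum f UNIV)" .
    qed
  qed simp
qed

section \<open>The weighted space and its norm\<close>

lemma weight_pos: "weight i > 0"
  by (simp add: weight_def)

lemma weight_nonneg [simp]: "weight i \<ge> 0"
  by (simp add: weight_def)

lemma weight_summable: "(weight :: ('d::finite) site \<Rightarrow> real) summable_on UNIV"
  using summable_on_powr_norm1[of 2] by (simp add: weight_def[abs_def])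

text \<open>The weight is split into two factors of base \<open>sqrt 2\<close>: one absorbs the
  linear growth, the other provides summability.\<close>

lemma Xspace_linear_growth:
  fixes x :: "('d::finite) config"
  assumes "\<And>i. \<bar>x i\<bar> \<le> A + B * norm1 i" "0 \<le> B"
  shows "x \<in> Xspace"
proof -
  define b :: real where "b = sqrt 2"
  have b: "1 < b" by (simp add: b_def)
  have sq: "2 powr (- s) = b powr (- s) * b powr (- s)" for s
    by (simp add: b_def powr_half_sqrt[symmetric] powr_powr powr_add[symmetric])
  define c where "c = 1 / ln b"
  \<comment> \<open>The value \<open>1 / ln b\<close> comes from
    \<open>s * ln b \<le> exp (s * ln b)\<close>.\<close>
  have c: "c > 0" using b by (simp add: c_def)
  have lin: "s * b powr (- s) \<le> c" for s
  proof -
    have "s * ln b \<le> exp (s * ln b)" using exp_ge_add_one_self[of "s * ln b"] by linarith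
    also have "\<dots> = b powr s" using b by (simp add: powr_def)
    finally have "s \<le> c * b powr s" using b by (simp add: c_def field_simps)
    then show ?thesis using b by (simp add: powr_minus field_simps)
  qed
  have bd: "weight i * \<bar>x i\<bar> \<le> \<bar>A\<bar> * weight i + B * c * b powr (- norm1 i)" for i
  proof -
    have "weight i * \<bar>x i\<bar> \<le> weight i * (\<bar>A\<bar> + B * norm1 i)"
      using assms(1)[of i] weight_pos[of i] by (intro mult_left_mono) auto
    also have "\<dots> = \<bar>A\<bar> * weight i + B * (norm1 i * b powr (- norm1 i)) * b powr (- norm1 i)"
      by (simp add: weight_def sq algebra_simps)
    also have "\<dots> \<le> \<bar>A\<bar> * weight i + B * c * b powr (- norm1 i)"
      using lin[of "norm1 i"] assms(2) by (intro add_left_mono mult_right_mono mult_left_mono) auto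
    finally show ?thesis .
  qed
  have "(\<lambda>i. \<bar>A\<bar> * weight i + B * c * b powr (- norm1 i)) summable_on (UNIV :: 'd site set)"
    by (intro summable_on_add summable_on_cmult_right weight_summable summable_on_powr_norm1 b)
  then have "(\<lambda>i. weight i * \<bar>x i\<bar>) summable_on UNIV"
    by (rule summable_on_comparison_test) (use bd weight_pos in \<open>auto simp: less_imp_le\<close>)
  then show ?thesis by (simp add: Xspace_def)
qed

lemma Xspace_bounded: "(\<And>i. \<bar>x i\<bar> \<le> c) \<Longrightarrow> x \<in> Xspace"
  by (rule Xspace_linear_growth[of x c 0]) auto

lemma Xspace_add_scaled:
  assumes "x \<in> Xspace" "y \<in> Xspace" shows "(\<lambda>i. x i + c * y i) \<in> Xspace"
proof -
  have "(\<lambda>i. weight i * \<bar>x i\<bar> + \<bar>c\<bar> * (weight i * \<bar>y i\<bar>)) summable_on UNIV"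
    using assms by (intro summable_on_add summable_on_cmult_right) (auto simp: Xspace_def)
  then have "(\<lambda>i. weight i * \<bar>x i + c * y i\<bar>) summable_on UNIV"
  proof (rule summable_on_comparison_test)
    fix i
    have "\<bar>x i + c * y i\<bar> \<le> \<bar>x i\<bar> + \<bar>c\<bar> * \<bar>y i\<bar>" by (simp add: abs_mult[symmetric] abs_triangle_ineq)
    from mult_left_mono[OF this, of "weight i"]
    show "weight i * \<bar>x i + c * y i\<bar> \<le> weight i * \<bar>x i\<bar> + \<bar>c\<bar> * (weight i * \<bar>y i\<bar>)"
      using weight_pos[of i] by (simp add: algebra_simps)
    show "0 \<le> weight i * \<bar>x i + c * y i\<bar>" using weight_pos[of i] by simp
  qed
  then show ?thesis by (simp add: Xspace_def)
qed

lemma Xspace_diff: "x \<in> Xspace \<Longrightarrow> y \<in> Xspace \<Longrightarrow> (\<lambda>i. x i - y i) \<in> Xspace"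
  using Xspace_add_scaled[of x y "-1"] by simp

lemma Xspace_shift_const:
  assumes "x \<in> Xspace" shows "(\<lambda>i. c + x i) \<in> Xspace"
  using Xspace_add_scaled[OF Xspace_bounded[of "\<lambda>_. c" "\<bar>c\<bar>"] assms, of 1] by simp

lemma wnorm_finite_sum_le:
  assumes "x \<in> Xspace" "finite F" shows "(\<Sum>i\<in>F. weight i * \<bar>x i\<bar>) \<le> wnorm x"
  unfolding wnorm_def using assms weight_pos
  by (intro finite_sum_le_infsum) (auto simp: Xspace_def less_imp_le)

lemma wnorm_coord_le: "x \<in> Xspace \<Longrightarrow> weight i * \<bar>x i\<bar> \<le> wnorm x"
  using wnorm_finite_sum_le[of x "{i}"] by simp

lemma wnorm_leI:
  assumes "x \<in> Xspace" "\<And>F. finite F \<Longrightarrow> (\<Sum>i\<in>F. weight i * \<bar>x i\<bar>) \<le> c"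
  shows "wnorm x \<le> c"
  unfolding wnorm_def using assms by (intro infsum_le_finite_sums) (auto simp: Xspace_def)

lemma wnorm_nonneg: "0 \<le> wnorm x"
  unfolding wnorm_def using weight_pos by (intro infsum_nonneg) (simp add: less_imp_le)

lemma wnorm_bounded_le:
  fixes x :: "('d::finite) config"
  assumes "\<And>i. \<bar>x i\<bar> \<le> c"
  shows "wnorm x \<le> c * infsum weight (UNIV :: 'd site set)"
proof (rule wnorm_leI[OF Xspace_bounded[OF assms]])
  fix F :: "'d site set" assume F: "finite F"
  have c: "0 \<le> c" using assms[of origin] by linarith
  have "(\<Sum>i\<in>F. weight i * \<bar>x i\<bar>) \<le> (\<Sum>i\<in>F. weight i * c)"
    using assms weight_pos by (intro sum_mono mult_left_mono) (auto simp: less_imp_le)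
  also have "\<dots> = c * sum weight F" by (simp add: sum_distrib_left mult.commute)
  also have "\<dots> \<le> c * infsum weight (UNIV :: 'd site set)"
    using F c weight_pos by (intro mult_left_mono finite_sum_le_infsum weight_summable) (auto simp: less_imp_le)
  finally show "(\<Sum>i\<in>F. weight i * \<bar>x i\<bar>) \<le> c * infsum weight (UNIV :: 'd site set)" .
qed

lemma wnorm_add_scaled_le:
  assumes "x \<in> Xspace" "y \<in> Xspace"
  shows "wnorm (\<lambda>i. x i + c * y i) \<le> wnorm x + \<bar>c\<bar> * wnorm y"
proof (rule wnorm_leI[OF Xspace_add_scaled[OF assms]])
  fix F :: "'a site set" assume F: "finite F"
  have "weight i * \<bar>x i + c * y i\<bar> \<le> weight i * \<bar>x i\<bar> + \<bar>c\<bar> * (weight i * \<bar>y i\<bar>)" for i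
    using mult_left_mono[OF abs_triangle_ineq[of "x i" "c * y i"] weight_nonneg[of i]]
    by (simp add: abs_mult algebra_simps)
  then have "(\<Sum>i\<in>F. weight i * \<bar>x i + c * y i\<bar>) \<le>
      (\<Sum>i\<in>F. weight i * \<bar>x i\<bar>) + \<bar>c\<bar> * (\<Sum>i\<in>F. weight i * \<bar>y i\<bar>)"
    by (simp add: sum_distrib_left sum.distrib[symmetric] sum_mono)
  also have "\<dots> \<le> wnorm x + \<bar>c\<bar> * wnorm y"
    using F by (intro add_mono mult_left_mono wnorm_finite_sum_le assms) auto
  finally show "(\<Sum>i\<in>F. weight i * \<bar>x i + c * y i\<bar>) \<le> wnorm x + \<bar>c\<bar> * wnorm y" .
qed

lemma weight_shift: "weight i \<le> 2 powr (norm1 k) * weight (site_add k i)"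
proof -
  have "norm1 (site_add k i) \<le> norm1 k + norm1 i" by (rule norm1_triangle)
  then have "(2::real) powr (- norm1 i) \<le> 2 powr (norm1 k + - norm1 (site_add k i))"
    by (intro powr_mono) auto
  then show ?thesis by (simp add: weight_def powr_add[symmetric])
qed

lemma wnorm_shift_sum_le:
  assumes "x \<in> Xspace" "finite F"
  shows "(\<Sum>i\<in>F. weight i * \<bar>x (site_add k i)\<bar>) \<le> 2 powr (norm1 k) * wnorm x"
proof -
  have "(\<Sum>i\<in>F. weight i * \<bar>x (site_add k i)\<bar>) \<le>
     (\<Sum>i\<in>F. 2 powr (norm1 k) * (weight (site_add k i) * \<bar>x (site_add k i)\<bar>))"
  proof (rule sum_mono)
    fix i
    show "weight i * \<bar>x (site_add k i)\<bar> \<le> 2 powr norm1 k * (weight (site_add k i) * \<bar>x (site_add k i)\<bar>)"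
      using mult_right_mono[OF weight_shift[of i k], of "\<bar>x (site_add k i)\<bar>"] by (simp add: mult.assoc)
  qed
  also have "\<dots> = 2 powr (norm1 k) * (\<Sum>i\<in>(\<lambda>i. site_add k i) ` F. weight i * \<bar>x i\<bar>)"
    by (subst sum.reindex) (auto simp: sum_distrib_left intro!: inj_on_inverseI[of _ "\<lambda>i. site_diff i k"] simp: site_simps)
  also have "\<dots> \<le> 2 powr (norm1 k) * wnorm x"
    using assms by (intro mult_left_mono wnorm_finite_sum_le) auto
  finally show ?thesis .
qed

lemma X_has_deriv_coord:
  assumes "X_has_deriv \<gamma> v t" "\<And>s. \<gamma> s \<in> Xspace" "v \<in> Xspace"
  shows "((\<lambda>s. \<gamma> s i) has_real_derivative v i) (at t)"
proof -
  let ?e = "\<lambda>h i. \<gamma> (t + h) i - \<gamma> t i - h * v i"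
  have X: "?e h \<in> Xspace" for h
    using Xspace_add_scaled[OF Xspace_diff[OF assms(2)[of "t+h"] assms(2)[of t]] assms(3), of "-h"]
    by (simp add: algebra_simps)
  have "((\<lambda>h. 1 / weight i * (wnorm (?e h) / \<bar>h\<bar>)) \<longlongrightarrow> 1 / weight i * 0) (at 0)"
    using assms(1) unfolding X_has_deriv_def by (intro tendsto_intros)
  then have lim: "((\<lambda>h. 1 / weight i * (wnorm (?e h) / \<bar>h\<bar>)) \<longlongrightarrow> 0) (at 0)" by simp
  have "norm ((\<gamma> (t + h) i - \<gamma> t i) / h - v i) \<le> 1 / weight i * (wnorm (?e h) / \<bar>h\<bar>)"
    if "h \<noteq> 0" for h
  proof -
    have "(\<gamma> (t + h) i - \<gamma> t i) / h - v i = ?e h i / h" using that by (simp add: field_simps)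
    then have "norm ((\<gamma> (t + h) i - \<gamma> t i) / h - v i) = \<bar>?e h i\<bar> / \<bar>h\<bar>" by (simp add: abs_divide)
    also have "\<bar>?e h i\<bar> \<le> 1 / weight i * wnorm (?e h)"
      using wnorm_coord_le[OF X, of i h] weight_pos[of i] by (simp add: field_simps)
    finally show ?thesis using that by (simp add: divide_right_mono)
  qed
  then have "((\<lambda>h. (\<gamma> (t + h) i - \<gamma> t i) / h - v i) \<longlongrightarrow> 0) (at 0)"
    by (intro Lim_null_comparison[OF _ lim]) (simp add: eventually_at_filter)
  then have "((\<lambda>h. (\<gamma> (t + h) i - \<gamma> t i) / h) \<longlongrightarrow> v i) (at 0)" by (rule LIM_zero_cancel)
  then show ?thesis by (simp add: DERIV_def)
qed


section \<open>Uniqueness of solutions in the weighted norm\<close>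

context lattice_potentials
begin

text \<open>The Lipschitz constant of the gradient field in the weighted norm: a shift by
  \<open>k\<close> within the interaction range distorts the weight by at most
  \<open>2 powr norm1 k\<close>.\<close>

definition Lw :: real where "Lw = K * (\<Sum>k\<in>ball1 (origin :: 'd site) (2 * r). 2 powr norm1 k)"

lemma Lw_nonneg: "0 \<le> Lw"
  unfolding Lw_def using K_pos by (intro mult_nonneg_nonneg sum_nonneg) auto

text \<open>Finite sums are used because summability of the difference of the gradients is itself
  deduced from this bound.\<close>

lemma sum_weight_g_diff_le:
  assumes "(\<lambda>i. y i - x i) \<in> Xspace" "finite F"
  shows "(\<Sum>i\<in>F. weight i * \<bar>g y i - g x i\<bar>) \<le> Lw * wnorm (\<lambda>i. y i - x i)"
proof -
  let ?B = "ball1 (origin :: 'd site) (2 * r)"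
  let ?z = "\<lambda>i. y i - x i"
  have "(\<Sum>i\<in>F. weight i * \<bar>g y i - g x i\<bar>) \<le>
      (\<Sum>i\<in>F. weight i * (K * (\<Sum>k\<in>?B. \<bar>?z (site_add k i)\<bar>)))"
  proof (intro sum_mono mult_left_mono)
    fix i
    have "(\<Sum>k\<in>ball1 i (2 * r). \<bar>?z k\<bar>) = (\<Sum>k\<in>?B. \<bar>?z (site_add k i)\<bar>)"
      by (subst ball1_eq_image, subst sum.reindex) (auto intro: inj_on_subset[OF inj_site_add])
    then show "\<bar>g y i - g x i\<bar> \<le> K * (\<Sum>k\<in>?B. \<bar>?z (site_add k i)\<bar>)"
      using g_lipschitz[of y i x] by simp
  qed simp
  also have "\<dots> = K * (\<Sum>k\<in>?B. \<Sum>i\<in>F. weight i * \<bar>?z (site_add k i)\<bar>)"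
    by (subst sum.swap) (simp add: sum_distrib_left mult_ac)
  also have "\<dots> \<le> K * (\<Sum>k\<in>?B. 2 powr (norm1 k) * wnorm ?z)"
    using K_pos assms by (intro mult_left_mono sum_mono wnorm_shift_sum_le) auto
  also have "\<dots> = Lw * wnorm ?z" by (simp add: Lw_def sum_distrib_right mult.assoc)
  finally show ?thesis .
qed

lemma g_zero_const: "g (\<lambda>_. 0) i = g (\<lambda>_. 0) origin"
  using g_tau[of i 0 "\<lambda>_. 0" origin] by (simp add: tau_def site_simps)

text \<open>By translation invariance the gradient of the zero configuration is the same at all
  sites, hence in the space; the Lipschitz bound handles the difference.\<close>

lemma g_Xspace:
  assumes "x \<in> Xspace" shows "g x \<in> Xspace"
proof -
  have x0: "(\<lambda>i. x i - (\<lambda>_. 0) i) \<in> Xspace" using assms by simp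
  have "(\<lambda>i. g x i - g (\<lambda>_. 0) i) \<in> Xspace"
    unfolding Xspace_def mem_Collect_eq
  proof (rule nonneg_bdd_above_summable_on)
    show "bdd_above (sum (\<lambda>i. weight i * \<bar>g x i - g (\<lambda>_. 0) i\<bar>) ` {F. F \<subseteq> UNIV \<and> finite F})"
      using sum_weight_g_diff_le[OF x0] by (intro bdd_aboveI2[where M = "Lw * wnorm x"]) auto
  qed simp
  then have "(\<lambda>i. g (\<lambda>_. 0) origin + (g x i - g (\<lambda>_. 0) i)) \<in> Xspace"
    by (rule Xspace_shift_const)
  moreover have "(\<lambda>i. g (\<lambda>_. 0) origin + (g x i - g (\<lambda>_. 0) i)) = g x"
  proof
    fix i show "g (\<lambda>_. 0) origin + (g x i - g (\<lambda>_. 0) i) = g x i"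
      using g_zero_const[of i] by linarith
  qed
  ultimately show ?thesis by (simp only:)
qed

lemma neg_g_Xspace: "x \<in> Xspace \<Longrightarrow> (\<lambda>i. - g x i) \<in> Xspace"
  using Xspace_diff[OF Xspace_bounded[of "\<lambda>_. 0" 0] g_Xspace[of x]] by simp

lemma solution_coord:
  assumes "grad_flow_solution r S \<gamma>"
  shows "((\<lambda>s. \<gamma> s i) has_real_derivative - g (\<gamma> t) i) (at t)"
proof -
  have X: "\<gamma> s \<in> Xspace" for s using assms by (simp add: grad_flow_solution_def)
  have "X_has_deriv \<gamma> (\<lambda>i. - g (\<gamma> t) i) t" using assms by (simp add: grad_flow_solution_def)
  from X_has_deriv_coord[OF this X neg_g_Xspace[OF X]] show ?thesis .
qed

text \<open>Provides the finite bound from which the halving argument for uniqueness can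
  start.\<close>

lemma solution_locally_bounded:
  assumes "grad_flow_solution r S \<gamma>"
  shows "\<exists>M \<delta>. \<delta> > 0 \<and> (\<forall>h. \<bar>h\<bar> < \<delta> \<longrightarrow> wnorm (\<lambda>i. \<gamma> (t + h) i - \<gamma> t i) \<le> M)"
proof -
  define v where "v = (\<lambda>i. - g (\<gamma> t) i)"
  have X: "\<gamma> s \<in> Xspace" for s using assms by (simp add: grad_flow_solution_def)
  have v: "v \<in> Xspace" unfolding v_def by (rule neg_g_Xspace[OF X])
  have "((\<lambda>h. wnorm (\<lambda>i. \<gamma> (t + h) i - \<gamma> t i - h * v i) / \<bar>h\<bar>) \<longlongrightarrow> 0) (at 0)"
    using assms by (simp add: grad_flow_solution_def X_has_deriv_def v_def)
  then have "\<forall>\<^sub>F h in at 0. wnorm (\<lambda>i. \<gamma> (t + h) i - \<gamma> t i - h * v i) / \<bar>h\<bar> < 1"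
    by (rule order_tendstoD) simp
  then obtain d where d: "d > 0" "\<And>h. h \<noteq> 0 \<Longrightarrow> \<bar>h\<bar> < d \<Longrightarrow>
      wnorm (\<lambda>i. \<gamma> (t + h) i - \<gamma> t i - h * v i) / \<bar>h\<bar> < 1"
    by (auto simp: eventually_at dist_real_def)
  have "wnorm (\<lambda>i. \<gamma> (t + h) i - \<gamma> t i) \<le> d + d * wnorm v" if h: "\<bar>h\<bar> < d" for h
  proof (cases "h = 0")
    case True
    then show ?thesis using d(1) wnorm_nonneg[of v] by (simp add: wnorm_def)
  next
    case False
    let ?e = "\<lambda>i. \<gamma> (t + h) i - \<gamma> t i - h * v i"
    have Xd: "(\<lambda>i. \<gamma> (t + h) i - \<gamma> t i) \<in> Xspace" by (rule Xspace_diff[OF X X])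
    have Xe: "?e \<in> Xspace"
      using Xspace_add_scaled[OF Xd v, of "-h"] by simp
    have "wnorm (\<lambda>i. ?e i + h * v i) \<le> wnorm ?e + \<bar>h\<bar> * wnorm v"
      by (rule wnorm_add_scaled_le[OF Xe v])
    moreover have "wnorm ?e \<le> \<bar>h\<bar>" using d(2)[OF False h] False by (simp add: field_simps)
    moreover have "\<bar>h\<bar> * wnorm v \<le> d * wnorm v" using h by (intro mult_right_mono wnorm_nonneg) auto
    ultimately show ?thesis using h by simp
  qed
  then show ?thesis using d(1) by blast
qed

text \<open>Testing the difference of two solutions against finitely many coordinates, with weights and
  signs, replaces differentiation of the norm.\<close>
lemma solution_unique_local:
  assumes "grad_flow_solution r S \<gamma>" "grad_flow_solution r S \<eta>" "\<gamma> t = \<eta> t"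
  shows "\<exists>\<delta>>0. \<forall>h. \<bar>h\<bar> < \<delta> \<longrightarrow> \<gamma> (t + h) = \<eta> (t + h)"
proof -
  have X: "\<gamma> s \<in> Xspace" "\<eta> s \<in> Xspace" for s using assms by (simp_all add: grad_flow_solution_def)
  let ?D = "\<lambda>s i. \<gamma> (t + s) i - \<eta> (t + s) i"
  have XD: "?D s \<in> Xspace" for s by (rule Xspace_diff[OF X])
  obtain M1 d1 where 1: "d1 > 0" "\<And>h. \<bar>h\<bar> < d1 \<Longrightarrow> wnorm (\<lambda>i. \<gamma> (t + h) i - \<gamma> t i) \<le> M1"
    using solution_locally_bounded[OF assms(1), of t] by blast
  obtain M2 d2 where 2: "d2 > 0" "\<And>h. \<bar>h\<bar> < d2 \<Longrightarrow> wnorm (\<lambda>i. \<eta> (t + h) i - \<eta> t i) \<le> M2"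
    using solution_locally_bounded[OF assms(2), of t] by blast
  \<comment> \<open>The last term ensures \<open>d * Lw \<le> 1 / 2\<close>; the added
    \<open>1\<close> keeps the quotient meaningful for \<open>Lw = 0\<close>.\<close>
  define d where "d = min (min d1 d2) (1 / (2 * (Lw + 1)))"
  have d0: "d > 0" using 1(1) 2(1) Lw_nonneg by (simp add: d_def)
  have dL: "d * Lw \<le> 1 / 2"
  proof -
    have "d * Lw \<le> 1 / (2 * (Lw + 1)) * Lw" using Lw_nonneg by (intro mult_right_mono) (auto simp: d_def)
    also have "\<dots> \<le> 1 / 2" using Lw_nonneg by (simp add: field_simps)
    finally show ?thesis .
  qed
  have base: "wnorm (?D h) \<le> M1 + M2" if h: "\<bar>h\<bar> < d" for h
  proof -
    have "wnorm (\<lambda>i. (\<gamma> (t + h) i - \<gamma> t i) + -1 * (\<eta> (t + h) i - \<eta> t i)) \<le> M1 + \<bar>-1\<bar> * M2"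
      by (rule order_trans[OF wnorm_add_scaled_le[OF Xspace_diff[OF X(1) X(1)] Xspace_diff[OF X(2) X(2)]]])
        (use h in \<open>auto simp: d_def intro!: add_mono 1 2\<close>)
    then show ?thesis by (simp add: assms(3))
  qed
  \<comment> \<open>Any bound valid on the whole interval improves by a factor two there; iteration
    drives it to zero.\<close>
  have halve: "wnorm (?D h) \<le> M / 2" if M: "\<And>h. \<bar>h\<bar> < d \<Longrightarrow> wnorm (?D h) \<le> M" and h: "\<bar>h\<bar> < d" for M h
  proof (rule wnorm_leI[OF XD])
    fix F :: "'d site set" assume F: "finite F"
    have M0: "0 \<le> M" using M[OF h] wnorm_nonneg[of "?D h"] by linarith
    \<comment> \<open>The signs are frozen at time \<open>h\<close>, so \<open>u\<close> is
      differentiable in \<open>s\<close> and still equals the weighted absolute sum at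
      \<open>s = h\<close>.\<close>
    define sg where "sg = (\<lambda>i. sgn (?D h i))"
    have sg: "\<bar>sg i\<bar> \<le> 1" for i by (simp add: sg_def sgn_if)
    define u where "u = (\<lambda>s. \<Sum>i\<in>F. weight i * sg i * ?D s i)"
    have du: "(u has_real_derivative (\<Sum>i\<in>F. weight i * sg i * (- g (\<gamma> (t + s)) i - - g (\<eta> (t + s)) i))) (at s)" for s
      unfolding u_def
      using solution_coord[OF assms(1), of _ "t + s"] solution_coord[OF assms(2), of _ "t + s"]
      by (intro DERIV_sum DERIV_cmult DERIV_diff) (simp_all add: DERIV_shift add.commute[of t])
    have bd: "\<bar>\<Sum>i\<in>F. weight i * sg i * (- g (\<gamma> (t + s)) i - - g (\<eta> (t + s)) i)\<bar> \<le> Lw * M" if s: "\<bar>s\<bar> < d" for s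
    proof -
      have "\<bar>\<Sum>i\<in>F. weight i * sg i * (- g (\<gamma> (t + s)) i - - g (\<eta> (t + s)) i)\<bar> \<le>
          (\<Sum>i\<in>F. weight i * \<bar>g (\<gamma> (t + s)) i - g (\<eta> (t + s)) i\<bar>)"
      proof (rule order_trans[OF sum_abs sum_mono])
        fix i
        have "\<bar>sg i\<bar> * \<bar>g (\<gamma> (t + s)) i - g (\<eta> (t + s)) i\<bar> \<le> 1 * \<bar>g (\<gamma> (t + s)) i - g (\<eta> (t + s)) i\<bar>"
          using sg by (intro mult_right_mono) auto
        from mult_left_mono[OF this weight_nonneg[of i]]
        show "\<bar>weight i * sg i * (- g (\<gamma> (t + s)) i - - g (\<eta> (t + s)) i)\<bar> \<le> weight i * \<bar>g (\<gamma> (t + s)) i - g (\<eta> (t + s)) i\<bar>"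
          by (simp add: abs_mult mult.assoc abs_minus_commute)
      qed
      also have "\<dots> \<le> Lw * wnorm (?D s)" by (rule sum_weight_g_diff_le[OF XD F])
      also have "\<dots> \<le> Lw * M" using M[OF s] Lw_nonneg by (intro mult_left_mono)
      finally show ?thesis .
    qed
    have "norm (u h - u 0) \<le> Lw * M * norm (h - 0)"
    proof (rule field_differentiable_bound[of "{-\<bar>h\<bar>..\<bar>h\<bar>}" u])
      fix s assume "s \<in> {-\<bar>h\<bar>..\<bar>h\<bar>}"
      then have "\<bar>s\<bar> < d" using h by auto
      then show "norm (\<Sum>i\<in>F. weight i * sg i * (- g (\<gamma> (t + s)) i - - g (\<eta> (t + s)) i)) \<le> Lw * M"
        using bd by simp
    qed (simp, rule has_field_derivative_at_within[OF du], auto)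
    moreover have "u 0 = 0" using assms(3) by (simp add: u_def)
    moreover have "u h = (\<Sum>i\<in>F. weight i * \<bar>?D h i\<bar>)"
      unfolding u_def sg_def by (intro sum.cong) (auto simp: sgn_if)
    ultimately have "(\<Sum>i\<in>F. weight i * \<bar>?D h i\<bar>) \<le> Lw * M * \<bar>h\<bar>" by simp
    also have "\<dots> \<le> Lw * M * d" using Lw_nonneg M0 h by (intro mult_left_mono) auto
    also have "\<dots> \<le> M / 2" using mult_right_mono[OF dL M0] by (simp add: mult_ac)
    finally show "(\<Sum>i\<in>F. weight i * \<bar>?D h i\<bar>) \<le> M / 2" .
  qed
  have pow: "wnorm (?D h) \<le> (M1 + M2) * (1/2) ^ n" if "\<bar>h\<bar> < d" for h n
    using that
  proof (induction n arbitrary: h)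
    case 0 then show ?case using base by simp
  next
    case (Suc n)
    show ?case using halve[OF Suc.IH Suc.prems] by simp
  qed
  have "\<gamma> (t + h) = \<eta> (t + h)" if h: "\<bar>h\<bar> < d" for h
  proof -
    have "(\<lambda>n. (M1 + M2) * (1/2) ^ n) \<longlonglongrightarrow> 0"
      by (auto intro!: tendsto_mult_right_zero LIMSEQ_power_zero)
    then have "wnorm (?D h) \<le> 0"
      by (rule tendsto_lowerbound) (use pow[OF h] in auto)
    then have w: "weight i * \<bar>?D h i\<bar> \<le> 0" for i using wnorm_coord_le[OF XD, of i h] by linarith
    have "\<bar>?D h i\<bar> \<le> 0" for i
      using w[of i] mult_le_cancel_left_pos[OF weight_pos[of i], of "\<bar>?D h i\<bar>" 0] by linarith
    then show ?thesis by (intro ext) simp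
  qed
  then show ?thesis using d0 by blast
qed

lemma solution_unique:
  assumes "grad_flow_solution r S \<gamma>" "grad_flow_solution r S \<eta>" "\<gamma> t = \<eta> t"
  shows "\<gamma> = \<eta>"
proof -
  define Z where "Z = {s. \<gamma> s = \<eta> s}"
  have "open Z"
    unfolding open_dist
  proof
    fix s assume "s \<in> Z"
    then obtain d where d: "d > 0" "\<And>h. \<bar>h\<bar> < d \<Longrightarrow> \<gamma> (s + h) = \<eta> (s + h)"
      using solution_unique_local[OF assms(1,2), of s] by (auto simp: Z_def)
    have "y \<in> Z" if "dist y s < d" for y
      using d(2)[of "y - s"] that by (simp add: Z_def dist_real_def)
    then show "\<exists>e>0. \<forall>y. dist y s < e \<longrightarrow> y \<in> Z" using d(1) by blast
  qed
  moreover have "closed Z"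
  proof -
    have "Z = (\<Inter>i. {s. \<gamma> s i = \<eta> s i})" by (auto simp: Z_def)
    moreover have "continuous_on UNIV (\<lambda>s. \<gamma> s i)" "continuous_on UNIV (\<lambda>s. \<eta> s i)" for i
      by (rule DERIV_continuous_on[OF solution_coord[OF assms(1)]]
               DERIV_continuous_on[OF solution_coord[OF assms(2)]])+
    ultimately show ?thesis by (auto intro!: closed_INT closed_Collect_eq)
  qed
  moreover have "t \<in> Z" using assms(3) by (simp add: Z_def)
  ultimately have "Z = UNIV" using clopen by blast
  then show ?thesis by (auto simp: Z_def)
qed

lemma Psi_eq:
  assumes "grad_flow_solution r S \<gamma>" "\<gamma> 0 = x" shows "Psi r S t x = \<gamma> t"
  unfolding Psi_def
proof (rule the_equality)
  fix y assume "\<exists>\<eta>. grad_flow_solution r S \<eta> \<and> \<eta> 0 = x \<and> \<eta> t = y"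
  then obtain \<eta> where \<eta>: "grad_flow_solution r S \<eta>" "\<eta> 0 = x" "\<eta> t = y" by blast
  have "\<eta> = \<gamma>" by (rule solution_unique[OF \<eta>(1) assms(1), of 0]) (simp add: \<eta>(2) assms(2))
  then show "y = \<gamma> t" using \<eta>(3) by simp
next
  show "\<exists>\<eta>. grad_flow_solution r S \<eta> \<and> \<eta> 0 = x \<and> \<eta> t = \<gamma> t"
    by (intro exI[of _ \<gamma>] conjI assms refl)
qed

end

section \<open>Existence of the flow\<close>

text \<open>A chosen primitive keeps the Picard iteration free of integrals; subtracting its value
  at \<open>0\<close> later removes the arbitrary constant.\<close>

definition antideriv :: "(real \<Rightarrow> real) \<Rightarrow> real \<Rightarrow> real" where
  "antideriv f = (SOME F. \<forall>t. (F has_real_derivative f t) (at t))"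

lemma antideriv:
  assumes "\<And>t. isCont f t" shows "(antideriv f has_real_derivative f t) (at t)"
proof -
  have "\<exists>F. \<forall>t. (F has_real_derivative f t) (at t)"
    using einterval_antiderivative[of "-\<infinity>" "\<infinity>" f] assms
    by (simp add: has_real_derivative_iff_has_vector_derivative)
  then have "\<forall>t. (antideriv f has_real_derivative f t) (at t)"
    unfolding antideriv_def by (rule someI_ex)
  then show ?thesis ..
qed

section \<open>Picard iteration in the supremum norm\<close>

context lattice_potentials
begin

lemma g_tendsto: "(y \<longlongrightarrow> x) G \<Longrightarrow> ((\<lambda>s. g (y s) i) \<longlongrightarrow> g x i) G"
  using g_cont[of i] isCont_tendsto_compose[of x "\<lambda>x. g x i" y G]
  by (simp add: continuous_on_eq_continuous_at)

lemma isCont_g_curve: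
  assumes "\<And>i. isCont (\<lambda>s. \<gamma> s i) t" shows "isCont (\<lambda>s. g (\<gamma> s) i) t"
proof -
  have "(\<gamma> \<longlongrightarrow> \<gamma> t) (at t)"
    unfolding tendsto_config_iff using assms by (simp add: isCont_def)
  then show ?thesis unfolding isCont_def by (rule g_tendsto)
qed

primrec picard :: "'d config \<Rightarrow> nat \<Rightarrow> real \<Rightarrow> 'd config" where
  "picard x 0 = (\<lambda>t. x)"
| "picard x (Suc n) = (\<lambda>t i. x i + (antideriv (\<lambda>s. - g (picard x n s) i) t - antideriv (\<lambda>s. - g (picard x n s) i) 0))"

text \<open>Continuity and derivative are proved in one induction: a primitive exists only for a
  continuous integrand, and continuity of an iterate comes from its derivative.\<close>

lemma picard_deriv: "((\<lambda>t. picard x (Suc n) t i) has_real_derivative - g (picard x n t) i) (at t)"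
proof -
  have shift: "((\<lambda>t. c + (F t - F 0)) has_real_derivative D) (at t)"
    if "(F has_real_derivative D) (at t)" for F and c D t :: real
    by (auto intro!: derivative_eq_intros that)
  have "(\<forall>i t. isCont (\<lambda>t. picard x n t i) t) \<and>
        (\<forall>i t. ((\<lambda>t. picard x (Suc n) t i) has_real_derivative - g (picard x n t) i) (at t))"
  proof (induction n)
    case 0
    have "((\<lambda>t. picard x (Suc 0) t i) has_real_derivative - g (picard x 0 t) i) (at t)" for i t
      by (auto intro!: derivative_eq_intros antideriv)
    then show ?case by simp
  next
    case (Suc n)
    then have c: "isCont (\<lambda>t. picard x (Suc n) t i) t" for i t
      using DERIV_isCont by blast
    have "isCont (\<lambda>s. - g (picard x (Suc n) s) i) t" for i t
      by (rule isCont_minus[OF isCont_g_curve[OF c]])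
    then have a: "(antideriv (\<lambda>s. - g (picard x (Suc n) s) i) has_real_derivative - g (picard x (Suc n) t) i) (at t)" for i t
      by (rule antideriv)
    have "((\<lambda>t. picard x (Suc (Suc n)) t i) has_real_derivative - g (picard x (Suc n) t) i) (at t)" for i t
      unfolding picard.simps(2)[of x "Suc n"] by (rule shift[OF a])
    then show ?case using c by blast
  qed
  then show ?thesis by blast
qed

lemma picard_0: "picard x n 0 = x"
  by (cases n) auto

text \<open>In the norm weighted by \<open>exp (2 * L * \<bar>t\<bar>)\<close> the Picard map
  contracts by \<open>L / (2 * L)\<close>. The estimate covers all times at once, so no continuation
  of local solutions is needed.\<close>

lemma picard_step:
  assumes "\<And>i. \<bar>g x i\<bar> \<le> M"
  shows "\<bar>picard x (Suc n) t i - picard x n t i\<bar> \<le> M / (2 * L) * exp (2 * L * \<bar>t\<bar>) * (1/2) ^ n"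
proof (induction n arbitrary: t i)
  case 0
  have M: "0 \<le> M" using assms[of i] by linarith
  have "\<bar>picard x (Suc 0) t i - picard x (Suc 0) 0 i\<bar> \<le> M / (2 * L) * (exp (2 * L * \<bar>t\<bar>) - 1)"
  proof (rule growth_bound[OF _ picard_deriv])
    fix s
    have "\<bar>- g (picard x 0 s) i\<bar> \<le> M * 1" using assms by simp
    also have "\<dots> \<le> M * exp (2 * L * \<bar>s\<bar>)" using M L_pos by (intro mult_left_mono) auto
    finally show "\<bar>- g (picard x 0 s) i\<bar> \<le> M * exp (2 * L * \<bar>s\<bar>)" .
  qed (use L_pos in simp)
  also have "\<dots> \<le> M / (2 * L) * exp (2 * L * \<bar>t\<bar>)" using M L_pos by (intro mult_left_mono) auto
  finally show ?case by (simp only: picard_0) simp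
next
  case (Suc n)
  define A where "A = M / (2 * L) * (1/2) ^ n"
  have A: "0 \<le> A" using assms[of i] L_pos by (simp add: A_def)
  let ?u = "\<lambda>t. picard x (Suc (Suc n)) t i - picard x (Suc n) t i"
  have "\<bar>?u t - ?u 0\<bar> \<le> L * A / (2 * L) * (exp (2 * L * \<bar>t\<bar>) - 1)"
  proof (rule growth_bound[OF _ DERIV_diff[OF picard_deriv picard_deriv]])
    fix s
    have "\<bar>g (picard x (Suc n) s) i - g (picard x n s) i\<bar> \<le> L * (A * exp (2 * L * \<bar>s\<bar>))"
      by (rule g_lipschitz_sup) (use Suc.IH[of s] in \<open>simp only: A_def mult_ac\<close>)
    then show "\<bar>- g (picard x (Suc n) s) i - - g (picard x n s) i\<bar> \<le> L * A * exp (2 * L * \<bar>s\<bar>)"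
      by (simp add: mult_ac abs_minus_commute)
  qed (use L_pos in simp)
  also have "\<dots> \<le> A / 2 * exp (2 * L * \<bar>t\<bar>)"
    using A L_pos mult_left_mono[of "exp (2 * L * \<bar>t\<bar>) - 1" "exp (2 * L * \<bar>t\<bar>)" A] by simp
  finally show ?case by (simp only: picard_0) (simp add: A_def mult_ac)
qed

lemma solution_exists_coord:
  assumes "\<And>i. \<bar>g x i\<bar> \<le> M"
  obtains \<gamma> where "\<gamma> 0 = x" "\<And>t i. ((\<lambda>s. \<gamma> s i) has_real_derivative - g (\<gamma> t) i) (at t)"
    "\<And>t i. \<bar>\<gamma> t i - x i\<bar> \<le> M / L * exp (2 * L * \<bar>t\<bar>)"
proof -
  have "\<exists>l. (\<lambda>n. picard x n t i) \<longlonglongrightarrow> l \<and>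
     (\<forall>n. \<bar>l - picard x n t i\<bar> \<le> 2 * (M / (2 * L) * exp (2 * L * \<bar>t\<bar>)) * (1/2) ^ n)" for t i
    using geometric_convergence[of "\<lambda>n. picard x n t i", OF picard_step[OF assms]] by metis
  then obtain \<gamma> where lim: "\<And>t i. (\<lambda>n. picard x n t i) \<longlonglongrightarrow> \<gamma> t i" and
    err: "\<And>t i n. \<bar>\<gamma> t i - picard x n t i\<bar> \<le> 2 * (M / (2 * L) * exp (2 * L * \<bar>t\<bar>)) * (1/2) ^ n"
    by metis
  have M: "0 \<le> M" using assms[of origin] by linarith
  show ?thesis
  proof (rule that[of \<gamma>])
    show "\<gamma> 0 = x"
    proof
      fix i
      have "(\<lambda>n. picard x n 0 i) \<longlonglongrightarrow> x i" by (simp add: picard_0)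
      then show "\<gamma> 0 i = x i" using lim LIMSEQ_unique by blast
    qed
    show "\<bar>\<gamma> t i - x i\<bar> \<le> M / L * exp (2 * L * \<bar>t\<bar>)" for t i
      using err[of t i 0] by simp
    fix t :: real and i
    define T where "T = \<bar>t\<bar> + 1"
    have conv: "convex (ball t 1)" by simp
    \<comment> \<open>Termwise differentiation on a neighbourhood of \<open>t\<close>, where the
      derivatives converge uniformly. The index is shifted by one because the derivative of iterate
      \<open>Suc n\<close> is expressed through iterate \<open>n\<close>.\<close>
    have "\<exists>h. \<forall>s\<in>ball t 1. (\<lambda>n. picard x (Suc n) s i) \<longlonglongrightarrow> h s \<and>
        (h has_derivative (\<lambda>a. - g (\<gamma> s) i * a)) (at s within ball t 1)"
    proof (rule has_derivative_sequence[OF conv])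
      show "((\<lambda>s. picard x (Suc n) s i) has_derivative (\<lambda>a. - g (picard x n s) i * a)) (at s within ball t 1)" for n s
        using has_field_derivative_at_within[OF picard_deriv[of x n i s], of "ball t 1"]
        unfolding has_field_derivative_def .
      show "t \<in> ball t 1" by simp
      show "(\<lambda>n. picard x (Suc n) t i) \<longlonglongrightarrow> \<gamma> t i" using lim by (rule LIMSEQ_Suc)
      fix e :: real assume e: "e > 0"
      have "(\<lambda>n. L * (M / L * exp (2 * L * T)) * (1/2) ^ n) \<longlonglongrightarrow> 0"
        by (auto intro!: tendsto_mult_right_zero LIMSEQ_power_zero)
      then have "\<forall>\<^sub>F n in sequentially. L * (M / L * exp (2 * L * T)) * (1/2) ^ n < e"
        using e by (rule order_tendstoD)
      then show "\<forall>\<^sub>F n in sequentially. \<forall>s\<in>ball t 1. \<forall>a.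
         norm (- g (picard x n s) i * a - - g (\<gamma> s) i * a) \<le> e * norm a"
      proof eventually_elim
        case (elim n)
        show ?case
        proof (intro ballI allI)
          fix s a assume "s \<in> ball t 1"
          then have s: "\<bar>s\<bar> \<le> T" by (auto simp: T_def dist_real_def)
          have "\<bar>g (\<gamma> s) i - g (picard x n s) i\<bar> \<le> L * (2 * (M / (2 * L) * exp (2 * L * \<bar>s\<bar>)) * (1/2) ^ n)"
            by (rule g_lipschitz_sup) (rule err)
          also have "\<dots> = L * (M / L * exp (2 * L * \<bar>s\<bar>)) * (1/2) ^ n" by simp
          also have "\<dots> \<le> L * (M / L * exp (2 * L * T)) * (1/2) ^ n"
            using s L_pos M by (intro mult_right_mono mult_left_mono) auto
          finally have b: "\<bar>g (\<gamma> s) i - g (picard x n s) i\<bar> \<le> e" using elim by linarith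
          have "- g (picard x n s) i * a - - g (\<gamma> s) i * a = (g (\<gamma> s) i - g (picard x n s) i) * a"
            by (simp add: algebra_simps)
          then show "norm (- g (picard x n s) i * a - - g (\<gamma> s) i * a) \<le> e * norm a"
            using b by (simp add: abs_mult mult_right_mono)
        qed
      qed
    qed
    then obtain h where h: "\<And>s. s \<in> ball t 1 \<Longrightarrow> (\<lambda>n. picard x (Suc n) s i) \<longlonglongrightarrow> h s"
       "\<And>s. s \<in> ball t 1 \<Longrightarrow> (h has_derivative (\<lambda>a. - g (\<gamma> s) i * a)) (at s within ball t 1)" by blast
    have eq: "h s = \<gamma> s i" if "s \<in> ball t 1" for s
      using h(1)[OF that] LIMSEQ_Suc[OF lim] LIMSEQ_unique by blast
    have "at t within ball t 1 = at t" by (rule at_within_open) auto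
    then have "(h has_derivative (\<lambda>a. - g (\<gamma> t) i * a)) (at t)"
      using h(2)[of t] by (simp only: centre_in_ball zero_less_one simp_thms)
    then have "(h has_real_derivative - g (\<gamma> t) i) (at t)" unfolding has_field_derivative_def .
    then show "((\<lambda>s. \<gamma> s i) has_real_derivative - g (\<gamma> t) i) (at t)"
      by (rule has_field_derivative_transform_within_open[of _ _ _ "ball t 1"]) (use eq in auto)
  qed
qed

text \<open>Near \<open>t\<close> the gradient along the curve is bounded by some \<open>M1\<close>
  uniformly in the site, so the first-order remainder is at most
  \<open>L * M1 * \<bar>h\<bar> * \<bar>h\<bar>\<close> at every site. Since the weights have finite
  sum, this is also a bound in the weighted norm.\<close>

lemma solution_of_coord:
  assumes x: "\<gamma> 0 = x" "x \<in> Xspace" "\<And>i. \<bar>g x i\<bar> \<le> M"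
    and d: "\<And>t i. ((\<lambda>s. \<gamma> s i) has_real_derivative - g (\<gamma> t) i) (at t)"
    and b: "\<And>t i. \<bar>\<gamma> t i - x i\<bar> \<le> A * exp (\<rho> * \<bar>t\<bar>)" and "0 \<le> \<rho>"
  shows "grad_flow_solution r S \<gamma>"
  unfolding grad_flow_solution_def
proof (intro allI conjI)
  fix t
  have "(\<lambda>i. \<gamma> t i - x i) \<in> Xspace" by (rule Xspace_bounded[OF b])
  then have "(\<lambda>i. x i + 1 * (\<gamma> t i - x i)) \<in> Xspace" by (rule Xspace_add_scaled[OF x(2)])
  then show "\<gamma> t \<in> Xspace" by simp
  define W :: real where "W = infsum weight (UNIV :: 'd site set)"
  define B where "B = A * exp (\<rho> * (\<bar>t\<bar> + 1))"
  have A: "0 \<le> A"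
  proof -
    have "0 \<le> A * exp (\<rho> * \<bar>t\<bar>)" using b[of t origin] by linarith
    then show ?thesis by (simp add: zero_le_mult_iff not_le)
  qed
  define M1 where "M1 = M + L * B"
  have gb: "\<bar>g (\<gamma> s) i\<bar> \<le> M1" if "\<bar>s - t\<bar> \<le> 1" for s i
  proof -
    have "\<bar>\<gamma> s k - x k\<bar> \<le> B" for k
    proof -
      have "A * exp (\<rho> * \<bar>s\<bar>) \<le> B"
        unfolding B_def using A \<open>0 \<le> \<rho>\<close> that by (intro mult_left_mono) (auto intro!: mult_left_mono)
      then show ?thesis using b[of s k] by linarith
    qed
    then have "\<bar>g (\<gamma> s) i - g x i\<bar> \<le> L * B" by (rule g_lipschitz_sup)
    then show ?thesis using x(3)[of i] by (simp add: M1_def)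
  qed
  have M1: "0 \<le> M1" using gb[of t origin] by simp
  have lip: "\<bar>\<gamma> s i - \<gamma> t i\<bar> \<le> M1 * \<bar>s - t\<bar>" if "\<bar>s - t\<bar> \<le> 1" for s i
  proof -
    have "norm (\<gamma> s i - \<gamma> t i) \<le> M1 * norm (s - t)"
    proof (rule field_differentiable_bound[of "cball t 1" "\<lambda>s. \<gamma> s i"])
      show "((\<lambda>s. \<gamma> s i) has_real_derivative - g (\<gamma> s) i) (at s within cball t 1)" for s
        by (rule has_field_derivative_at_within[OF d])
      show "norm (- g (\<gamma> z) i) \<le> M1" if "z \<in> cball t 1" for z
        using gb[of z i] that by (simp add: dist_real_def abs_minus_commute)
    qed (use that in \<open>auto simp: dist_real_def abs_minus_commute\<close>)
    then show ?thesis by simp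
  qed
  have quad: "\<bar>\<gamma> (t + h) i - \<gamma> t i - h * (- g (\<gamma> t) i)\<bar> \<le> L * M1 * \<bar>h\<bar> * \<bar>h\<bar>" if h: "\<bar>h\<bar> \<le> 1" for h i
  proof -
    let ?u = "\<lambda>s. \<gamma> s i - s * (- g (\<gamma> t) i)"
    have "norm (?u (t + h) - ?u t) \<le> (L * M1 * \<bar>h\<bar>) * norm (t + h - t)"
    proof (rule field_differentiable_bound[of "cball t \<bar>h\<bar>" ?u "\<lambda>s. - g (\<gamma> s) i - (- g (\<gamma> t) i)"])
      show "(?u has_real_derivative - g (\<gamma> s) i - - g (\<gamma> t) i) (at s within cball t \<bar>h\<bar>)" for s
        by (auto intro!: derivative_eq_intros has_field_derivative_at_within[OF d])
      fix s assume "s \<in> cball t \<bar>h\<bar>"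
      then have s: "\<bar>s - t\<bar> \<le> \<bar>h\<bar>" by (simp add: dist_real_def abs_minus_commute)
      have "\<bar>\<gamma> s k - \<gamma> t k\<bar> \<le> M1 * \<bar>h\<bar>" for k
        using lip[of s k] s h mult_left_mono[OF s M1] by linarith
      then have "\<bar>g (\<gamma> s) i - g (\<gamma> t) i\<bar> \<le> L * (M1 * \<bar>h\<bar>)" by (rule g_lipschitz_sup)
      then show "norm (- g (\<gamma> s) i - - g (\<gamma> t) i) \<le> L * M1 * \<bar>h\<bar>"
        by (simp add: mult.assoc abs_minus_commute)
    qed (auto simp: dist_real_def)
    then show ?thesis by (simp add: algebra_simps)
  qed
  show "X_has_deriv \<gamma> (\<lambda>i. - g (\<gamma> t) i) t"
    unfolding X_has_deriv_def
  proof (rule Lim_null_comparison[where g = "\<lambda>h. L * M1 * W * \<bar>h\<bar>"])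
    have "((\<lambda>h. L * M1 * W * \<bar>h\<bar>) \<longlongrightarrow> L * M1 * W * \<bar>0\<bar>) (at (0::real))"
      by (intro tendsto_intros)
    then show "((\<lambda>h. L * M1 * W * \<bar>h\<bar>) \<longlongrightarrow> 0) (at (0::real))" by simp
    have "norm (wnorm (\<lambda>i. \<gamma> (t + h) i - \<gamma> t i - h * - g (\<gamma> t) i) / \<bar>h\<bar>) \<le> L * M1 * W * \<bar>h\<bar>"
      if h: "h \<noteq> 0" "dist h 0 < 1" for h
    proof -
      have "wnorm (\<lambda>i. \<gamma> (t + h) i - \<gamma> t i - h * - g (\<gamma> t) i) \<le> L * M1 * \<bar>h\<bar> * \<bar>h\<bar> * W"
        unfolding W_def by (rule wnorm_bounded_le[OF quad]) (use h in \<open>simp add: dist_real_def\<close>)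
      then show ?thesis using h by (simp add: abs_divide abs_of_nonneg[OF wnorm_nonneg] divide_le_eq mult_ac)
    qed
    then show "\<forall>\<^sub>F h in at 0. norm (wnorm (\<lambda>i. \<gamma> (t + h) i - \<gamma> t i - h * - g (\<gamma> t) i) / \<bar>h\<bar>) \<le> L * M1 * W * \<bar>h\<bar>"
      unfolding eventually_at by (intro exI[of _ 1]) auto
  qed
qed

text \<open>The bounded gradient is what the Picard iteration in the supremum norm requires; all
  configurations of \<open>E\<close> satisfy it although they may be unbounded.\<close>

definition flow_dom :: "'d config set" where
  "flow_dom = {x \<in> Xspace. \<exists>M. \<forall>i. \<bar>g x i\<bar> \<le> M}"

abbreviation \<Psi> :: "real \<Rightarrow> 'd config \<Rightarrow> 'd config" where "\<Psi> \<equiv> Psi r S"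

text \<open>The drift bound is recorded because comparison and continuous dependence need an a
  priori bound to start their iterations.\<close>

lemma Psi_solution:
  assumes "x \<in> flow_dom"
  shows "grad_flow_solution r S (\<lambda>t. \<Psi> t x)" "\<Psi> 0 x = x"
    "\<exists>A\<ge>0. \<forall>t i. \<bar>\<Psi> t x i - x i\<bar> \<le> A * exp (2 * L * \<bar>t\<bar>)"
proof -
  obtain M where M: "x \<in> Xspace" "\<And>i. \<bar>g x i\<bar> \<le> M"
    using assms unfolding flow_dom_def by blast
  obtain \<gamma> where \<gamma>: "\<gamma> 0 = x" "\<And>t i. ((\<lambda>s. \<gamma> s i) has_real_derivative - g (\<gamma> t) i) (at t)"
    "\<And>t i. \<bar>\<gamma> t i - x i\<bar> \<le> M / L * exp (2 * L * \<bar>t\<bar>)"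
    using solution_exists_coord[OF M(2)] by metis
  have sol: "grad_flow_solution r S \<gamma>"
    by (rule solution_of_coord[OF \<gamma>(1) M \<gamma>(2,3)]) (use L_pos in simp)
  have e: "\<Psi> t x = \<gamma> t" for t by (rule Psi_eq[OF sol \<gamma>(1)])
  show "grad_flow_solution r S (\<lambda>t. \<Psi> t x)" "\<Psi> 0 x = x" using sol \<gamma>(1) by (simp_all add: e)
  have "0 \<le> M / L" using M(2)[of origin] L_pos by simp
  then show "\<exists>A\<ge>0. \<forall>t i. \<bar>\<Psi> t x i - x i\<bar> \<le> A * exp (2 * L * \<bar>t\<bar>)"
    using \<gamma>(3) unfolding e by blast
qed

lemma Psi_deriv:
  assumes "x \<in> flow_dom"
  shows "((\<lambda>t. \<Psi> t x i) has_real_derivative - g (\<Psi> t x) i) (at t)"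
  using solution_coord[OF Psi_solution(1)[OF assms]] .

lemma Psi_add:
  assumes "x \<in> flow_dom" shows "\<Psi> (s + t) x = \<Psi> s (\<Psi> t x)"
proof -
  have shift: "X_has_deriv (\<lambda>s. \<gamma> (s + t)) v s \<longleftrightarrow> X_has_deriv \<gamma> v (s + t)" for \<gamma> and v :: "'d config" and s
    by (simp only: X_has_deriv_def ac_simps)
  have sol: "\<Psi> s x \<in> Xspace" "X_has_deriv (\<lambda>t. \<Psi> t x) (\<lambda>i. - g (\<Psi> s x) i) s" for s
    using Psi_solution(1)[OF assms] by (simp_all add: grad_flow_solution_def)
  have "grad_flow_solution r S (\<lambda>s. \<Psi> (s + t) x)"
    unfolding grad_flow_solution_def shift[of "\<lambda>t. \<Psi> t x"] using sol by blast
  then show ?thesis by (rule Psi_eq[symmetric]) simp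
qed

lemma Psi_tau:
  assumes "x \<in> flow_dom" "tau k l x \<in> Xspace"
  shows "\<Psi> t (tau k l x) = tau k l (\<Psi> t x)"
proof -
  obtain M where M: "\<And>i. \<bar>g x i\<bar> \<le> M" using assms unfolding flow_dom_def by blast
  obtain A where A: "\<And>t i. \<bar>\<Psi> t x i - x i\<bar> \<le> A * exp (2 * L * \<bar>t\<bar>)"
    using Psi_solution(3)[OF assms(1)] by blast
  have "grad_flow_solution r S (\<lambda>t. tau k l (\<Psi> t x))"
  proof (rule solution_of_coord[OF _ assms(2), of _ M A "2 * L"])
    show "tau k l (\<Psi> 0 x) = tau k l x" by (simp add: Psi_solution(2)[OF assms(1)])
    show "\<bar>g (tau k l x) i\<bar> \<le> M" for i using M by (simp add: g_tau)
    show "((\<lambda>t. tau k l (\<Psi> t x) i) has_real_derivative - g (tau k l (\<Psi> t x)) i) (at t)" for t i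
      unfolding tau_apply g_tau using Psi_deriv[OF assms(1)] by (auto intro!: derivative_eq_intros)
    show "\<bar>tau k l (\<Psi> t x) i - tau k l x i\<bar> \<le> A * exp (2 * L * \<bar>t\<bar>)" for t i
      using A by (simp add: tau_apply)
  qed (use L_pos in simp)
  then show ?thesis by (rule Psi_eq) (simp add: Psi_solution(2)[OF assms(1)])
qed

end

section \<open>The rational period lattice and monotonicity of the flow\<close>

text \<open>The offset \<open>c\<close> admits both the box based at the origin and boxes that grow
  symmetrically around it.\<close>

definition pbox :: "int \<Rightarrow> int \<Rightarrow> 'd site set" where
  "pbox c N = {i. \<forall>m. c \<le> i m \<and> i m < c + N}"

definition rep :: "int \<Rightarrow> int \<Rightarrow> 'd site \<Rightarrow> 'd site" where
  "rep c N i = (\<lambda>m. c + (i m - c) mod N)"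

definition scale :: "int \<Rightarrow> 'd site \<Rightarrow> 'd site" where
  "scale N e = (\<lambda>m. N * e m)"

definition periodic :: "int \<Rightarrow> ('d site \<Rightarrow> 'b) \<Rightarrow> bool" where
  "periodic N h \<longleftrightarrow> (\<forall>i e. h (site_add i (scale N e)) = h i)"

lemma finite_pbox: "finite (pbox c N :: ('d::finite) site set)"
proof -
  have "pbox c N \<subseteq> PiE (UNIV :: 'd set) (\<lambda>_. {c..<c+N})" by (auto simp: pbox_def)
  then show ?thesis by (rule finite_subset) (auto intro!: finite_PiE)
qed

lemma rep_in_pbox: "0 < N \<Longrightarrow> rep c N i \<in> pbox c N"
  by (auto simp: rep_def pbox_def)

lemma rep_pbox: "i \<in> pbox c N \<Longrightarrow> rep c N i = i"
proof
  fix m assume "i \<in> pbox c N"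
  then have "0 \<le> i m - c" "i m - c < N" unfolding pbox_def by (auto simp: algebra_simps)
  then show "rep c N i m = i m" by (simp add: rep_def mod_pos_pos_trivial)
qed

lemma rep_decomp: "i = site_add (rep c N i) (scale N (\<lambda>m. (i m - c) div N))"
  by (rule ext) (simp add: rep_def site_add_def scale_def)

lemma rep_add_scale: "rep c N (site_add i (scale N e)) = rep c N i"
proof
  fix m
  have "(i m + N * e m - c) mod N = (i m - c + e m * N) mod N" by (simp add: algebra_simps)
  then show "rep c N (site_add i (scale N e)) m = rep c N i m"
    by (simp add: rep_def site_add_def scale_def)
qed

lemma periodic_rep: "periodic N h \<Longrightarrow> h (rep c N i) = h i"
  using rep_decomp[of i c N] unfolding periodic_def by metis

lemma scale_mult: "scale (N * a) e = scale N (scale a e)"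
  by (simp add: scale_def mult.assoc)

text \<open>Translating and then reducing modulo \<open>N\<close> permutes the box.\<close>

lemma sum_pbox_shift:
  fixes h :: "('d::finite) site \<Rightarrow> real"
  assumes "0 < N" "periodic N h"
  shows "(\<Sum>j\<in>pbox c N. h (site_add j k)) = (\<Sum>j\<in>pbox c N. h j)"
proof -
  have per: "rep c N (site_add (rep c N j) k) = rep c N (site_add j k)" for j k
  proof -
    have "site_add j k = site_add (site_add (rep c N j) k) (scale N (\<lambda>m. (j m - c) div N))"
      by (subst rep_decomp[of j c N]) (simp add: site_add_def add_ac)
    then show ?thesis using rep_add_scale by metis
  qed
  have "(\<Sum>j\<in>pbox c N. h (rep c N (site_add j k))) = (\<Sum>j\<in>pbox c N. h j)"
  proof (rule sum.reindex_bij_witness[where i = "\<lambda>j. rep c N (site_diff j k)" and j = "\<lambda>j. rep c N (site_add j k)"])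
    fix j :: "'d site" assume j: "j \<in> pbox c N"
    have "site_diff a k = site_add a (\<lambda>m. - k m)" for a by (simp add: site_diff_def site_add_def)
    then show "rep c N (site_diff (rep c N (site_add j k)) k) = j"
      by (simp add: per) (simp add: site_add_def rep_pbox[OF j])
    show "rep c N (site_add (rep c N (site_diff j k)) k) = j"
      by (simp add: per site_simps rep_pbox[OF j])
  qed (use assms(1) in \<open>auto intro: rep_in_pbox\<close>)
  then show ?thesis by (simp add: periodic_rep[OF assms(2)])
qed

text \<open>Induction on the distance to \<open>k0\<close>, moving one unit towards it in a
  coordinate that differs. It spreads the nearest-neighbour information of (C) and (D) over all
  sites.\<close>

lemma lattice_connected:
  fixes P :: "('d::finite) site \<Rightarrow> bool"
  assumes "P k0" and step: "\<And>i k. P k \<Longrightarrow> norm1 (site_diff i k) = 1 \<Longrightarrow> P i"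
  shows "P i"
proof (induction "\<Sum>m\<in>UNIV. nat \<bar>i m - k0 m\<bar>" arbitrary: i rule: less_induct)
  case less
  show ?case
  proof (cases "i = k0")
    case True then show ?thesis using assms(1) by simp
  next
    case False
    then obtain m where m: "i m \<noteq> k0 m" by (auto simp: fun_eq_iff)
    define j where "j = i(m := i m - sgn (i m - k0 m))"
    have sg: "\<bar>sgn (i m - k0 m)\<bar> = (1::int)" using m by (simp add: abs_sgn_eq)
    have "(\<Sum>l\<in>UNIV. nat \<bar>j l - k0 l\<bar>) < (\<Sum>l\<in>UNIV. nat \<bar>i l - k0 l\<bar>)"
    proof (rule sum_strict_mono_ex1)
      have jm: "nat \<bar>j m - k0 m\<bar> < nat \<bar>i m - k0 m\<bar>" using m by (auto simp: j_def sgn_if)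
      then show "\<exists>a\<in>UNIV. nat \<bar>j a - k0 a\<bar> < nat \<bar>i a - k0 a\<bar>" by blast
      show "\<forall>a\<in>UNIV. nat \<bar>j a - k0 a\<bar> \<le> nat \<bar>i a - k0 a\<bar>"
      proof
        fix a show "nat \<bar>j a - k0 a\<bar> \<le> nat \<bar>i a - k0 a\<bar>"
          using jm by (cases "a = m") (auto simp: j_def)
      qed
    qed simp
    then have "P j" by (rule less)
    moreover have "norm1 (site_diff i j) = 1"
    proof -
      have "norm1 (site_diff i j) = (\<Sum>l\<in>UNIV. if l = m then 1 else 0)"
        unfolding norm1_def site_diff_def j_def by (intro sum.cong) (use m in \<open>auto simp: sgn_if\<close>)
      then show ?thesis by simp
    qed
    ultimately show ?thesis by (rule step)
  qed
qed

section \<open>The affine space \<open>E\<close> belonging to a rational rotation vector\<close>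

locale rational_rotation = lattice_potentials r S
  for r :: real and S :: "('d::finite) site \<Rightarrow> 'd config \<Rightarrow> real" +
  fixes \<omega> :: "'d \<Rightarrow> real"
  assumes rat: "\<And>m. \<omega> m \<in> \<rat>"
begin

abbreviation ip :: "'d site \<Rightarrow> real" where "ip \<equiv> inner_site \<omega>"

lemma ip_add: "ip (site_add k k') = ip k + ip k'"
  by (simp add: inner_site_def site_add_def distrib_left sum.distrib)

lemma ip_scale: "ip (scale N e) = of_int N * ip e"
  by (simp add: inner_site_def scale_def sum_distrib_left mult_ac)

lemma ip_neg: "ip (\<lambda>m. - k m) = - ip k"
  by (simp add: inner_site_def sum_negf)

lemma ip_origin: "ip origin = 0"
  by (simp add: inner_site_def)

lemma denominator_ex: "\<exists>q::int. q > 0 \<and> (\<forall>e. \<exists>p::int. ip (scale q e) = of_int p)"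
proof -
  have "\<exists>a b::int. b > 0 \<and> \<omega> m = of_int a / of_int b" for m
    using rat[of m] by (rule Rats_cases') blast
  then obtain a b :: "'d \<Rightarrow> int" where ab: "\<And>m. b m > 0" "\<And>m. \<omega> m = of_int (a m) / of_int (b m)"
    by metis
  define q where "q = (\<Prod>m\<in>UNIV. b m)"
  have "\<exists>p::int. of_int q * \<omega> m = of_int p" for m
  proof -
    have "q = b m * (\<Prod>m\<in>UNIV-{m}. b m)" unfolding q_def by (simp add: prod.remove)
    then have "of_int q * \<omega> m = of_int (a m * (\<Prod>m\<in>UNIV-{m}. b m))"
      using ab(1)[of m] by (simp add: ab(2))
    then show ?thesis by blast
  qed
  then obtain p where p: "\<And>m. of_int q * \<omega> m = of_int (p m :: int)" by metis
  have "\<omega> m * of_int (q * a) = of_int (p m * a)" for m a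
    by (simp add: p[symmetric] mult_ac)
  then have "ip (scale q e) = of_int (\<Sum>m\<in>UNIV. p m * e m)" for e
    by (simp add: inner_site_def scale_def del: of_int_mult)
  moreover have "q > 0" unfolding q_def using ab(1) by (intro prod_pos) auto
  ultimately show ?thesis by blast
qed

definition q :: int where "q = (SOME q. q > 0 \<and> (\<forall>e. \<exists>p::int. ip (scale q e) = of_int p))"

lemma q_pos: "q > 0" and q_int: "\<exists>p::int. ip (scale q e) = of_int p"
proof -
  have "q > 0 \<and> (\<forall>e. \<exists>p::int. ip (scale q e) = of_int p)"
    unfolding q_def using denominator_ex by (rule someI_ex)
  then show "q > 0" "\<exists>p::int. ip (scale q e) = of_int p" by blast+
qed

text \<open>The mean displacement that \<open>tau k l\<close> causes on configurations with rotation
  vector \<open>\<omega>\<close>; its sign decides the direction in which a Birkhoff configuration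
  is moved.\<close>

definition height :: "'d site \<Rightarrow> int \<Rightarrow> real" where
  "height k l = ip k + of_int l"

lemma height_add: "height (site_add k k') (l + l') = height k l + height k' l'"
  by (simp add: height_def ip_add)

lemma height_neg: "height (\<lambda>m. - k m) (- l) = - height k l"
  by (simp add: height_def ip_neg)

lemma tau_inverse: "tau (\<lambda>m. - k m) (- l) (tau k l x) = x" "tau k l (tau (\<lambda>m. - k m) (- l) x) = x"
  by (simp_all add: tau_tau tau_def site_add_def)

definition E :: "'d config set" where
  "E = {x. \<forall>k l. height k l = 0 \<longrightarrow> tau k l x = x}"

definition Bw :: "'d config set" where
  "Bw = {x. \<forall>k l. height k l \<ge> 0 \<longrightarrow> x \<le> tau k l x}"

lemma E_shift: "x \<in> E \<Longrightarrow> ip k = of_int p \<Longrightarrow> x (site_add i k) = x i + of_int p"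
proof -
  assume "x \<in> E" "ip k = of_int p"
  then have "tau k (- p) x = x" by (simp add: E_def height_def)
  then have "tau k (- p) x i = x i" by simp
  then show ?thesis by (simp add: tau_apply)
qed

lemma E_add_diff: "x \<in> E \<Longrightarrow> y \<in> E \<Longrightarrow> z \<in> E \<Longrightarrow> (\<lambda>i. x i + c * (y i - z i)) \<in> E"
  unfolding E_def
proof (intro CollectI allI impI ext)
  fix k l i assume x: "x \<in> {x. \<forall>k l. height k l = 0 \<longrightarrow> tau k l x = x}"
    "y \<in> {x. \<forall>k l. height k l = 0 \<longrightarrow> tau k l x = x}"
    "z \<in> {x. \<forall>k l. height k l = 0 \<longrightarrow> tau k l x = x}" and h: "height k l = 0"
  have "tau k l x i = x i" "tau k l y i = y i" "tau k l z i = z i" using x h by auto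
  then have "x (site_add i k) = x i - l" "y (site_add i k) = y i - l" "z (site_add i k) = z i - l"
    by (simp_all add: tau_apply)
  then show "tau k l (\<lambda>i. x i + c * (y i - z i)) i = x i + c * (y i - z i)"
    by (simp add: tau_apply)
qed

text \<open>The form in which finite dimensionality of \<open>E\<close> is used: differences are
  determined by their values on the finite box \<open>Q\<close>, hence bounded.\<close>

lemma E_diff_periodic: "x \<in> E \<Longrightarrow> y \<in> E \<Longrightarrow> periodic q (\<lambda>i. x i - y i)"
  unfolding periodic_def
proof (intro allI)
  fix i e assume "x \<in> E" "y \<in> E"
  obtain p where "ip (scale q e) = of_int p" using q_int by blast
  then show "x (site_add i (scale q e)) - y (site_add i (scale q e)) = x i - y i"
    using \<open>x \<in> E\<close> \<open>y \<in> E\<close> by (simp add: E_shift)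
qed

abbreviation Q :: "'d site set" where "Q \<equiv> pbox 0 q"

lemma Q_nonempty: "Q \<noteq> {}"
  using rep_in_pbox[OF q_pos] by blast

lemma periodic_bounded:
  fixes h :: "'d site \<Rightarrow> real"
  assumes "periodic q h" obtains M where "\<And>i. \<bar>h i\<bar> \<le> M" "0 \<le> M"
proof -
  have "\<bar>h i\<bar> \<le> (\<Sum>j\<in>Q. \<bar>h j\<bar>)" for i
  proof -
    have "\<bar>h (rep 0 q i)\<bar> \<le> (\<Sum>j\<in>Q. \<bar>h j\<bar>)"
      by (rule member_le_sum[OF rep_in_pbox[OF q_pos]]) (auto intro: finite_pbox)
    then show ?thesis using periodic_rep[OF assms] by metis
  qed
  then show ?thesis using that[of "\<Sum>j\<in>Q. \<bar>h j\<bar>"] by (simp add: sum_nonneg)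
qed

lemma E_diff_bounded:
  assumes "x \<in> E" "y \<in> E" obtains M where "\<And>i. \<bar>x i - y i\<bar> \<le> M" "0 \<le> M"
  using periodic_bounded[OF E_diff_periodic[OF assms]] by metis

lemma ip_in_E: "ip \<in> E"
  by (auto simp: E_def tau_def height_def ip_add)

lemma E_growth:
  assumes "x \<in> E" obtains A B where "\<And>i. \<bar>x i\<bar> \<le> A + B * norm1 i" "0 \<le> B"
proof -
  obtain M where M: "\<And>i. \<bar>x i - ip i\<bar> \<le> M" using E_diff_bounded[OF assms ip_in_E] by metis
  define B where "B = (\<Sum>m\<in>UNIV. \<bar>\<omega> m\<bar>)"
  have "\<bar>ip i\<bar> \<le> B * norm1 i" for i
  proof -
    have "\<bar>ip i\<bar> \<le> (\<Sum>m\<in>UNIV. \<bar>\<omega> m\<bar> * real_of_int \<bar>i m\<bar>)"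
      unfolding inner_site_def by (rule order_trans[OF sum_abs]) (simp add: abs_mult)
    also have "\<dots> \<le> (\<Sum>m\<in>UNIV. \<bar>\<omega> m\<bar> * norm1 i)"
      by (intro sum_mono mult_left_mono norm1_ge_coord) auto
    finally show ?thesis by (simp add: B_def sum_distrib_right)
  qed
  then have b: "\<bar>ip i\<bar> \<le> B * norm1 i" for i .
  have "\<bar>x i\<bar> \<le> M + B * norm1 i" for i
    using M[of i] b[of i] by linarith
  moreover have "0 \<le> B" by (simp add: B_def sum_nonneg)
  ultimately show ?thesis using that by blast
qed

lemma g_periodic: "x \<in> E \<Longrightarrow> ip k = of_int p \<Longrightarrow> g x (site_add i k) = g x i"
proof -
  assume "x \<in> E" "ip k = of_int p"
  then have "tau k (- p) x = x" by (simp add: E_def height_def)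
  then show ?thesis using g_tau[of k "- p" x i] by simp
qed

lemma E_flow_dom: assumes "x \<in> E" shows "x \<in> flow_dom"
proof -
  have "periodic q (g x)"
    unfolding periodic_def using g_periodic[OF assms] q_int by blast
  then obtain M where "\<And>i. \<bar>g x i\<bar> \<le> M" using periodic_bounded by metis
  moreover obtain A B where "\<And>i. \<bar>x i\<bar> \<le> A + B * norm1 i" "0 \<le> B" using E_growth[OF assms] by metis
  then have "x \<in> Xspace" by (rule Xspace_linear_growth)
  ultimately show ?thesis unfolding flow_dom_def by blast
qed

lemma tau_E: assumes "x \<in> E" shows "tau k l x \<in> E"
  unfolding E_def
proof (intro CollectI allI impI)
  fix k' l' assume "height k' l' = 0"
  then have "tau k' l' x = x" using assms by (simp add: E_def)
  moreover have "tau k' l' (tau k l x) = tau k l (tau k' l' x)"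
    by (simp add: tau_tau add.commute site_add_commute)
  ultimately show "tau k' l' (tau k l x) = tau k l x" by simp
qed

lemma tau_Xspace: "x \<in> E \<Longrightarrow> tau k l x \<in> Xspace"
  using E_flow_dom[OF tau_E] by (simp add: flow_dom_def)

lemma Psi_tau_E: "x \<in> E \<Longrightarrow> \<Psi> t (tau k l x) = tau k l (\<Psi> t x)"
  by (rule Psi_tau[OF E_flow_dom tau_Xspace])

lemma Psi_E: "x \<in> E \<Longrightarrow> \<Psi> t x \<in> E"
proof -
  assume x: "x \<in> E"
  have "tau k l (\<Psi> t x) = \<Psi> t x" if "height k l = 0" for k l
    using Psi_tau_E[OF x, of t k l] x that by (simp add: E_def)
  then show ?thesis by (simp add: E_def)
qed

lemma Psi_0: "x \<in> E \<Longrightarrow> \<Psi> 0 x = x"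
  by (rule Psi_solution(2)[OF E_flow_dom])

lemma Psi_add_E: "x \<in> E \<Longrightarrow> \<Psi> s (\<Psi> t x) = \<Psi> (s + t) x"
  by (rule Psi_add[OF E_flow_dom, symmetric])

lemma Psi_inverse: "x \<in> E \<Longrightarrow> \<Psi> (- t) (\<Psi> t x) = x" "x \<in> E \<Longrightarrow> \<Psi> t (\<Psi> (- t) x) = x"
  by (simp_all add: Psi_add_E Psi_0)

lemma Psi_deriv_E: "x \<in> E \<Longrightarrow> ((\<lambda>t. \<Psi> t x i) has_real_derivative - g (\<Psi> t x) i) (at t)"
  by (rule Psi_deriv[OF E_flow_dom])

text \<open>Only the positive part of \<open>x - y\<close> is estimated: each pass halves its
  exponential bound, starting from \<open>M\<close>. The differential inequalities make the result
  applicable to constant sub- and supersolutions as well as to orbits.\<close>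

lemma comparison:
  assumes "0 \<le> T"
    and dx: "\<And>s i. 0 \<le> s \<Longrightarrow> s \<le> T \<Longrightarrow> ((\<lambda>s. x s i) has_real_derivative x' s i) (at s)"
    and dy: "\<And>s i. 0 \<le> s \<Longrightarrow> s \<le> T \<Longrightarrow> ((\<lambda>s. y s i) has_real_derivative y' s i) (at s)"
    and sub: "\<And>s i. 0 \<le> s \<Longrightarrow> s \<le> T \<Longrightarrow> x' s i \<le> - g (x s) i"
    and super: "\<And>s i. 0 \<le> s \<Longrightarrow> s \<le> T \<Longrightarrow> - g (y s) i \<le> y' s i"
    and M: "\<And>s i. 0 \<le> s \<Longrightarrow> s \<le> T \<Longrightarrow> x s i - y s i \<le> M"
    and le: "x 0 \<le> y 0"
  shows "x T \<le> y T"
proof -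
  \<comment> \<open>This rate makes \<open>(K + L) / (K + \<rho>)\<close> equal to one half.\<close>
  define \<rho> where "\<rho> = 2 * L + K"
  have pos: "0 < K" "0 < L" by (rule K_pos L_pos)+
  define M' where "M' = max M 0"
  have bd: "x t i - y t i \<le> M' * (1/2) ^ n * exp (\<rho> * t)" if "0 \<le> t" "t \<le> T" for n t i
    using that
  proof (induction n arbitrary: t i)
    case 0
    have "M' * 1 \<le> M' * exp (\<rho> * t)" using 0 pos by (intro mult_left_mono) (auto simp: M'_def \<rho>_def)
    then show ?case using M[OF 0, of i] by (simp add: M'_def)
  next
    case (Suc n)
    define B where "B = M' * (1/2) ^ n"
    have B0: "0 \<le> B" by (simp add: B_def M'_def)
    let ?u = "\<lambda>s. exp (K * s) * (x s i - y s i)"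
    have "?u t - ?u 0 \<le> (K + L) * B / (K + \<rho>) * (exp ((K + \<rho>) * t) - 1)"
    proof (rule growth_bound_above[where u' = "\<lambda>s. exp (K * s) * (K * (x s i - y s i) + (x' s i - y' s i))"])
      fix s assume s: "0 \<le> s" "s \<le> t"
      then have s': "s \<le> T" using Suc.prems by simp
      show "(?u has_real_derivative exp (K * s) * (K * (x s i - y s i) + (x' s i - y' s i))) (at s)"
        by (auto intro!: derivative_eq_intros dx dy s s' simp: algebra_simps)
      \<comment> \<open>Since \<open>x s\<close> and \<open>y s\<close> are not yet known to be
        ordered, both are compared with their supremum: \<open>g_one_sided\<close> applies to
        \<open>x s \<le> z\<close>, and \<open>z - y s\<close> is the positive part controlled by
        the induction hypothesis.\<close>
      define z where "z = sup (x s) (y s)"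
      have "x s \<le> z" "y s \<le> z" by (simp_all add: z_def)
      have "\<bar>z k - y s k\<bar> \<le> B * exp (\<rho> * s)" for k
        using Suc.IH[OF s(1) s', of k] B0 by (auto simp: z_def sup_max B_def[symmetric] max_def)
      then have 1: "\<bar>g z i - g (y s) i\<bar> \<le> L * (B * exp (\<rho> * s))" "\<bar>z i - y s i\<bar> \<le> B * exp (\<rho> * s)"
        using g_lipschitz_sup[of z "y s"] by blast+
      have "g z i - g (x s) i \<le> K * (z i - x s i)" by (rule g_one_sided[OF \<open>x s \<le> z\<close>])
      then have "K * (x s i - y s i) + (x' s i - y' s i) \<le> K * (z i - y s i) - (g z i - g (y s) i)"
        using sub[OF s(1) s', of i] super[OF s(1) s', of i] by (simp add: right_diff_distrib)
      also have "\<dots> \<le> K * (B * exp (\<rho> * s)) + L * (B * exp (\<rho> * s))"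
      proof -
        have "K * (z i - y s i) \<le> K * (B * exp (\<rho> * s))" using 1(2) pos by (intro mult_left_mono) auto
        then show ?thesis using 1(1) by linarith
      qed
      also have "\<dots> = (K + L) * B * exp (\<rho> * s)" by (simp add: algebra_simps)
      finally have "K * (x s i - y s i) + (x' s i - y' s i) \<le> (K + L) * B * exp (\<rho> * s)" .
      then have "exp (K * s) * (K * (x s i - y s i) + (x' s i - y' s i)) \<le> exp (K * s) * ((K + L) * B * exp (\<rho> * s))"
        by (intro mult_left_mono) auto
      also have "\<dots> = (K + L) * B * (exp (K * s) * exp (\<rho> * s))" by (simp add: mult_ac)
      also have "exp (K * s) * exp (\<rho> * s) = exp ((K + \<rho>) * s)" by (simp add: distrib_right exp_add)
      finally show "exp (K * s) * (K * (x s i - y s i) + (x' s i - y' s i)) \<le> (K + L) * B * exp ((K + \<rho>) * s)" .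
    qed (use Suc.prems pos in \<open>auto simp: \<rho>_def\<close>)
    moreover have "?u 0 \<le> 0" using le by (simp add: le_fun_def)
    moreover have "(K + L) * B / (K + \<rho>) = B / 2"
      using pos by (simp add: \<rho>_def field_simps)
    ultimately have "?u t \<le> B / 2 * (exp ((K + \<rho>) * t) - 1)" by simp
    also have "\<dots> \<le> B / 2 * exp ((K + \<rho>) * t)" using B0 by (intro mult_left_mono) auto
    also have "exp ((K + \<rho>) * t) = exp (K * t) * exp (\<rho> * t)" by (simp add: distrib_right exp_add)
    also have "B / 2 * (exp (K * t) * exp (\<rho> * t)) = exp (K * t) * (B / 2 * exp (\<rho> * t))" by simp
    finally show ?case by (simp add: B_def mult_ac)
  qed
  have "x T i \<le> y T i" for i
  proof -
    have "(\<lambda>n. M' * (1/2) ^ n * exp (\<rho> * T)) \<longlonglongrightarrow> M' * 0 * exp (\<rho> * T)"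
      by (intro tendsto_intros LIMSEQ_power_zero) auto
    then have "x T i - y T i \<le> M' * 0 * exp (\<rho> * T)"
      by (rule tendsto_lowerbound) (use bd[OF assms(1) order_refl] in auto)
    then show ?thesis by simp
  qed
  then show ?thesis by (simp add: le_fun_def)
qed

section \<open>Order preservation and continuity of the flow on \<open>E\<close>\<close>

lemma Psi_drift:
  assumes "x \<in> E" obtains A where "0 \<le> A" "\<And>t i. \<bar>\<Psi> t x i - x i\<bar> \<le> A * exp (2 * L * \<bar>t\<bar>)"
  using Psi_solution(3)[OF E_flow_dom[OF assms]] by metis

lemma exp_mono_abs: "\<bar>s\<bar> \<le> \<bar>T\<bar> \<Longrightarrow> 0 \<le> A \<Longrightarrow> A * exp (2 * L * \<bar>s\<bar>) \<le> A * exp (2 * L * \<bar>T\<bar>)"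
  using L_pos by (intro mult_left_mono) auto

lemma Psi_mono:
  assumes "x \<in> E" "y \<in> E" "x \<le> y" "0 \<le> t" shows "\<Psi> t x \<le> \<Psi> t y"
proof -
  obtain A where A: "0 \<le> A" "\<And>t i. \<bar>\<Psi> t x i - x i\<bar> \<le> A * exp (2 * L * \<bar>t\<bar>)" by (rule Psi_drift[OF assms(1)]) blast
  obtain B where B: "0 \<le> B" "\<And>t i. \<bar>\<Psi> t y i - y i\<bar> \<le> B * exp (2 * L * \<bar>t\<bar>)" by (rule Psi_drift[OF assms(2)]) blast
  show ?thesis
  proof (rule comparison[where M = "A * exp (2 * L * \<bar>t\<bar>) + B * exp (2 * L * \<bar>t\<bar>)"])
    show "\<Psi> s x i - \<Psi> s y i \<le> A * exp (2 * L * \<bar>t\<bar>) + B * exp (2 * L * \<bar>t\<bar>)" if "0 \<le> s" "s \<le> t" for s i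
      using A(2)[of s i] B(2)[of s i] exp_mono_abs[OF _ A(1), of s t] exp_mono_abs[OF _ B(1), of s t]
        le_funD[OF assms(3), of i] that by linarith
  qed (use assms Psi_deriv_E Psi_0 in auto)
qed

lemma Psi_ge_subsolution:
  assumes "x \<in> E" "\<And>i. g x i \<le> 0" "0 \<le> t" shows "x \<le> \<Psi> t x"
proof -
  obtain A where A: "0 \<le> A" "\<And>t i. \<bar>\<Psi> t x i - x i\<bar> \<le> A * exp (2 * L * \<bar>t\<bar>)" by (rule Psi_drift[OF assms(1)]) blast
  show ?thesis
  proof (rule comparison[where x = "\<lambda>_. x" and x' = "\<lambda>_ _. 0" and M = "A * exp (2 * L * \<bar>t\<bar>)"])
    show "x i - \<Psi> s x i \<le> A * exp (2 * L * \<bar>t\<bar>)" if "0 \<le> s" "s \<le> t" for s i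
      using A(2)[of s i] exp_mono_abs[OF _ A(1), of s t] that by linarith
  qed (use assms Psi_deriv_E Psi_0 in auto)
qed

lemma Psi_le_supersolution:
  assumes "x \<in> E" "\<And>i. 0 \<le> g x i" "0 \<le> t" shows "\<Psi> t x \<le> x"
proof -
  obtain A where A: "0 \<le> A" "\<And>t i. \<bar>\<Psi> t x i - x i\<bar> \<le> A * exp (2 * L * \<bar>t\<bar>)" by (rule Psi_drift[OF assms(1)]) blast
  show ?thesis
  proof (rule comparison[where y = "\<lambda>_. x" and y' = "\<lambda>_ _. 0" and M = "A * exp (2 * L * \<bar>t\<bar>)"])
    show "\<Psi> s x i - x i \<le> A * exp (2 * L * \<bar>t\<bar>)" if "0 \<le> s" "s \<le> t" for s i
      using A(2)[of s i] exp_mono_abs[OF _ A(1), of s t] that by linarith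
  qed (use assms Psi_deriv_E Psi_0 in auto)
qed

text \<open>The factor \<open>exp (K * s)\<close> makes every weighted coordinate difference
  nondecreasing, so positivity persists at a site where it holds initially. The strict coupling to
  nearest neighbours passes it on at once, and the lattice is connected.\<close>

lemma Psi_strict_mono:
  assumes "x \<in> E" "y \<in> E" "x \<le> y" "x \<noteq> y" "0 < t" shows "\<Psi> t x i < \<Psi> t y i"
proof -
  have le: "\<Psi> s x \<le> \<Psi> s y" if "0 \<le> s" for s by (rule Psi_mono[OF assms(1-3) that])
  define w where "w = (\<lambda>i s. exp (K * s) * (\<Psi> s y i - \<Psi> s x i))"
  define w' where "w' = (\<lambda>i s. exp (K * s) * (K * (\<Psi> s y i - \<Psi> s x i) - (g (\<Psi> s y) i - g (\<Psi> s x) i)))"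
  have dw: "(w i has_real_derivative w' i s) (at s)" for i s
    unfolding w_def w'_def
    by (auto intro!: derivative_eq_intros Psi_deriv_E assms simp: algebra_simps)
  have w'0: "0 \<le> w' i s" if "0 \<le> s" for i s
    using g_one_sided[OF le[OF that], of i] by (simp add: w'_def)
  have w0: "0 \<le> w i s" if "0 \<le> s" for i s
    using le[OF that] by (simp add: w_def le_fun_def)
  have wpos: "0 < w i s \<longleftrightarrow> \<Psi> s x i < \<Psi> s y i" for i s
    by (simp add: w_def zero_less_mult_iff)
  obtain k0 where k0: "x k0 < y k0" using assms(3,4) by (metis antisym le_fun_def not_le)
  have "\<forall>s>0. 0 < w i s"
  proof (rule lattice_connected[where P = "\<lambda>i. \<forall>s>0. 0 < w i s" and ?k0.0 = k0])
    show "\<forall>s>0. 0 < w k0 s"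
    proof (intro allI impI)
      fix s :: real assume "0 < s"
      have "w k0 0 \<le> w k0 s"
      proof (rule DERIV_nonneg_imp_nondecreasing[where f = "w k0"])
        fix z :: real assume "0 \<le> z"
        then show "\<exists>d. (w k0 has_real_derivative d) (at z) \<and> 0 \<le> d"
          by (intro exI[of _ "w' k0 z"] conjI dw w'0)
      qed (use \<open>0 < s\<close> in simp)
      moreover have "0 < w k0 0" using k0 assms by (simp add: w_def Psi_0)
      ultimately show "0 < w k0 s" by linarith
    qed
  next
    fix i k assume k: "\<forall>s>0. 0 < w k s" and nb: "norm1 (site_diff i k) = 1"
    show "\<forall>s>0. 0 < w i s"
    proof (intro allI impI)
      fix s :: real assume s: "0 < s"
      \<comment> \<open>The neighbour is known to be positive only at positive times, so growth is
        measured from \<open>s/2\<close> instead of \<open>0\<close>.\<close>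
      have "w i (s/2) < w i s"
      proof (rule DERIV_pos_imp_increasing[where f = "w i"])
        fix z assume "s/2 \<le> z" "z \<le> s"
        then have z: "0 < z" using s by linarith
        have "\<Psi> z x k < \<Psi> z y k" using k z wpos by blast
        then have "0 < w' i z"
          using g_one_sided_strict[OF le nb, of z] z by (simp add: w'_def)
        then show "\<exists>d. (w i has_real_derivative d) (at z) \<and> 0 < d" using dw by blast
      qed (use s in simp)
      then show "0 < w i s" using w0[of "s/2" i] s by linarith
    qed
  qed
  then show ?thesis using assms(5) wpos by blast
qed

text \<open>One integration turns the coefficient \<open>D\<close> of the bound into
  \<open>c + D / 2\<close>, whose fixed point is \<open>2 * c\<close>; the drift contribution
  \<open>A + B\<close> is halved away. Both time directions are covered.\<close>

lemma Psi_lipschitz: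
  assumes "x \<in> E" "y \<in> E" "\<And>i. \<bar>y i - x i\<bar> \<le> c"
  shows "\<bar>\<Psi> t y i - \<Psi> t x i\<bar> \<le> 2 * c * exp (2 * L * \<bar>t\<bar>)"
proof -
  obtain A where A: "0 \<le> A" "\<And>t i. \<bar>\<Psi> t x i - x i\<bar> \<le> A * exp (2 * L * \<bar>t\<bar>)" by (rule Psi_drift[OF assms(1)]) blast
  obtain B where B: "0 \<le> B" "\<And>t i. \<bar>\<Psi> t y i - y i\<bar> \<le> B * exp (2 * L * \<bar>t\<bar>)" by (rule Psi_drift[OF assms(2)]) blast
  have c0: "0 \<le> c" using assms(3)[of origin] by linarith
  have e1: "1 \<le> exp (2 * L * \<bar>t\<bar>)" for t using L_pos by simp
  have bd: "\<bar>\<Psi> t y i - \<Psi> t x i\<bar> \<le> (2 * c + (A + B) * (1/2) ^ n) * exp (2 * L * \<bar>t\<bar>)" for n t i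
  proof (induction n arbitrary: t i)
    case 0
    have "c * 1 \<le> (2 * c) * exp (2 * L * \<bar>t\<bar>)" using c0 e1[of t] by (intro mult_mono) auto
    then have "\<bar>\<Psi> t y i - \<Psi> t x i\<bar> \<le> A * exp (2 * L * \<bar>t\<bar>) + B * exp (2 * L * \<bar>t\<bar>) + 2 * c * exp (2 * L * \<bar>t\<bar>)"
      using A(2)[of t i] B(2)[of t i] assms(3)[of i] by linarith
    then show ?case by (simp add: distrib_right)
  next
    case (Suc n)
    define D where "D = 2 * c + (A + B) * (1/2) ^ n"
    let ?u = "\<lambda>t. \<Psi> t y i - \<Psi> t x i"
    have "\<bar>?u t - ?u 0\<bar> \<le> L * D / (2 * L) * (exp (2 * L * \<bar>t\<bar>) - 1)"
    proof (rule growth_bound[OF _ DERIV_diff[OF Psi_deriv_E[OF assms(2)] Psi_deriv_E[OF assms(1)]]])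
      fix s
      have "\<bar>g (\<Psi> s y) i - g (\<Psi> s x) i\<bar> \<le> L * (D * exp (2 * L * \<bar>s\<bar>))"
        by (rule g_lipschitz_sup) (use Suc.IH[of s] in \<open>simp only: D_def\<close>)
      then show "\<bar>- g (\<Psi> s y) i - - g (\<Psi> s x) i\<bar> \<le> L * D * exp (2 * L * \<bar>s\<bar>)"
        by (simp add: mult_ac abs_minus_commute)
    qed (use L_pos in simp)
    moreover have "L * D / (2 * L) = D / 2" using L_pos by simp
    ultimately have 1: "\<bar>?u t - ?u 0\<bar> \<le> D / 2 * (exp (2 * L * \<bar>t\<bar>) - 1)" by (simp only:)
    have D: "D / 2 = c + (A + B) * (1/2) ^ Suc n" by (simp add: D_def)
    have "\<bar>?u 0\<bar> \<le> c" using assms by (simp add: Psi_0)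
    then have "\<bar>?u t\<bar> \<le> c + D / 2 * (exp (2 * L * \<bar>t\<bar>) - 1)" using 1 by linarith
    also have "\<dots> \<le> c * exp (2 * L * \<bar>t\<bar>) + D / 2 * exp (2 * L * \<bar>t\<bar>)"
    proof -
      have "0 \<le> D" using c0 A(1) B(1) by (simp add: D_def)
      then show ?thesis using mult_left_mono[OF e1[of t] c0] by (simp add: right_diff_distrib)
    qed
    also have "\<dots> = (2 * c + (A + B) * (1/2) ^ Suc n) * exp (2 * L * \<bar>t\<bar>)"
      unfolding D by (simp add: algebra_simps)
    finally show ?case .
  qed
  have "(\<lambda>n. (2 * c + (A + B) * (1/2) ^ n) * exp (2 * L * \<bar>t\<bar>)) \<longlonglongrightarrow> (2 * c + (A + B) * 0) * exp (2 * L * \<bar>t\<bar>)"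
    by (intro tendsto_intros LIMSEQ_power_zero) auto
  then have "\<bar>\<Psi> t y i - \<Psi> t x i\<bar> \<le> (2 * c + (A + B) * 0) * exp (2 * L * \<bar>t\<bar>)"
    by (rule tendsto_lowerbound) (use bd in auto)
  then show ?thesis by simp
qed

text \<open>The finitely many sites of \<open>Q\<close> decide, because differences within
  \<open>E\<close> are periodic.\<close>

lemma E_tendsto_uniform:
  assumes "(y \<longlongrightarrow> x) G" "\<forall>\<^sub>F s in G. y s \<in> E" "x \<in> E" "0 < e"
  shows "\<forall>\<^sub>F s in G. \<forall>i. \<bar>y s i - x i\<bar> < e"
proof -
  have "\<forall>\<^sub>F s in G. \<bar>y s i - x i\<bar> < e" for i
    using assms(1,4) unfolding tendsto_config_iff by (auto simp: tendsto_iff dist_real_def)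
  then have "\<forall>\<^sub>F s in G. \<forall>i\<in>Q. \<bar>y s i - x i\<bar> < e"
    by (intro eventually_ball_finite finite_pbox) auto
  with assms(2) show ?thesis
  proof eventually_elim
    case (elim s)
    have "\<bar>y s (rep 0 q i) - x (rep 0 q i)\<bar> < e" for i
      using elim(2) rep_in_pbox[OF q_pos] by blast
    then show ?case using periodic_rep[OF E_diff_periodic[OF elim(1) assms(3)], of 0] by simp
  qed
qed

lemma Psi_tendsto:
  assumes "(y \<longlongrightarrow> x) G" "\<forall>\<^sub>F s in G. y s \<in> E" "x \<in> E"
  shows "((\<lambda>s. \<Psi> t (y s)) \<longlongrightarrow> \<Psi> t x) G"
  unfolding tendsto_config_iff
proof (intro allI tendstoI)
  fix i and e :: real assume e: "0 < e"
  define c where "c = e / (4 * exp (2 * L * \<bar>t\<bar>))"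
  have c: "0 < c" using e by (simp add: c_def)
  from E_tendsto_uniform[OF assms c] assms(2)
  show "\<forall>\<^sub>F s in G. dist (\<Psi> t (y s) i) (\<Psi> t x i) < e"
  proof eventually_elim
    case (elim s)
    have "\<bar>\<Psi> t (y s) i - \<Psi> t x i\<bar> \<le> 2 * c * exp (2 * L * \<bar>t\<bar>)"
      by (rule Psi_lipschitz[OF assms(3) elim(2)]) (use elim(1) in \<open>simp add: less_imp_le\<close>)
    also have "\<dots> < e" using e by (simp add: c_def)
    finally show ?case by (simp add: dist_real_def)
  qed
qed

lemma Psi_continuous_on: "continuous_on E (\<Psi> t)"
  unfolding continuous_on_def
  by (auto intro!: Psi_tendsto simp: eventually_at_filter)

end

section \<open>A Birkhoff global minimiser\<close>

lemma compact_order_interval: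
  fixes a b :: "'i \<Rightarrow> real"
  shows "compact {x. \<forall>i. a i \<le> x i \<and> x i \<le> b i}"
proof -
  have "compactin (product_topology (\<lambda>_::'i. euclideanreal) UNIV) (PiE UNIV (\<lambda>i. {a i..b i}))"
    by (simp add: compactin_PiE)
  moreover have "PiE UNIV (\<lambda>i. {a i..b i}) = {x. \<forall>i. a i \<le> x i \<and> x i \<le> b i}"
    by (auto simp: PiE_def Pi_def)
  ultimately show ?thesis by (simp add: euclidean_product_topology)
qed

lemma continuous_on_coord: "continuous_on A (\<lambda>x :: 'i \<Rightarrow> real. x i)"
  by (rule continuous_on_subset[OF continuous_on_product_coordinates]) simp

lemma config_convergent_subseq:
  fixes f :: "nat \<Rightarrow> ('d::finite) config"
  assumes "\<And>n i. a i \<le> f n i" "\<And>n i. f n i \<le> b i"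
  obtains l h where "strict_mono h" "(f \<circ> h) \<longlonglongrightarrow> l"
proof -
  have "seq_compact {x. \<forall>i. a i \<le> x i \<and> x i \<le> b i}"
    by (rule compact_imp_seq_compact[OF compact_order_interval])
  then show ?thesis using assms that unfolding seq_compact_def by blast
qed

context lattice_potentials
begin

lemma S_uniform_lower_bound: "\<exists>b. \<forall>j x. b \<le> S j x"
proof -
  obtain b where "\<And>x. b \<le> S origin x" using S_bdd_below by blast
  then have "b \<le> S origin (tau j 0 x)" for j x by blast
  then have "b \<le> S j x" for j x unfolding S_tau by (simp add: site_simps)
  then show ?thesis by blast
qed

text \<open>Translation invariance moves every bond to the origin, where only finitely many
  neighbours occur; the sum of their thresholds serves for all.\<close>

lemma S_uniform_coercive:
  "\<exists>R. \<forall>j k x. norm1 (site_diff k j) = 1 \<longrightarrow> S j x \<le> M \<longrightarrow> \<bar>x k - x j\<bar> \<le> R"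
proof -
  have "\<exists>R. \<forall>x. norm1 d = 1 \<longrightarrow> R \<le> \<bar>x d - x origin\<bar> \<longrightarrow> M + 1 \<le> S origin x" for d
    using S_coercive[of d origin "M + 1"] by (cases "norm1 d = 1") (simp_all add: site_simps)
  then obtain R where R: "\<And>d x. norm1 d = 1 \<Longrightarrow> R d \<le> \<bar>x d - x origin\<bar> \<Longrightarrow> M + 1 \<le> S origin x" by metis
  define R' where "R' = (\<Sum>d\<in>ball1 origin 1. \<bar>R d\<bar>)"
  have "\<bar>x k - x j\<bar> \<le> R'" if nb: "norm1 (site_diff k j) = 1" and le: "S j x \<le> M" for j k x
  proof (rule ccontr)
    assume n: "\<not> \<bar>x k - x j\<bar> \<le> R'"
    let ?d = "site_diff k j"
    have "\<bar>R ?d\<bar> \<le> R'"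
      unfolding R'_def
      by (rule member_le_sum[OF _ _ finite_ball1]) (use nb in \<open>auto simp: ball1_def site_simps\<close>)
    moreover have "tau j 0 x ?d = x k" "tau j 0 x origin = x j" by (simp_all add: tau_apply site_simps)
    ultimately have "R ?d \<le> \<bar>tau j 0 x ?d - tau j 0 x origin\<bar>" using n by simp
    then have "M + 1 \<le> S origin (tau j 0 x)" by (rule R[OF nb])
    then show False using le by (simp add: S_tau site_simps)
  qed
  then show ?thesis by blast
qed

lemma W_B_cont: "continuous_on UNIV (W_B S B)"
  unfolding W_B_def by (intro continuous_on_sum S_cont)

text \<open>For the ball of radius \<open>r\<close> around \<open>i\<close> the site
  \<open>i\<close> is interior, and the potentials in that ball are exactly those summed in
  \<open>g x i\<close>.\<close>

lemma global_minimizer_equilibrium: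
  assumes "global_minimizer r S x" shows "g x i = 0"
proof -
  let ?B = "ball1 i r"
  have int: "i \<in> interior_r ?B r" using r_pos by (auto simp: interior_r_def intro: mem_ball1_self)
  let ?f = "\<lambda>t. W_B S ?B (x(i := t))"
  have "(?f has_real_derivative g x i) (at (x i))"
    unfolding W_B_def gradW_def
    by (intro DERIV_sum) (use pd_has_deriv[OF S_diff, of _ x i "x i"] in simp)
  moreover have "?f (x i) \<le> ?f t" for t
  proof -
    have "W_B S ?B x \<le> W_B S ?B (\<lambda>k. x k + (if k = i then t - x i else 0))"
      by (rule assms[unfolded global_minimizer_def, rule_format, OF finite_ball1]) (use int in auto)
    moreover have "(\<lambda>k. x k + (if k = i then t - x i else 0)) = x(i := t)" by auto
    ultimately show ?thesis by simp
  qed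
  ultimately show ?thesis using DERIV_local_min[of ?f "g x i" "x i" 1] by simp
qed

end

section \<open>Periodic minimisers and their limit\<close>

context rational_rotation
begin

text \<open>Only translations by multiples of \<open>N\<close> are imposed. For large
  \<open>N\<close> this leaves room for any finitely supported perturbation to be repeated
  periodically, which \<open>E\<close> would not allow.\<close>

definition EN :: "int \<Rightarrow> 'd config set" where
  "EN N = {y. \<forall>e p. ip (scale N e) = of_int p \<longrightarrow> tau (scale N e) (- p) y = y}"

definition WN :: "int \<Rightarrow> int \<Rightarrow> 'd config \<Rightarrow> real" where
  "WN c N y = W_B S (pbox c N) y"

definition minimizers :: "int \<Rightarrow> int \<Rightarrow> 'd config set" where
  "minimizers c N = {y \<in> EN N. \<forall>z\<in>EN N. WN c N y \<le> WN c N z}"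

lemma E_subset_EN: "E \<subseteq> EN N"
  by (auto simp: E_def EN_def height_def)

lemma EN_shift: "y \<in> EN N \<Longrightarrow> ip (scale N e) = of_int p \<Longrightarrow> y (site_add i (scale N e)) = y i + of_int p"
proof -
  assume "y \<in> EN N" "ip (scale N e) = of_int p"
  then have "tau (scale N e) (- p) y i = y i" by (simp add: EN_def)
  then show ?thesis by (simp add: tau_apply)
qed

lemma EN_I:
  assumes "\<And>e p i. ip (scale N e) = of_int p \<Longrightarrow> y (site_add i (scale N e)) = y i + of_int p"
  shows "y \<in> EN N"
  using assms by (auto simp: EN_def tau_def)

lemma EN_tau: assumes "y \<in> EN N" shows "tau k l y \<in> EN N"
proof (rule EN_I)
  fix e p i assume "ip (scale N e) = of_int p"
  then have "y (site_add (site_add i k) (scale N e)) = y (site_add i k) + of_int p" by (rule EN_shift[OF assms])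
  moreover have "site_add (site_add i k) (scale N e) = site_add (site_add i (scale N e)) k"
    by (simp add: site_add_def add_ac)
  ultimately show "tau k l y (site_add i (scale N e)) = tau k l y i + of_int p"
    by (simp add: tau_apply)
qed

lemma EN_inf: "y \<in> EN N \<Longrightarrow> z \<in> EN N \<Longrightarrow> inf y z \<in> EN N"
  by (rule EN_I) (simp add: EN_shift inf_min min_add_distrib_left)

lemma EN_sup: "y \<in> EN N \<Longrightarrow> z \<in> EN N \<Longrightarrow> sup y z \<in> EN N"
  by (rule EN_I) (simp add: EN_shift sup_max max_add_distrib_left)

lemma EN_add_periodic:
  assumes "y \<in> EN N" "periodic N Y" shows "(\<lambda>i. y i + Y i) \<in> EN N"
  by (rule EN_I) (use assms in \<open>simp add: EN_shift periodic_def\<close>)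

lemma scale_int: "q dvd N \<Longrightarrow> \<exists>p::int. ip (scale N e) = of_int p"
  using q_int by (auto simp: dvd_def scale_mult)

lemma S_periodic:
  assumes "q dvd N" "y \<in> EN N" shows "periodic N (\<lambda>j. S j y)"
  unfolding periodic_def
proof (intro allI)
  fix i e
  obtain p where "ip (scale N e) = of_int p" using scale_int[OF assms(1)] by blast
  then have "tau (scale N e) (- p) y = y" using assms(2) by (simp add: EN_def)
  then show "S (site_add i (scale N e)) y = S i y" using S_tau[of i "scale N e" "- p" y] by simp
qed

lemma WN_tau:
  assumes "0 < N" "q dvd N" "y \<in> EN N" shows "WN c N (tau k l y) = WN c N y"
  unfolding WN_def W_B_def S_tau by (rule sum_pbox_shift[OF assms(1) S_periodic[OF assms(2,3)]])

lemma minimizers_tau: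
  assumes "0 < N" "q dvd N" "y \<in> minimizers c N" shows "tau k l y \<in> minimizers c N"
  using assms by (simp add: minimizers_def EN_tau WN_tau)

lemma minimizers_inf:
  assumes "y \<in> minimizers c N" "z \<in> minimizers c N" shows "inf y z \<in> minimizers c N"
proof -
  have y: "y \<in> EN N" "\<And>z. z \<in> EN N \<Longrightarrow> WN c N y \<le> WN c N z"
    and z: "z \<in> EN N" "\<And>y. y \<in> EN N \<Longrightarrow> WN c N z \<le> WN c N y"
    using assms by (auto simp: minimizers_def)
  have "WN c N (inf y z) + WN c N (sup y z) \<le> WN c N y + WN c N z"
    unfolding WN_def W_B_def sum.distrib[symmetric] by (intro sum_mono S_submodular)
  moreover have "WN c N z \<le> WN c N (sup y z)" using z(2)[OF EN_sup[OF y(1) z(1)]] .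
  ultimately have "WN c N (inf y z) \<le> WN c N y" by linarith
  then show ?thesis using y EN_inf[OF y(1) z(1)] by (auto simp: minimizers_def intro: order_trans)
qed

lemma minimizers_finite_inf:
  assumes "finite A" "A \<noteq> {}" "\<And>a. a \<in> A \<Longrightarrow> f a \<in> minimizers c N"
  obtains z where "z \<in> minimizers c N" "\<And>a. a \<in> A \<Longrightarrow> z \<le> f a" "\<And>i. \<exists>a\<in>A. z i = f a i"
proof -
  have "\<exists>z\<in>minimizers c N. (\<forall>a\<in>A. z \<le> f a) \<and> (\<forall>i. \<exists>a\<in>A. z i = f a i)"
    using assms
  proof (induction rule: finite_ne_induct)
    case (singleton a)
    then show ?case by (intro bexI[of _ "f a"]) auto
  next
    case (insert a A)
    then obtain z where z: "z \<in> minimizers c N" "\<forall>a\<in>A. z \<le> f a" "\<forall>i. \<exists>a\<in>A. z i = f a i" by auto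
    show ?case
    proof (intro bexI[of _ "inf (f a) z"] conjI ballI allI)
      show "inf (f a) z \<in> minimizers c N" using insert z by (intro minimizers_inf) auto
      show "inf (f a) z \<le> f a'" if "a' \<in> insert a A" for a'
        using that z(2) by (auto intro: le_infI1 le_infI2)
      show "\<exists>a'\<in>insert a A. inf (f a) z i = f a' i" for i
        using z(3) by (auto simp: inf_min min_def)
    qed
  qed
  then show ?thesis using that by blast
qed

lemma closed_EN: "closed (EN N)"
proof -
  have "EN N = (\<Inter>e. \<Inter>p. \<Inter>i. {y. ip (scale N e) = of_int p \<longrightarrow> y (site_add i (scale N e)) = y i + of_int p})"
  proof (intro equalityI subsetI)
    fix y assume "y \<in> EN N"
    then show "y \<in> (\<Inter>e. \<Inter>p. \<Inter>i. {y. ip (scale N e) = of_int p \<longrightarrow> y (site_add i (scale N e)) = y i + of_int p})"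
      by (simp add: EN_shift)
  qed (rule EN_I, simp)
  moreover have "closed {y :: 'd config. P \<longrightarrow> y a = y b + c}" for P a b c
    by (cases P) (auto intro!: closed_Collect_eq continuous_intros continuous_on_coord)
  ultimately show ?thesis by (auto intro!: closed_INT)
qed

text \<open>Coercivity controls only differences between neighbours. These bound every site relative
  to the origin, and a vertical integer translation, which leaves the action unchanged, normalises
  the value there; the sublevel set then reduces to a compact one.\<close>

lemma minimizers_nonempty:
  assumes N: "0 < N" "q dvd N" shows "minimizers c N \<noteq> {}"
proof -
  let ?B = "pbox c N :: 'd site set"
  obtain b where b: "\<And>j x. b \<le> S j x" using S_uniform_lower_bound by blast
  \<comment> \<open>The linear configuration is the competitor. Below its action every single
    potential is at most \<open>M\<close>, since each of the others in the box is at least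
    \<open>- \<bar>b\<bar>\<close>.\<close>
  define m0 where "m0 = WN c N ip"
  define M where "M = m0 + card ?B * \<bar>b\<bar>"
  obtain R where R: "\<And>j k x. norm1 (site_diff k j) = 1 \<Longrightarrow> S j x \<le> M \<Longrightarrow> \<bar>x k - x j\<bar> \<le> R"
    using S_uniform_coercive[of M] by blast
  have SM: "S j y \<le> M" if y: "y \<in> EN N" "WN c N y \<le> m0" for y j
  proof -
    have "S (rep c N j) y + (\<Sum>i\<in>?B - {rep c N j}. S i y) \<le> m0"
      using y(2) sum.remove[OF finite_pbox rep_in_pbox[OF N(1)], of "\<lambda>i. S i y" c j]
      by (simp add: WN_def W_B_def)
    moreover have "- (card ?B * \<bar>b\<bar>) \<le> (\<Sum>i\<in>?B - {rep c N j}. S i y)"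
    proof -
      have "- (card ?B * \<bar>b\<bar>) \<le> - (card (?B - {rep c N j}) * \<bar>b\<bar>)"
        by (auto intro!: mult_right_mono card_mono finite_pbox)
      also have "\<dots> = (\<Sum>i\<in>?B - {rep c N j}. - \<bar>b\<bar>)" by simp
      also have "\<dots> \<le> (\<Sum>i\<in>?B - {rep c N j}. S i y)"
        by (intro sum_mono order_trans[OF _ b]) simp
      finally show ?thesis .
    qed
    ultimately have "S (rep c N j) y \<le> M" by (simp add: M_def)
    then show ?thesis using periodic_rep[OF S_periodic[OF N(2) y(1)], of c j] by simp
  qed
  define Y where "Y = {y :: 'd config. \<forall>j k. norm1 (site_diff k j) = 1 \<longrightarrow> \<bar>y k - y j\<bar> \<le> R}"
  have "\<exists>C. \<forall>y\<in>Y. \<bar>y i - y origin\<bar> \<le> C" for i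
  proof (rule lattice_connected[where P = "\<lambda>i. \<exists>C. \<forall>y\<in>Y. \<bar>y i - y origin\<bar> \<le> C" and ?k0.0 = origin])
    show "\<exists>C. \<forall>y\<in>Y. \<bar>y origin - y origin\<bar> \<le> C" by (intro exI[of _ 0]) simp
    fix i k assume "\<exists>C. \<forall>y\<in>Y. \<bar>y k - y origin\<bar> \<le> C" and nb: "norm1 (site_diff i k) = 1"
    then obtain C where C: "\<And>y. y \<in> Y \<Longrightarrow> \<bar>y k - y origin\<bar> \<le> C" by blast
    have "\<bar>y i - y origin\<bar> \<le> C + R" if "y \<in> Y" for y
    proof -
      have "\<bar>y i - y k\<bar> \<le> R" using that nb by (simp add: Y_def)
      then show ?thesis using C[OF that] by linarith
    qed
    then show "\<exists>C. \<forall>y\<in>Y. \<bar>y i - y origin\<bar> \<le> C" by blast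
  qed
  then obtain C where C: "\<And>i y. y \<in> Y \<Longrightarrow> \<bar>y i - y origin\<bar> \<le> C i" by metis
  define Z where "Z = {x. \<forall>i. - C i \<le> x i \<and> x i \<le> C i + 1} \<inter> EN N"
  have inZ: "\<exists>z\<in>Z. WN c N z = WN c N y" if y: "y \<in> EN N" "WN c N y \<le> m0" for y
  proof -
    define z where "z = tau origin (- \<lfloor>y origin\<rfloor>) y"
    have z: "z \<in> EN N" "WN c N z = WN c N y" using y N by (simp_all add: z_def EN_tau WN_tau)
    have "z \<in> Y" unfolding Y_def using R[OF _ SM[OF z(1)]] z(2) y(2) by simp
    moreover have "0 \<le> z origin" "z origin \<le> 1"
      unfolding z_def by (simp_all add: tau_apply site_simps) linarith+
    ultimately have "- C i \<le> z i \<and> z i \<le> C i + 1" for i using C[of z i] by linarith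
    then show ?thesis using z by (auto simp: Z_def)
  qed
  have ipE: "ip \<in> EN N" using E_subset_EN ip_in_E by blast
  obtain z0 where z0: "z0 \<in> Z" "WN c N z0 = m0" using inZ[OF ipE] by (auto simp: m0_def)
  have "compact Z" unfolding Z_def by (intro compact_Int_closed compact_order_interval closed_EN)
  then obtain y where y: "y \<in> Z" "\<And>z. z \<in> Z \<Longrightarrow> WN c N y \<le> WN c N z"
    using continuous_attains_inf[of Z "WN c N"] z0(1) continuous_on_subset[OF W_B_cont]
    unfolding WN_def by blast
  have "WN c N y \<le> WN c N x" if "x \<in> EN N" for x
  proof (cases "WN c N x \<le> m0")
    case True then show ?thesis using inZ[OF that] y(2) by metis
  next
    case False then show ?thesis using y(2)[OF z0(1)] z0(2) by linarith
  qed
  then show ?thesis using y(1) by (auto simp: Z_def minimizers_def)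
qed

text \<open>At height zero the inverse translation also has height zero, so both inequalities
  hold.\<close>

lemma Bw_subset_E: "Bw \<subseteq> E"
proof
  fix x assume x: "x \<in> Bw"
  have "tau k l x = x" if h: "height k l = 0" for k l
  proof (rule antisym)
    show "x \<le> tau k l x" using x h by (simp add: Bw_def)
    have "x \<le> tau (\<lambda>m. - k m) (- l) x" using x h by (simp add: Bw_def height_neg)
    from tau_mono[OF this, of k l] show "tau k l x \<le> x" by (simp add: tau_inverse)
  qed
  then show "x \<in> E" by (simp add: E_def)
qed

lemma Bw_le: "x \<in> Bw \<Longrightarrow> 0 \<le> height k l \<Longrightarrow> x \<le> tau k l x"
  by (simp add: Bw_def)

lemma Bw_ge: assumes "x \<in> Bw" "height k l \<le> 0" shows "tau k l x \<le> x"
proof -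
  have "x \<le> tau (\<lambda>m. - k m) (- l) x" using assms by (simp add: Bw_def height_neg)
  from tau_mono[OF this, of k l] show ?thesis by (simp add: tau_inverse)
qed

text \<open>The infimum of all translates by pairs of nonnegative height is attained over
  representatives of the period box, since for each site only the least admissible height matters.\<close>
lemma Bw_minimizer:
  assumes N: "0 < N" "q dvd N" obtains x where "x \<in> minimizers c N" "x \<in> Bw"
proof -
  obtain y where y: "y \<in> minimizers c N" using minimizers_nonempty[OF assms] by blast
  then have yE: "y \<in> EN N" by (simp add: minimizers_def)
  define l where "l = (\<lambda>k. \<lceil>- ip k\<rceil>)"
  let ?B = "pbox c N :: 'd site set"
  obtain x where x: "x \<in> minimizers c N" "\<And>k. k \<in> ?B \<Longrightarrow> x \<le> tau k (l k) y"
     "\<And>i. \<exists>k\<in>?B. x i = tau k (l k) y i"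
    using minimizers_finite_inf[of ?B "\<lambda>k. tau k (l k) y" c N] finite_pbox minimizers_tau[OF N y]
      rep_in_pbox[OF N(1)] by (metis empty_iff)
  have le: "x i \<le> tau k m y i" if h: "0 \<le> height k m" for k m i
  proof -
    define k' where "k' = rep c N k"
    define e where "e = (\<lambda>m. (k m - c) div N)"
    have k: "k = site_add k' (scale N e)" unfolding k'_def e_def by (rule rep_decomp)
    obtain p where p: "ip (scale N e) = of_int p" using scale_int[OF N(2)] by blast
    have "site_add i k = site_add (site_add i k') (scale N e)" by (subst k) (simp add: site_add_def add_ac)
    then have "tau k m y i = y (site_add i k') + of_int p + of_int m"
      by (simp add: tau_apply EN_shift[OF yE p])
    moreover have "ip k = ip k' + of_int p" by (subst k) (simp add: ip_add p)
    then have "- ip k' \<le> of_int (p + m)" using h by (simp add: height_def)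
    then have "l k' \<le> p + m" unfolding l_def by (simp add: ceiling_le_iff)
    moreover have "x i \<le> tau k' (l k') y i"
      using x(2)[of k'] rep_in_pbox[OF N(1), of c k] by (simp add: k'_def le_fun_def)
    ultimately show ?thesis by (simp add: tau_apply)
  qed
  have "x \<in> Bw"
    unfolding Bw_def
  proof (intro CollectI allI impI le_funI)
    fix k m i assume h: "0 \<le> height k m"
    \<comment> \<open>At the shifted site the infimum is attained by a translate of
      \<open>y\<close>; composing it with \<open>(k, m)\<close> keeps the height nonnegative, so
      \<open>le\<close> applies.\<close>
    obtain k' where k': "x (site_add i k) = tau k' (l k') y (site_add i k)" using x(3) by blast
    have "0 \<le> height k' (l k')" by (simp add: height_def l_def) linarith
    then have "0 \<le> height (site_add k k') (m + l k')" using h by (simp add: height_add)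
    then have "x i \<le> tau (site_add k k') (m + l k') y i" by (rule le)
    also have "\<dots> = tau k m x i" by (simp add: tau_apply k' site_add_assoc)
    finally show "x i \<le> tau k m x i" .
  qed
  then show ?thesis using x(1) that by blast
qed

text \<open>A perturbation supported in the interior of a set that fits into the period box does not
  see its own periodic copies.\<close>
lemma minimizer_on_subbox:
  assumes N: "0 < N" "q dvd N" and x: "x \<in> minimizers c N" and B: "B \<subseteq> pbox c N"
    and y: "\<And>i. i \<notin> interior_r B r \<Longrightarrow> y i = 0"
  shows "W_B S B x \<le> W_B S B (\<lambda>i. x i + y i)"
proof -
  define Y where "Y = (\<lambda>i. y (rep c N i))"
  have "periodic N Y" by (simp add: periodic_def Y_def rep_add_scale)
  then have "(\<lambda>i. x i + Y i) \<in> EN N" using x by (intro EN_add_periodic) (simp_all add: minimizers_def)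
  then have le: "WN c N x \<le> WN c N (\<lambda>i. x i + Y i)" using x by (simp add: minimizers_def)
  \<comment> \<open>If \<open>j\<close> sees a copy of the perturbation at \<open>k\<close>, then
    moving \<open>j\<close> by the same period places it within range of the original site, hence in
    \<open>B\<close>. Two points of the box that differ by a period coincide, so the copy is the
    original.\<close>
  have key: "rep c N k = k \<and> j \<in> B" if j: "j \<in> pbox c N" and k: "k \<in> ball1 j r" and nz: "y (rep c N k) \<noteq> 0" for j k
  proof -
    define k' where "k' = rep c N k"
    define e where "e = (\<lambda>m. (k m - c) div N)"
    have kk: "k = site_add k' (scale N e)" unfolding k'_def e_def by (rule rep_decomp)
    have k': "k' \<in> interior_r B r" using y nz by (auto simp: k'_def)
    define j' where "j' = site_diff j (scale N e)"
    have j'j: "j = site_add j' (scale N e)" by (simp add: j'_def site_simps)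
    have "j \<in> ball1 k r" using k by (simp add: mem_ball1_sym)
    then have "j' \<in> ball1 k' r" unfolding kk by (subst (asm) j'j) (simp add: mem_ball1_shift)
    then have j'B: "j' \<in> B" using k' by (auto simp: interior_r_def)
    then have "j' = rep c N j'" using B by (auto simp: rep_pbox)
    also have "\<dots> = rep c N j" unfolding j'j by (simp add: rep_add_scale)
    also have "\<dots> = j" using j by (rule rep_pbox)
    finally have "j' = j" .
    then have "scale N e = origin" using j'j by (auto simp: site_add_def fun_eq_iff)
    then have "k' = k" using kk by (simp add: site_simps)
    then show ?thesis using j'B \<open>j' = j\<close> by (simp add: k'_def)
  qed
  have on: "S j (\<lambda>i. x i + Y i) = S j (\<lambda>i. x i + y i)" if j: "j \<in> pbox c N" for j
  proof (rule depends_only_onD[OF S_dep])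
    fix k assume k: "k \<in> ball1 j r"
    show "x k + Y k = x k + y k"
    proof (cases "y (rep c N k) = 0")
      case False then show ?thesis using key[OF j k False] by (simp add: Y_def)
    next
      case True
      have "y k = 0"
      proof (rule ccontr)
        assume "y k \<noteq> 0"
        then have "k \<in> pbox c N" using y B by (auto simp: interior_r_def)
        then show False using True \<open>y k \<noteq> 0\<close> by (simp add: rep_pbox)
      qed
      then show ?thesis using True by (simp add: Y_def)
    qed
  qed
  have off: "S j (\<lambda>i. x i + Y i) = S j x" if j: "j \<in> pbox c N - B" for j
  proof (rule depends_only_onD[OF S_dep])
    fix k assume "k \<in> ball1 j r"
    then have "y (rep c N k) = 0" using key[of j k] j by blast
    then show "x k + Y k = x k" by (simp add: Y_def)
  qed
  have split: "WN c N z = W_B S B z + (\<Sum>j\<in>pbox c N - B. S j z)" for z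
    unfolding WN_def W_B_def by (subst sum.subset_diff[OF B finite_pbox]) simp
  have "W_B S B (\<lambda>i. x i + Y i) = W_B S B (\<lambda>i. x i + y i)"
    unfolding W_B_def by (intro sum.cong refl on) (use B in auto)
  moreover have "(\<Sum>j\<in>pbox c N - B. S j (\<lambda>i. x i + Y i)) = (\<Sum>j\<in>pbox c N - B. S j x)"
    by (intro sum.cong refl off)
  ultimately show ?thesis using le by (simp add: split)
qed

text \<open>Rounding \<open>- ip i\<close> up or down gives translations of height in
  \<open>[0, 1)\<close> or \<open>(-1, 0]\<close>, which are compared at the origin.\<close>

lemma Bw_bounds:
  assumes "x \<in> Bw" shows "ip i - 1 \<le> x i - x origin" "x i - x origin \<le> ip i + 1"
proof -
  have "0 \<le> height i \<lceil>- ip i\<rceil>" by (simp add: height_def) linarith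
  from le_funD[OF Bw_le[OF assms this], of origin]
  show "ip i - 1 \<le> x i - x origin" by (simp add: tau_apply site_simps) linarith
  have "height i \<lfloor>- ip i\<rfloor> \<le> 0" by (simp add: height_def) linarith
  from le_funD[OF Bw_ge[OF assms this], of origin]
  show "x i - x origin \<le> ip i + 1" by (simp add: tau_apply site_simps) linarith
qed

lemma closed_Bw: "closed Bw"
proof -
  have "Bw = (\<Inter>k. \<Inter>l. \<Inter>i. {x. 0 \<le> height k l \<longrightarrow> x i \<le> x (site_add i k) + of_int l})"
    by (auto simp: Bw_def le_fun_def tau_apply)
  moreover have "closed {x :: 'd config. P \<longrightarrow> x a \<le> x b + c}" for P a b c
    by (cases P) (auto intro!: closed_Collect_le continuous_intros continuous_on_coord)
  ultimately show ?thesis by (auto intro!: closed_INT)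
qed

lemma Bw_tau: assumes "x \<in> Bw" shows "tau k l x \<in> Bw"
  unfolding Bw_def
proof (intro CollectI allI impI)
  fix k' l' assume "0 \<le> height k' l'"
  from tau_mono[OF Bw_le[OF assms this], of k l]
  show "tau k l x \<le> tau k' l' (tau k l x)" by (simp add: tau_tau add.commute site_add_commute)
qed

lemma Bw_global_minimizer: obtains x where "x \<in> Bw" "global_minimizer r S x"
proof -
  \<comment> \<open>Boxes centred at the origin exhaust the lattice; the side is a positive multiple
    of \<open>q\<close>, so the associated vertical shifts are integers.\<close>
  define c N :: "nat \<Rightarrow> int" where "c = (\<lambda>n. - (int (Suc n) * q))" and "N = (\<lambda>n. 2 * (int (Suc n) * q))"
  have N: "0 < N n" "q dvd N n" for n using q_pos by (auto simp: N_def)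
  have "\<exists>x. x \<in> minimizers (c n) (N n) \<and> x \<in> Bw \<and> 0 \<le> x origin \<and> x origin \<le> 1" for n
  proof -
    obtain y where y: "y \<in> minimizers (c n) (N n)" "y \<in> Bw" using Bw_minimizer[OF N] .
    define x where "x = tau origin (- \<lfloor>y origin\<rfloor>) y"
    have "x \<in> minimizers (c n) (N n)" "x \<in> Bw"
      unfolding x_def using minimizers_tau[OF N y(1)] Bw_tau[OF y(2)] by blast+
    moreover have "0 \<le> x origin" "x origin \<le> 1"
      unfolding x_def by (simp_all add: tau_apply site_simps) linarith+
    ultimately show ?thesis by blast
  qed
  then obtain f where f: "\<And>n. f n \<in> minimizers (c n) (N n)" "\<And>n. f n \<in> Bw" "\<And>n. 0 \<le> f n origin" "\<And>n. f n origin \<le> 1"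
    by metis
  have b: "ip i - 1 \<le> f n i" "f n i \<le> ip i + 2" for n i
    using Bw_bounds[OF f(2)[of n], of i] f(3,4)[of n] by linarith+
  obtain x h where h: "strict_mono h" "(f \<circ> h) \<longlonglongrightarrow> x"
    by (rule config_convergent_subseq[OF b])
  have "x \<in> Bw" by (rule closed_sequentially[OF closed_Bw _ h(2)]) (simp add: f(2))
  moreover have "global_minimizer r S x"
    unfolding global_minimizer_def
  proof (intro allI impI)
    fix B and y :: "'d config" assume B: "finite B" and y: "\<forall>i. i \<notin> interior_r B r \<longrightarrow> y i = 0"
    obtain n0 where n0: "\<And>j m. j \<in> B \<Longrightarrow> \<bar>j m\<bar> \<le> int n0"
    proof -
      have "\<bar>j m\<bar> \<le> int (\<Sum>j\<in>B. \<Sum>m\<in>UNIV. nat \<bar>j m\<bar>)" if "j \<in> B" for j m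
      proof -
        have "nat \<bar>j m\<bar> \<le> (\<Sum>m\<in>UNIV. nat \<bar>j m\<bar>)" by (rule member_le_sum) auto
        also have "\<dots> \<le> (\<Sum>j\<in>B. \<Sum>m\<in>UNIV. nat \<bar>j m\<bar>)" by (rule member_le_sum) (use that B in auto)
        finally show ?thesis by linarith
      qed
      then show ?thesis using that by blast
    qed
    have sub: "B \<subseteq> pbox (c n) (N n)" if "n0 \<le> n" for n
    proof
      fix j assume j: "j \<in> B"
      have "int n0 < int (Suc n) * q"
      proof -
        have "int n0 < int (Suc n) * 1" using that by simp
        also have "\<dots> \<le> int (Suc n) * q" using q_pos by (intro mult_left_mono) auto
        finally show ?thesis .
      qed
      then have "- (int (Suc n) * q) \<le> j m \<and> j m < - (int (Suc n) * q) + 2 * (int (Suc n) * q)" for m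
        using n0[OF j, of m] by linarith
      then show "j \<in> pbox (c n) (N n)" by (simp only: pbox_def c_def N_def mem_Collect_eq simp_thms)
    qed
    have lim: "(\<lambda>n. f (h n)) \<longlonglongrightarrow> x" using h(2) by (simp add: o_def)
    have "((\<lambda>n. W_B S B (\<lambda>i. f (h n) i + y i)) \<longlonglongrightarrow> W_B S B (\<lambda>i. x i + y i))"
    proof (rule isCont_tendsto_compose[of _ "W_B S B"])
      show "isCont (W_B S B) (\<lambda>i. x i + y i)" using W_B_cont by (simp add: continuous_on_eq_continuous_at)
      show "(\<lambda>n i. f (h n) i + y i) \<longlonglongrightarrow> (\<lambda>i. x i + y i)"
        using lim unfolding tendsto_config_iff by (auto intro!: tendsto_intros)
    qed
    moreover have "((\<lambda>n. W_B S B (f (h n))) \<longlonglongrightarrow> W_B S B x)"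
      by (rule isCont_tendsto_compose[OF _ lim]) (use W_B_cont in \<open>simp add: continuous_on_eq_continuous_at\<close>)
    moreover have "\<forall>\<^sub>F n in sequentially. W_B S B (f (h n)) \<le> W_B S B (\<lambda>i. f (h n) i + y i)"
      using eventually_ge_at_top[of n0]
    proof eventually_elim
      case (elim n)
      then have "n0 \<le> h n" using seq_suble[OF h(1)] le_trans by blast
      then show ?case using y by (intro minimizer_on_subbox[OF N f(1) sub]) auto
    qed
    ultimately show "W_B S B x \<le> W_B S B (\<lambda>i. x i + y i)" by (rule tendsto_le[rotated 1, OF _ _ _]) simp
  qed
  ultimately show ?thesis using that by blast
qed

end

section \<open>Equilibria and barriers\<close>

context rational_rotation
begin

definition equilibrium :: "'d config \<Rightarrow> bool" where
  "equilibrium x \<longleftrightarrow> x \<in> E \<and> (\<forall>i. g x i = 0)"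

text \<open>An equilibrium is a sub- and a supersolution at once; negative times follow by inverting
  the flow.\<close>

lemma Psi_equilibrium: assumes "equilibrium x" shows "\<Psi> t x = x"
proof -
  have x: "x \<in> E" "\<And>i. g x i = 0" using assms by (auto simp: equilibrium_def)
  have pos: "\<Psi> t x = x" if "0 \<le> t" for t
    using Psi_ge_subsolution[OF x(1) _ that] Psi_le_supersolution[OF x(1) _ that] x(2)
    by (intro antisym) auto
  show ?thesis
  proof (cases "0 \<le> t")
    case False
    then have "\<Psi> t (\<Psi> (- t) x) = \<Psi> t x" using pos[of "- t"] by simp
    then show ?thesis using Psi_inverse(2)[OF x(1), of t] by simp
  qed (rule pos)
qed

lemma equilibriumI:
  assumes "x \<in> E" "\<And>t. 0 \<le> t \<Longrightarrow> \<Psi> t x = x" shows "equilibrium x"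
proof -
  have fix_all: "\<Psi> t x = x" for t
  proof (cases "0 \<le> t")
    case False
    then have "\<Psi> t (\<Psi> (- t) x) = \<Psi> t x" using assms(2)[of "- t"] by simp
    then show ?thesis using Psi_inverse(2)[OF assms(1), of t] by simp
  qed (rule assms(2))
  have "g x i = 0" for i
  proof -
    have "((\<lambda>t. x i) has_real_derivative - g x i) (at 0)"
      using Psi_deriv_E[OF assms(1), of i 0] by (simp add: fix_all)
    then show ?thesis using DERIV_unique[OF _ DERIV_const, of "x i" "- g x i" 0] by simp
  qed
  then show ?thesis using assms(1) by (simp add: equilibrium_def)
qed

text \<open>A real coordinate on ordered subsets of \<open>E\<close>: strictly monotone, and its
  increment dominates the uniform distance of two ordered configurations.\<close>

definition \<phi> :: "'d config \<Rightarrow> real" where "\<phi> x = (\<Sum>i\<in>Q. x i)"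

lemma phi_mono: "x \<le> y \<Longrightarrow> \<phi> x \<le> \<phi> y"
  unfolding \<phi>_def by (intro sum_mono) (simp add: le_fun_def)

lemma E_eqI:
  assumes "x \<in> E" "y \<in> E" "\<And>i. i \<in> Q \<Longrightarrow> x i = y i" shows "x = y"
proof
  fix i
  have "x (rep 0 q i) - y (rep 0 q i) = x i - y i"
    by (rule periodic_rep[OF E_diff_periodic[OF assms(1,2)]])
  then show "x i = y i" using assms(3)[OF rep_in_pbox[OF q_pos], of i] by simp
qed

lemma phi_inj: assumes "x \<in> E" "y \<in> E" "x \<le> y" "\<phi> x = \<phi> y" shows "x = y"
proof (rule E_eqI[OF assms(1,2)])
  have "(\<Sum>i\<in>Q. y i - x i) = 0" using assms(4) by (simp add: \<phi>_def sum_subtractf)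
  then have "\<forall>i\<in>Q. y i - x i = 0"
    by (subst (asm) sum_nonneg_eq_0_iff[OF finite_pbox]) (use assms(3) in \<open>auto simp: le_fun_def\<close>)
  then show "x i = y i" if "i \<in> Q" for i using that by simp
qed

lemma phi_strict_mono: "x \<in> E \<Longrightarrow> y \<in> E \<Longrightarrow> x \<le> y \<Longrightarrow> x \<noteq> y \<Longrightarrow> \<phi> x < \<phi> y"
  using phi_mono[of x y] phi_inj[of x y] by fastforce

lemma phi_bounds_diff:
  assumes "x \<in> E" "y \<in> E" "x \<le> y" shows "\<bar>y i - x i\<bar> \<le> \<phi> y - \<phi> x"
proof -
  have "\<bar>y (rep 0 q i) - x (rep 0 q i)\<bar> \<le> (\<Sum>i\<in>Q. \<bar>y i - x i\<bar>)"
    by (rule member_le_sum[OF rep_in_pbox[OF q_pos] _ finite_pbox]) simp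
  also have "\<dots> = \<phi> y - \<phi> x"
    using assms(3) by (simp add: \<phi>_def sum_subtractf[symmetric] le_fun_def)
  finally show ?thesis using periodic_rep[OF E_diff_periodic[OF assms(2,1)], of 0 i] by simp
qed

lemma phi_tendsto: "(f \<longlongrightarrow> x) G \<Longrightarrow> ((\<lambda>s. \<phi> (f s)) \<longlongrightarrow> \<phi> x) G"
  unfolding \<phi>_def tendsto_config_iff by (intro tendsto_sum) auto

lemma phi_cont: "continuous_on A \<phi>"
  unfolding \<phi>_def by (intro continuous_on_sum continuous_on_coord)

lemma phi_Psi_cont: "x \<in> E \<Longrightarrow> continuous_on A (\<lambda>t. \<phi> (\<Psi> t x))"
  unfolding \<phi>_def
  by (intro continuous_on_sum, rule DERIV_continuous_on, rule has_field_derivative_at_within[OF Psi_deriv_E])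

lemma closed_E: "closed E"
proof -
  have "E = (\<Inter>k. \<Inter>l. \<Inter>i. {y. height k l = 0 \<longrightarrow> y (site_add i k) + of_int l = y i})"
    by (auto simp: E_def tau_def fun_eq_iff)
  moreover have "closed {y :: 'd config. P \<longrightarrow> y a + c = y b}" for P a b c
    by (cases P) (auto intro!: closed_Collect_eq continuous_intros continuous_on_coord)
  ultimately show ?thesis by (auto intro!: closed_INT)
qed

lemma E_limit: "(f \<longlonglongrightarrow> x) \<Longrightarrow> (\<And>n. f n \<in> E) \<Longrightarrow> x \<in> E"
  by (rule closed_sequentially[OF closed_E])

text \<open>The factor \<open>c\<close> is meant to be \<open>1\<close> or \<open>-1\<close>, so
  that increasing and decreasing orbits share one argument.\<close>

lemma limit_le:
  fixes f h :: "nat \<Rightarrow> 'd config"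
  assumes "f \<longlonglongrightarrow> x" "h \<longlonglongrightarrow> y" "\<forall>\<^sub>F n in sequentially. c * f n i \<le> c * h n i"
  shows "c * x i \<le> c * y i"
proof (rule tendsto_le[of sequentially])
  show "(\<lambda>n. c * h n i) \<longlonglongrightarrow> c * y i" "(\<lambda>n. c * f n i) \<longlonglongrightarrow> c * x i"
    using assms(1,2) unfolding tendsto_config_iff by (auto intro!: tendsto_intros)
qed (use assms(3) in auto)

section \<open>The action of one period as a Lyapunov function\<close>

lemma pdS_periodic:
  assumes "x \<in> E"
  shows "pd (S (site_add j (scale q e))) (site_add i (scale q e)) x = pd (S j) i x"
proof -
  obtain p where "ip (scale q e) = of_int p" using q_int by blast
  then have "tau (scale q e) (- p) x = x" using assms by (simp add: E_def height_def)
  then show ?thesis using pdS_tau[of j i "scale q e" "- p" x] by simp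
qed

text \<open>The action contains only potentials centred in \<open>Q\<close>, whereas
  \<open>g\<close> collects all potentials that see a given site. For each fixed offset
  \<open>a\<close> the summand is periodic, so shifting the sum over the period exchanges the two
  points of view.\<close>

lemma action_derivative:
  assumes "\<gamma> t \<in> E" and d: "\<And>i. ((\<lambda>s. \<gamma> s i) has_real_derivative v i) (at t)" and v: "periodic q v"
  shows "((\<lambda>s. W_B S Q (\<gamma> s)) has_real_derivative (\<Sum>i\<in>Q. g (\<gamma> t) i * v i)) (at t)"
proof -
  let ?x = "\<gamma> t"
  let ?B = "ball1 origin r :: 'd site set"
  have "((\<lambda>s. W_B S Q (\<gamma> s)) has_real_derivative (\<Sum>j\<in>Q. \<Sum>k\<in>ball1 j r. pd (S j) k ?x * v k)) (at t)"
    unfolding W_B_def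
    by (intro DERIV_sum coord_chain_rule[OF S_diff finite_ball1 S_dep pdS_cont d])
  also have "(\<Sum>j\<in>Q. \<Sum>k\<in>ball1 j r. pd (S j) k ?x * v k) =
      (\<Sum>j\<in>Q. \<Sum>a\<in>?B. pd (S j) (site_add a j) ?x * v (site_add a j))"
  proof (rule sum.cong[OF refl])
    fix j
    show "(\<Sum>k\<in>ball1 j r. pd (S j) k ?x * v k) = (\<Sum>a\<in>?B. pd (S j) (site_add a j) ?x * v (site_add a j))"
      by (subst ball1_eq_image, subst sum.reindex) (auto intro: inj_on_subset[OF inj_site_add])
  qed
  also have "\<dots> = (\<Sum>a\<in>?B. \<Sum>j\<in>Q. pd (S j) (site_add a j) ?x * v (site_add a j))"
    by (rule sum.swap)
  also have "\<dots> = (\<Sum>a\<in>?B. \<Sum>j\<in>Q. pd (S (site_diff j a)) j ?x * v j)"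
  proof (rule sum.cong[OF refl])
    fix a
    define h where "h = (\<lambda>j. pd (S (site_diff j a)) j ?x * v j)"
    have "periodic q h"
      unfolding periodic_def
    proof (intro allI)
      fix i e
      have "site_diff (site_add i (scale q e)) a = site_add (site_diff i a) (scale q e)"
        by (simp add: site_add_def site_diff_def algebra_simps)
      then show "h (site_add i (scale q e)) = h i"
        using v pdS_periodic[OF assms(1), of "site_diff i a" e i] by (simp add: h_def periodic_def)
    qed
    from sum_pbox_shift[OF q_pos this, of a 0]
    show "(\<Sum>j\<in>Q. pd (S j) (site_add a j) ?x * v (site_add a j)) = (\<Sum>j\<in>Q. pd (S (site_diff j a)) j ?x * v j)"
      by (simp add: h_def site_simps site_add_commute)
  qed
  also have "\<dots> = (\<Sum>j\<in>Q. \<Sum>a\<in>?B. pd (S (site_diff j a)) j ?x * v j)"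
    by (rule sum.swap)
  also have "\<dots> = (\<Sum>j\<in>Q. g ?x j * v j)"
  proof (rule sum.cong[OF refl])
    fix j
    have "(\<Sum>a\<in>?B. pd (S (site_diff j a)) j ?x) = (\<Sum>k\<in>ball1 j r. pd (S k) j ?x)"
    proof (rule sum.reindex_bij_witness[where i = "\<lambda>k. site_diff j k" and j = "\<lambda>a. site_diff j a"])
      fix a :: "'d site"
      show "site_diff j (site_diff j a) = a" by (simp add: site_diff_def)
      then show "site_diff j (site_diff j a) = a" .
      have "site_diff (site_diff j a) j = site_diff origin a" "site_diff j a = site_diff (site_diff j a) origin"
        by (auto simp: site_diff_def)
      then show "site_diff j a \<in> ball1 j r" if "a \<in> ball1 origin r"
        using that norm1_diff_commute[of origin a] by (simp add: ball1_def)
      show "site_diff j a \<in> ball1 origin r" if "a \<in> ball1 j r"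
        using that norm1_diff_commute[of j a] by (simp add: ball1_def site_simps)
    qed auto
    then show "(\<Sum>a\<in>?B. pd (S (site_diff j a)) j ?x * v j) = g ?x j * v j"
      by (simp add: gradW_def sum_distrib_right[symmetric])
  qed
  finally show ?thesis .
qed

lemma g_Q_zero: assumes "x \<in> E" "\<And>i. i \<in> Q \<Longrightarrow> g x i = 0" shows "g x i = 0"
proof -
  have "periodic q (g x)" unfolding periodic_def using g_periodic[OF assms(1)] q_int by blast
  from periodic_rep[OF this, of 0 i] show ?thesis using assms(2)[OF rep_in_pbox[OF q_pos], of i] by simp
qed

lemma action_decay:
  assumes "z \<in> E" "0 < e" shows "\<exists>t\<ge>0. (\<Sum>i\<in>Q. (g (\<Psi> t z) i)\<^sup>2) < e"
proof (rule ccontr)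
  assume "\<not> ?thesis"
  then have ge: "e \<le> (\<Sum>i\<in>Q. (g (\<Psi> t z) i)\<^sup>2)" if "0 \<le> t" for t using that by force
  let ?W = "\<lambda>t. W_B S Q (\<Psi> t z)"
  have dW: "(?W has_real_derivative (\<Sum>i\<in>Q. g (\<Psi> t z) i * - g (\<Psi> t z) i)) (at t)" for t
  proof (rule action_derivative[where \<gamma> = "\<lambda>t. \<Psi> t z"])
    show "\<Psi> t z \<in> E" by (rule Psi_E[OF assms(1)])
    show "periodic q (\<lambda>i. - g (\<Psi> t z) i)"
      unfolding periodic_def using g_periodic[OF Psi_E[OF assms(1)]] q_int by metis
  qed (rule Psi_deriv_E[OF assms(1)])
  have dec: "?W t \<le> ?W 0 - e * t" if "0 \<le> t" for t
  proof -
    have "?W t + e * t \<le> ?W 0 + e * 0"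
    proof (rule DERIV_nonpos_imp_nonincreasing[where f = "\<lambda>t. ?W t + e * t", OF that])
      fix s :: real assume s: "0 \<le> s"
      have "((\<lambda>t. ?W t + e * t) has_real_derivative (\<Sum>i\<in>Q. g (\<Psi> s z) i * - g (\<Psi> s z) i) + e) (at s)"
        by (auto intro!: derivative_eq_intros dW)
      moreover have "(\<Sum>i\<in>Q. g (\<Psi> s z) i * - g (\<Psi> s z) i) + e \<le> 0"
        using ge[OF s] by (simp add: power2_eq_square sum_negf)
      ultimately show "\<exists>y. ((\<lambda>t. ?W t + e * t) has_real_derivative y) (at s) \<and> y \<le> 0" by blast
    qed
    then show ?thesis by simp
  qed
  obtain b where b: "\<And>j x. b \<le> S j x" using S_uniform_lower_bound by blast
  define m where "m = (\<Sum>j\<in>Q. b)"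
  have lower: "m \<le> ?W t" for t unfolding m_def W_B_def by (intro sum_mono b)
  \<comment> \<open>A time at which decay at rate \<open>e\<close> would have pushed the action
    below its lower bound \<open>m\<close>.\<close>
  define t where "t = (\<bar>?W 0 - m\<bar> + 1) / e"
  have "0 \<le> t" using assms(2) by (simp add: t_def)
  moreover have "e * t = \<bar>?W 0 - m\<bar> + 1" using assms(2) by (simp add: t_def)
  ultimately show False using dec[of t] lower[of t] by linarith
qed

text \<open>Lagrange multipliers on an order interval: at a minimiser of the action on a level set of
  the sum of coordinates all components of the gradient have the same sign, because mass can
  always be moved from a site where it is positive to one where it is negative.\<close>
lemma barrier_exists:
  assumes a: "equilibrium a" and b: "equilibrium b" and ab: "a \<le> b" and s: "\<phi> a \<le> s" "s \<le> \<phi> b"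
  obtains x where "x \<in> E" "a \<le> x" "x \<le> b" "\<phi> x = s" "(\<forall>i. g x i \<le> 0) \<or> (\<forall>i. 0 \<le> g x i)"
proof -
  have aE: "a \<in> E" and bE: "b \<in> E" using a b by (auto simp: equilibrium_def)
  define Z where "Z = {x. \<forall>i. a i \<le> x i \<and> x i \<le> b i} \<inter> (E \<inter> {x. \<phi> x = s})"
  have "compact Z"
    unfolding Z_def
    by (intro compact_Int_closed compact_order_interval closed_Int closed_E closed_Collect_eq phi_cont continuous_on_const)
  have "Z \<noteq> {}"
  proof (cases "\<phi> a = \<phi> b")
    case True
    then have "a \<in> Z" using s aE ab by (simp add: Z_def le_fun_def)
    then show ?thesis by blast
  next
    case False
    define \<theta> where "\<theta> = (s - \<phi> a) / (\<phi> b - \<phi> a)"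
    have \<theta>: "0 \<le> \<theta>" "\<theta> \<le> 1" using s False by (auto simp: \<theta>_def field_simps)
    let ?x = "\<lambda>i. a i + \<theta> * (b i - a i)"
    have "?x \<in> E" by (rule E_add_diff[OF aE bE aE])
    moreover have "\<phi> ?x = \<phi> a + \<theta> * (\<phi> b - \<phi> a)"
      by (simp add: \<phi>_def sum.distrib sum_distrib_left[symmetric] sum_subtractf)
    then have "\<phi> ?x = s" using False by (simp add: \<theta>_def)
    moreover have "a i \<le> ?x i \<and> ?x i \<le> b i" for i
    proof -
      have "0 \<le> b i - a i" using ab by (simp add: le_fun_def)
      then have "0 \<le> \<theta> * (b i - a i)" "\<theta> * (b i - a i) \<le> 1 * (b i - a i)"
        using \<theta> by (auto intro!: mult_left_le_one_le)
      then show ?thesis by auto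
    qed
    ultimately have "?x \<in> Z" by (simp add: Z_def)
    then show ?thesis by blast
  qed
  then obtain x where x: "x \<in> Z" "\<And>y. y \<in> Z \<Longrightarrow> W_B S Q x \<le> W_B S Q y"
    using continuous_attains_inf[OF \<open>compact Z\<close>, of "W_B S Q"] continuous_on_subset[OF W_B_cont] by blast
  have xE: "x \<in> E" and ax: "a \<le> x" and xb: "x \<le> b" and xs: "\<phi> x = s"
    using x(1) by (auto simp: Z_def le_fun_def)
  have "(\<forall>i. g x i \<le> 0) \<or> (\<forall>i. 0 \<le> g x i)"
  proof (rule ccontr)
    assume "\<not> ?thesis"
    then obtain i0 j0 where ij: "0 < g x j0" "g x i0 < 0" by (auto simp: not_le)
    \<comment> \<open>Admissible variations within \<open>E\<close> are the functions invariant
      under all \<open>k\<close> with integral \<open>ip k\<close>. The indicator of the class of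
      \<open>i0\<close> modulo these \<open>k\<close> is therefore the most localised variation at
      \<open>i0\<close>.\<close>
    define cls where "cls = (\<lambda>i0 i. if (\<exists>k p. i = site_add i0 k \<and> ip k = of_int (p::int)) then 1 else 0 :: real)"
    have cls01: "cls i0 i = 0 \<or> cls i0 i = 1" for i0 i by (simp add: cls_def)
    have cls_shift: "cls i0 (site_add i k) = cls i0 i" if k: "ip k = of_int p" for i0 i k p
    proof -
      have "(\<exists>k' p. site_add i k = site_add i0 k' \<and> ip k' = of_int (p::int)) \<longleftrightarrow>
            (\<exists>k' p. i = site_add i0 k' \<and> ip k' = of_int (p::int))"
      proof
        assume "\<exists>k' p. site_add i k = site_add i0 k' \<and> ip k' = of_int (p::int)"
        then obtain k' p' where 1: "site_add i k = site_add i0 k'" "ip k' = of_int p'" by blast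
        have "i = site_add i0 (site_add k' (\<lambda>m. - k m))"
          using 1(1) by (simp add: site_add_def fun_eq_iff algebra_simps)
        moreover have "ip (site_add k' (\<lambda>m. - k m)) = of_int (p' - p)"
          by (simp add: ip_add ip_neg 1 k)
        ultimately show "\<exists>k' p. i = site_add i0 k' \<and> ip k' = of_int (p::int)" by blast
      next
        assume "\<exists>k' p. i = site_add i0 k' \<and> ip k' = of_int (p::int)"
        then obtain k' p' where 1: "i = site_add i0 k'" "ip k' = of_int p'" by blast
        have "site_add i k = site_add i0 (site_add k' k)" by (simp add: 1 site_add_assoc)
        moreover have "ip (site_add k' k) = of_int (p' + p)" by (simp add: ip_add 1 k)
        ultimately show "\<exists>k' p. site_add i k = site_add i0 k' \<and> ip k' = of_int (p::int)" by blast
      qed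
      then show ?thesis by (simp add: cls_def)
    qed
    have cls_self: "cls i0 i0 = 1" for i0
      unfolding cls_def using ip_origin by (auto intro!: exI[of _ origin] exI[of _ 0] simp: site_simps)
    have cls_inv: "h i = h i0" if "cls i0 i = 1" "\<And>i k p. ip k = of_int (p::int) \<Longrightarrow> h (site_add i k) = h i"
      for h :: "'d config" and i0 i
      using that by (auto simp: cls_def split: if_splits)
    have clsper: "periodic q (cls i0)" for i0
      unfolding periodic_def using cls_shift q_int by blast
    have phi_pos: "0 < \<phi> (cls i0)" for i0
    proof -
      have "cls i0 (rep 0 q i0) \<le> \<phi> (cls i0)"
        unfolding \<phi>_def by (rule member_le_sum[OF rep_in_pbox[OF q_pos] _ finite_pbox]) (simp add: cls_def)
      then show ?thesis using periodic_rep[OF clsper, of i0 0 i0] cls_self[of i0] by simp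
    qed
    have g_inv: "g x (site_add i k) = g x i" if "ip k = of_int p" for i k p
      by (rule g_periodic[OF xE that])
    have sum_g: "(\<Sum>i\<in>Q. g x i * cls i0 i) = g x i0 * \<phi> (cls i0)" for i0
      unfolding \<phi>_def sum_distrib_left
    proof (rule sum.cong[OF refl])
      fix i show "g x i * cls i0 i = g x i0 * cls i0 i"
      proof (cases "cls i0 i = 0")
        case False
        then have "cls i0 i = 1" using cls01[of i0 i] by blast
        then have "g x i = g x i0" by (rule cls_inv) (rule g_inv)
        then show ?thesis by simp
      qed simp
    qed
    \<comment> \<open>Cross weights by the sizes of the two classes: the variation \<open>v\<close>
      leaves the coordinate sum unchanged.\<close>
    define \<alpha> \<beta> where "\<alpha> = \<phi> (cls i0)" and "\<beta> = \<phi> (cls j0)"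
    have \<alpha>\<beta>: "0 < \<alpha>" "0 < \<beta>" using phi_pos by (simp_all add: \<alpha>_def \<beta>_def)
    define v where "v = (\<lambda>i. \<beta> * cls i0 i - \<alpha> * cls j0 i)"
    have vshift: "v (site_add i k) = v i" if "ip k = of_int p" for i k p
      by (simp add: v_def cls_shift[OF that])
    have phiv: "\<phi> v = 0"
    proof -
      have "\<phi> v = \<beta> * \<phi> (cls i0) - \<alpha> * \<phi> (cls j0)"
        by (simp add: \<phi>_def v_def sum_subtractf sum_distrib_left)
      then show ?thesis by (simp add: \<alpha>_def \<beta>_def)
    qed
    \<comment> \<open>Where \<open>x\<close> touches the upper equilibrium,
      \<open>g_antimono\<close> forces a nonnegative gradient. So there is room to raise
      \<open>x\<close> at \<open>i0\<close>, and symmetrically to lower it at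
      \<open>j0\<close>.\<close>
    have "x i0 \<noteq> b i0"
    proof
      assume "x i0 = b i0"
      then have "g b i0 \<le> g x i0" by (rule g_antimono[OF xb])
      then show False using ij b by (simp add: equilibrium_def)
    qed
    then have d1: "0 < b i0 - x i0" using xb by (simp add: le_fun_def less_le)
    have "x j0 \<noteq> a j0"
    proof
      assume "x j0 = a j0"
      then have "g x j0 \<le> g a j0" by (intro g_antimono[OF ax]) simp
      then show False using ij a by (simp add: equilibrium_def)
    qed
    then have d2: "0 < x j0 - a j0" using ax by (simp add: le_fun_def less_le)
    \<comment> \<open>The largest step for which neither the raised class crosses \<open>b\<close>
      nor the lowered class crosses \<open>a\<close>.\<close>
    define h0 where "h0 = min ((b i0 - x i0) / \<beta>) ((x j0 - a j0) / \<alpha>)"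
    have h0: "0 < h0" "h0 * \<beta> \<le> b i0 - x i0" "h0 * \<alpha> \<le> x j0 - a j0"
      using d1 d2 \<alpha>\<beta> by (auto simp: h0_def min_def field_simps)
    have inZ: "(\<lambda>i. x i + h * v i) \<in> Z" if h: "0 \<le> h" "h \<le> h0" for h
    proof -
      have "x i + h * v i \<le> b i" for i
      proof (cases "cls i0 i = 1")
        case True
        have "b i - x i = b i0 - x i0"
          by (rule cls_inv[of i0 i "\<lambda>i. b i - x i", OF True]) (simp add: E_shift[OF bE] E_shift[OF xE])
        moreover have "h * v i \<le> h0 * \<beta>"
        proof -
          have "v i \<le> \<beta>" using True \<alpha>\<beta> cls01[of j0 i] by (auto simp: v_def)
          then have "h * v i \<le> h * \<beta>" using h by (intro mult_left_mono)
          also have "\<dots> \<le> h0 * \<beta>" using h \<alpha>\<beta> by (intro mult_right_mono) auto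
          finally show ?thesis .
        qed
        ultimately show ?thesis using h0(2) by linarith
      next
        case False
        then have "v i \<le> 0" using cls01[of i0 i] cls01[of j0 i] \<alpha>\<beta> by (auto simp: v_def)
        then have "h * v i \<le> 0" using h by (simp add: mult_nonneg_nonpos)
        moreover have "x i \<le> b i" using xb by (rule le_funD)
        ultimately show ?thesis by linarith
      qed
      moreover have "a i \<le> x i + h * v i" for i
      proof (cases "cls j0 i = 1")
        case True
        have "x i - a i = x j0 - a j0"
          by (rule cls_inv[of j0 i "\<lambda>i. x i - a i", OF True]) (simp add: E_shift[OF aE] E_shift[OF xE])
        moreover have "- (h0 * \<alpha>) \<le> h * v i"
        proof -
          have "- \<alpha> \<le> v i" using True \<alpha>\<beta> cls01[of i0 i] by (auto simp: v_def)
          then have "h * (- \<alpha>) \<le> h * v i" using h by (intro mult_left_mono)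
          moreover have "h * \<alpha> \<le> h0 * \<alpha>" using h \<alpha>\<beta> by (intro mult_right_mono) auto
          ultimately show ?thesis by simp
        qed
        ultimately show ?thesis using h0(3) by linarith
      next
        case False
        then have "0 \<le> v i" using cls01[of i0 i] cls01[of j0 i] \<alpha>\<beta> by (auto simp: v_def)
        then have "0 \<le> h * v i" using h by simp
        moreover have "a i \<le> x i" using ax by (rule le_funD)
        ultimately show ?thesis by linarith
      qed
      moreover have "(\<lambda>i. x i + h * v i) \<in> E"
        unfolding E_def
      proof (intro CollectI allI impI ext)
        fix k l i assume kl: "height k l = 0"
        then have ipk: "ip k = of_int (- l)" by (simp add: height_def)
        show "tau k l (\<lambda>i. x i + h * v i) i = x i + h * v i"
          by (simp add: tau_apply vshift[OF ipk] E_shift[OF xE ipk])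
      qed
      moreover have "\<phi> (\<lambda>i. x i + h * v i) = s"
      proof -
        have "\<phi> (\<lambda>i. x i + h * v i) = \<phi> x + h * \<phi> v" by (simp add: \<phi>_def sum.distrib sum_distrib_left)
        then show ?thesis by (simp add: phiv xs)
      qed
      ultimately show ?thesis by (simp add: Z_def)
    qed
    let ?f = "\<lambda>h. W_B S Q (\<lambda>i. x i + h * v i)"
    have df: "(?f has_real_derivative (\<Sum>i\<in>Q. g (\<lambda>i. x i + 0 * v i) i * v i)) (at 0)"
    proof (rule action_derivative[where \<gamma> = "\<lambda>h i. x i + h * v i"])
      show "periodic q v" unfolding periodic_def using vshift q_int by blast
    qed (auto intro!: derivative_eq_intros simp: xE)
    have "(\<Sum>i\<in>Q. g (\<lambda>i. x i + 0 * v i) i * v i) = \<beta> * (g x i0 * \<alpha>) - \<alpha> * (g x j0 * \<beta>)"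
    proof -
      have "(\<Sum>i\<in>Q. g x i * v i) = \<beta> * (\<Sum>i\<in>Q. g x i * cls i0 i) - \<alpha> * (\<Sum>i\<in>Q. g x i * cls j0 i)"
        by (simp add: v_def sum_distrib_left sum_subtractf[symmetric] algebra_simps)
      then show ?thesis by (simp add: sum_g \<alpha>_def \<beta>_def)
    qed
    moreover have "\<beta> * (g x i0 * \<alpha>) - \<alpha> * (g x j0 * \<beta>) < 0"
    proof -
      have "\<beta> * (g x i0 * \<alpha>) - \<alpha> * (g x j0 * \<beta>) = (\<alpha> * \<beta>) * (g x i0 - g x j0)" by (simp add: algebra_simps)
      then show ?thesis using \<alpha>\<beta> ij by (simp add: mult_pos_neg)
    qed
    ultimately have "(\<Sum>i\<in>Q. g (\<lambda>i. x i + 0 * v i) i * v i) < 0" by simp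
    from DERIV_neg_dec_right[OF df this]
    obtain d where d: "0 < d" "\<And>h. 0 < h \<Longrightarrow> h < d \<Longrightarrow> ?f (0 + h) < ?f 0" by blast
    define h where "h = min h0 (d / 2)"
    have "0 < h" "h < d" "h \<le> h0" using d(1) h0(1) by (auto simp: h_def)
    then show False using d(2)[of h] x(2)[OF inZ[of h]] by simp
  qed
  then show ?thesis by (rule that[OF xE ax xb xs])
qed

end

section \<open>Orbits between ordered equilibria\<close>

context rational_rotation
begin

lemma subseq_in_interval:
  fixes f :: "nat \<Rightarrow> 'd config"
  assumes "\<And>n. a \<le> f n" "\<And>n. f n \<le> b" "\<And>n. f n \<in> E"
  obtains h x where "strict_mono h" "(\<lambda>n. f (h n)) \<longlonglongrightarrow> x" "x \<in> E" "a \<le> x" "x \<le> b"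
proof -
  have bd: "a i \<le> f n i" "f n i \<le> b i" for n i using assms(1,2) by (auto simp: le_fun_def)
  obtain x h where h: "strict_mono h" "(f \<circ> h) \<longlonglongrightarrow> x"
    by (rule config_convergent_subseq[OF bd])
  have lim: "(\<lambda>n. f (h n)) \<longlonglongrightarrow> x" using h(2) by (simp add: o_def)
  have "x \<in> E" by (rule E_limit[OF lim assms(3)])
  moreover have "a i \<le> x i" "x i \<le> b i" for i
    using limit_le[OF tendsto_const lim, where c = 1] limit_le[OF lim tendsto_const, where c = 1] bd by auto
  ultimately show ?thesis using that[OF h(1) lim] by (simp add: le_fun_def)
qed

lemma fixed_point_between:
  assumes "equilibrium a" "x \<in> E" "0 \<le> t" shows "a \<le> x \<Longrightarrow> a \<le> \<Psi> t x" "x \<le> a \<Longrightarrow> \<Psi> t x \<le> a"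
  using Psi_mono[of a x t] Psi_mono[of x a t] Psi_equilibrium[OF assms(1), of t] assms
  by (auto simp: equilibrium_def)

text \<open>The sign \<open>c\<close> encodes the direction: \<open>1\<close> for a forward orbit
  staying above its start, \<open>-1\<close> for one staying below it.\<close>

definition forward :: "real \<Rightarrow> 'd config \<Rightarrow> bool" where
  "forward c x \<longleftrightarrow> (\<forall>t\<ge>0. \<forall>i. c * x i \<le> c * \<Psi> t x i)"

text \<open>The point reached after time \<open>t - s\<close> is ordered relative to the start, and
  order preservation transports this relation by time \<open>s\<close>.\<close>

lemma forward_mono:
  assumes "forward c x" "x \<in> E" "c = 1 \<or> c = -1" "0 \<le> s" "s \<le> t"
  shows "c * \<Psi> s x i \<le> c * \<Psi> t x i"
proof -
  let ?y = "\<Psi> (t - s) x"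
  have y: "?y \<in> E" by (rule Psi_E[OF assms(2)])
  have t: "\<Psi> t x = \<Psi> s ?y" using Psi_add_E[OF assms(2), of s "t - s"] by simp
  have f: "c * x i \<le> c * ?y i" for i using assms(1,5) by (simp add: forward_def)
  from assms(3) show ?thesis
  proof
    assume c: "c = 1"
    then have "x \<le> ?y" using f by (simp add: le_fun_def)
    from Psi_mono[OF assms(2) y this assms(4)] show ?thesis by (simp add: t c le_fun_def)
  next
    assume c: "c = -1"
    then have "?y \<le> x" using f by (simp add: le_fun_def)
    from Psi_mono[OF y assms(2) this assms(4)] show ?thesis by (simp add: t c le_fun_def)
  qed
qed

text \<open>Coordinatewise the orbit is monotone and trapped between the equilibria, so it converges
  along integer times. Shifting by \<open>t\<close> is squeezed between shifts by \<open>0\<close>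
  and by an integer \<open>N \<ge> t\<close>, so the limit is at rest.\<close>

lemma forward_limit:
  assumes c: "c = 1 \<or> c = -1" and x: "x \<in> E" "forward c x"
    and a: "equilibrium a" "a \<le> x" and b: "equilibrium b" "x \<le> b"
  obtains e where "equilibrium e" "a \<le> e" "e \<le> b" "(\<lambda>n. \<Psi> (real n) x) \<longlonglongrightarrow> e" "\<And>i. c * x i \<le> c * e i"
proof -
  have bd: "a i \<le> \<Psi> t x i" "\<Psi> t x i \<le> b i" if "0 \<le> t" for t i
    using fixed_point_between(1)[OF a(1) x(1) that a(2)] fixed_point_between(2)[OF b(1) x(1) that b(2)]
    by (auto simp: le_fun_def)
  have conv: "convergent (\<lambda>n. \<Psi> (real n) x i)" for i
  proof (rule Bseq_monoseq_convergent)
    show "Bseq (\<lambda>n. \<Psi> (real n) x i)"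
    proof (rule BseqI')
      fix n show "norm (\<Psi> (real n) x i) \<le> \<bar>a i\<bar> + \<bar>b i\<bar>"
        using bd[OF of_nat_0_le_iff[of n], of i] unfolding real_norm_def by linarith
    qed
    have "c * \<Psi> (real m) x i \<le> c * \<Psi> (real n) x i" if "m \<le> n" for m n
      by (rule forward_mono[OF x(2,1) c]) (use that in auto)
    then show "monoseq (\<lambda>n. \<Psi> (real n) x i)" using c by (auto simp: monoseq_def)
  qed
  then obtain e where e: "\<And>i. (\<lambda>n. \<Psi> (real n) x i) \<longlonglongrightarrow> e i" unfolding convergent_def by metis
  have lim: "(\<lambda>n. \<Psi> (real n) x) \<longlonglongrightarrow> e" unfolding tendsto_config_iff using e by blast
  have eE: "e \<in> E" by (rule E_limit[OF lim Psi_E[OF x(1)]])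
  have lim_t: "(\<lambda>n. \<Psi> (t + real n) x) \<longlonglongrightarrow> \<Psi> t e" for t
    using Psi_tendsto[OF lim always_eventually eE, of t] Psi_E[OF x(1)] by (simp add: Psi_add_E[OF x(1)])
  have up: "c * e i \<le> c * \<Psi> t e i" if "0 \<le> t" for t i
    by (rule limit_le[OF lim lim_t]) (use that in \<open>auto intro!: always_eventually forward_mono[OF x(2,1) c]\<close>)
  have "\<Psi> t e = e" if t: "0 \<le> t" for t
  proof -
    obtain N :: nat where N: "t \<le> real N" using real_arch_simple by blast
    have "c * \<Psi> t e i \<le> c * e i" for i
    proof -
      have "(\<lambda>n. \<Psi> (real (n + N)) x) \<longlonglongrightarrow> e" using lim by (rule LIMSEQ_ignore_initial_segment)
      then show ?thesis
        by (rule limit_le[OF lim_t]) (use t N in \<open>auto intro!: always_eventually forward_mono[OF x(2,1) c]\<close>)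
    qed
    then have "c * \<Psi> t e i = c * e i" for i using up[OF t] antisym by blast
    then show ?thesis using c by (intro ext) auto
  qed
  then have "equilibrium e" by (rule equilibriumI[OF eE])
  moreover have "a i \<le> e i" "e i \<le> b i" for i
    using limit_le[OF tendsto_const lim, where c = 1] limit_le[OF lim tendsto_const, where c = 1] bd by auto
  moreover have "c * x i \<le> c * e i" for i
    using limit_le[OF tendsto_const lim, where c = c] x(2) by (auto simp: forward_def)
  ultimately show ?thesis using that lim by (simp add: le_fun_def)
qed

text \<open>Monotone orbits that start closer and closer to an equilibrium, shifted in time so that they
  cross a fixed level at time zero, accumulate at an entire monotone orbit.\<close>
lemma entire_orbit_from_forward:
  assumes c: "c = 1 \<or> c = -1"
    and a: "equilibrium a" and b: "equilibrium b" and p: "equilibrium p" and e: "equilibrium e"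
    and x: "\<And>n. x n \<in> E" "\<And>n. a \<le> x n" "\<And>n. x n \<le> b" "\<And>n. forward c (x n)"
    and xp: "x \<longlonglongrightarrow> p" and to_e: "\<And>n. (\<lambda>m. \<Psi> (real m) (x n)) \<longlonglongrightarrow> e"
    and mu: "c * \<phi> p < c * \<mu>" "c * \<mu> < c * \<phi> e"
  obtains z where "z \<in> E" "\<phi> z = \<mu>" "\<And>t. a \<le> \<Psi> t z" "\<And>t. \<Psi> t z \<le> b"
    "\<And>s t. \<Psi> s z \<le> \<Psi> t z \<or> \<Psi> t z \<le> \<Psi> s z"
proof -
  have phi_mono_t: "c * \<phi> (\<Psi> s (x n)) \<le> c * \<phi> (\<Psi> t (x n))" if "0 \<le> s" "s \<le> t" for s t n
    unfolding \<phi>_def sum_distrib_left by (intro sum_mono forward_mono[OF x(4,1) c that])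
  have below: "\<forall>\<^sub>F n in sequentially. c * \<phi> (\<Psi> T (x n)) < c * \<mu>" for T
  proof -
    have "(\<lambda>n. \<Psi> T (x n)) \<longlonglongrightarrow> \<Psi> T p"
      by (rule Psi_tendsto[OF xp]) (use x(1) p in \<open>auto simp: equilibrium_def\<close>)
    then have "(\<lambda>n. c * \<phi> (\<Psi> T (x n))) \<longlonglongrightarrow> c * \<phi> p"
      unfolding Psi_equilibrium[OF p] by (intro tendsto_mult tendsto_const phi_tendsto)
    then show ?thesis using mu(1) by (rule order_tendstoD)
  qed
  \<comment> \<open>Dropping the first \<open>n0\<close> orbits guarantees that all remaining ones
    start on the near side of the level \<open>\<mu>\<close>.\<close>
  then obtain n0 where n0: "\<And>n. n0 \<le> n \<Longrightarrow> c * \<phi> (\<Psi> 0 (x n)) < c * \<mu>"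
    unfolding eventually_sequentially by blast
  have "\<exists>t\<ge>0. \<phi> (\<Psi> t (x (n + n0))) = \<mu>" for n
  proof -
    let ?y = "x (n + n0)"
    have "(\<lambda>m. c * \<phi> (\<Psi> (real m) ?y)) \<longlonglongrightarrow> c * \<phi> e"
      by (intro tendsto_mult tendsto_const phi_tendsto to_e)
    then have "\<forall>\<^sub>F m in sequentially. c * \<mu> < c * \<phi> (\<Psi> (real m) ?y)"
      using mu(2) by (rule order_tendstoD)
    then obtain m where "c * \<mu> < c * \<phi> (\<Psi> (real m) ?y)" unfolding eventually_sequentially by blast
    then have "\<exists>t. 0 \<le> t \<and> t \<le> real m \<and> c * \<phi> (\<Psi> t ?y) = c * \<mu>"
      using n0[of "n + n0"]
      by (intro IVT') (auto intro!: continuous_intros phi_Psi_cont x)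
    then show ?thesis using c by auto
  qed
  then obtain \<tau> where \<tau>: "\<And>n. 0 \<le> \<tau> n" "\<And>n. \<phi> (\<Psi> (\<tau> n) (x (n + n0))) = \<mu>" by metis
  define f where "f = (\<lambda>n. \<Psi> (\<tau> n) (x (n + n0)))"
  have fE: "f n \<in> E" for n unfolding f_def by (rule Psi_E[OF x(1)])
  have fab: "a \<le> \<Psi> t (f n)" "\<Psi> t (f n) \<le> b" if "0 \<le> \<tau> n + t" for n t
  proof -
    have "\<Psi> t (f n) = \<Psi> (\<tau> n + t) (x (n + n0))" by (simp add: f_def Psi_add_E[OF x(1)] add.commute)
    then show "a \<le> \<Psi> t (f n)" "\<Psi> t (f n) \<le> b"
      using fixed_point_between(1)[OF a x(1) that x(2)] fixed_point_between(2)[OF b x(1) that x(3)] by simp_all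
  qed
  \<comment> \<open>Orbits starting near the equilibrium \<open>p\<close> stay near it on any
    bounded time interval, so the crossing times tend to infinity. This makes the limiting orbit
    controlled at all negative times.\<close>
  have large: "\<forall>\<^sub>F n in sequentially. T < \<tau> n" for T
  proof -
    have "\<forall>\<^sub>F n in sequentially. c * \<phi> (\<Psi> (max T 0) (x (n + n0))) < c * \<mu>"
      using below[of "max T 0"] by (subst eventually_sequentially_seg)
    then show ?thesis
    proof eventually_elim
      case (elim n)
      show ?case
      proof (rule ccontr)
        assume "\<not> T < \<tau> n"
        then have "c * \<phi> (\<Psi> (\<tau> n) (x (n + n0))) \<le> c * \<phi> (\<Psi> (max T 0) (x (n + n0)))"
          by (intro phi_mono_t \<tau>) auto
        then show False using elim \<tau>(2) by simp
      qed
    qed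
  qed
  obtain h z where h: "strict_mono h" and lim: "(\<lambda>n. f (h n)) \<longlonglongrightarrow> z" and zE: "z \<in> E"
  proof (rule subseq_in_interval[of a f b])
    show "a \<le> f n" "f n \<le> b" for n using fab[of n 0] \<tau>(1)[of n] by (simp_all add: Psi_0[OF fE])
  qed (auto intro: fE)
  have large': "\<forall>\<^sub>F n in sequentially. T < \<tau> (h n)" for T
    using large[of T] h by (rule eventually_subseq[rotated])
  have lim_t: "(\<lambda>n. \<Psi> t (f (h n))) \<longlonglongrightarrow> \<Psi> t z" for t
    by (rule Psi_tendsto[OF lim]) (auto simp: fE zE)
  have "\<phi> z = \<mu>"
  proof (rule LIMSEQ_unique[OF phi_tendsto[OF lim]])
    show "(\<lambda>n. \<phi> (f (h n))) \<longlonglongrightarrow> \<mu>" by (simp add: f_def \<tau>)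
  qed
  moreover have "a i \<le> \<Psi> t z i" "\<Psi> t z i \<le> b i" for t i
  proof -
    have "\<forall>\<^sub>F n in sequentially. a i \<le> \<Psi> t (f (h n)) i"
      using large'[of "- t"] by eventually_elim (rule le_funD[OF fab(1)], simp)
    then show "a i \<le> \<Psi> t z i" using limit_le[OF tendsto_const lim_t, where c = 1] by simp
    have "\<forall>\<^sub>F n in sequentially. \<Psi> t (f (h n)) i \<le> b i"
      using large'[of "- t"] by eventually_elim (rule le_funD[OF fab(2)], simp)
    then show "\<Psi> t z i \<le> b i" using limit_le[OF lim_t tendsto_const, where c = 1] by simp
  qed
  moreover have mono_z: "c * \<Psi> s z i \<le> c * \<Psi> t z i" if "s \<le> t" for s t i
  proof (rule limit_le[OF lim_t lim_t])
    show "\<forall>\<^sub>F n in sequentially. c * \<Psi> s (f (h n)) i \<le> c * \<Psi> t (f (h n)) i"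
      using large'[of "- s"]
    proof eventually_elim
      case (elim n)
      have "\<Psi> u (f (h n)) = \<Psi> (\<tau> (h n) + u) (x (h n + n0))" for u
        by (simp add: f_def Psi_add_E[OF x(1)] add.commute)
      then show ?case using elim that by (simp add: forward_mono[OF x(4,1) c])
    qed
  qed
  have "\<Psi> s z \<le> \<Psi> t z \<or> \<Psi> t z \<le> \<Psi> s z" for s t
  proof (cases "s \<le> t")
    case True then show ?thesis using mono_z[OF True] c by (auto simp: le_fun_def)
  next
    case False then show ?thesis using mono_z[of t s] c by (auto simp: le_fun_def)
  qed
  ultimately show ?thesis using that[OF zE] by (simp add: le_fun_def)
qed

text \<open>The monotone orbits from \<open>p\<close> and \<open>p'\<close> supply open traps for
  \<open>a\<close> and \<open>b\<close>. A connected segment cannot be covered by the two disjoint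
  open sets of parameters that are eventually trapped, and an untrapped orbit cannot accumulate at
  \<open>a\<close> or \<open>b\<close>.\<close>

lemma third_equilibrium:
  assumes a: "equilibrium a" and b: "equilibrium b" and ab: "a \<le> b" "a \<noteq> b"
    and p: "p \<in> E" "a \<le> p" "p \<noteq> a" "forward (-1) p" "(\<lambda>n. \<Psi> (real n) p) \<longlonglongrightarrow> a"
    and p': "p' \<in> E" "p' \<le> b" "p' \<noteq> b" "forward 1 p'" "(\<lambda>n. \<Psi> (real n) p') \<longlonglongrightarrow> b"
  obtains e where "equilibrium e" "a \<le> e" "e \<le> b" "e \<noteq> a" "e \<noteq> b"
proof -
  have aE: "a \<in> E" and bE: "b \<in> E" using a b by (auto simp: equilibrium_def)
  \<comment> \<open>One unit of time turns \<open>p \<noteq> a\<close> into strict inequality at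
    every site, which makes the trap below \<open>p1\<close> contain a neighbourhood of
    \<open>a\<close> within \<open>E\<close>; likewise for \<open>p1'\<close>.\<close>
  define p1 where "p1 = \<Psi> 1 p"
  define p1' where "p1' = \<Psi> 1 p'"
  have p1E: "p1 \<in> E" "p1' \<in> E" by (simp_all add: p1_def p1'_def Psi_E p p')
  have ap1: "a i < p1 i" for i
    using Psi_strict_mono[OF aE p(1,2) p(3)[symmetric], of 1 i] by (simp add: Psi_equilibrium[OF a] p1_def)
  have bp1: "p1' i < b i" for i
    using Psi_strict_mono[OF p'(1) bE p'(2,3), of 1 i] by (simp add: Psi_equilibrium[OF b] p1'_def)
  have p1t: "\<Psi> t p1 \<le> p1" "p1' \<le> \<Psi> t p1'" if "0 \<le> t" for t
  proof -
    show "\<Psi> t p1 \<le> p1"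
      using forward_mono[OF p(4,1), of 1 "t + 1"] that by (simp add: p1_def Psi_add_E[OF p(1)] le_fun_def)
    show "p1' \<le> \<Psi> t p1'"
      using forward_mono[OF p'(4,1), of 1 "t + 1"] that by (simp add: p1'_def Psi_add_E[OF p'(1)] le_fun_def)
  qed
  have lim1: "(\<lambda>n. \<Psi> (real n) p1) \<longlonglongrightarrow> a" "(\<lambda>n. \<Psi> (real n) p1') \<longlonglongrightarrow> b"
    using LIMSEQ_Suc[OF p(5)] LIMSEQ_Suc[OF p'(5)]
    by (simp_all add: p1_def p1'_def Psi_add_E[OF p(1)] Psi_add_E[OF p'(1)] add.commute)
  define l where "l = (\<lambda>\<theta> i. a i + \<theta> * (b i - a i))"
  have lE: "l \<theta> \<in> E" for \<theta> unfolding l_def by (rule E_add_diff[OF aE bE aE])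
  have lcont: "isCont (\<lambda>\<theta>. \<Psi> T (l \<theta>) i) \<theta>" for T i \<theta>
  proof -
    have "(l \<longlongrightarrow> l \<theta>) (at \<theta>)" unfolding tendsto_config_iff l_def by (auto intro!: tendsto_intros)
    then have "((\<lambda>\<theta>. \<Psi> T (l \<theta>)) \<longlongrightarrow> \<Psi> T (l \<theta>)) (at \<theta>)"
      by (rule Psi_tendsto) (auto simp: lE)
    then show ?thesis unfolding tendsto_config_iff isCont_def by blast
  qed
  define A where "A = (\<Union>T\<in>{0..}. \<Inter>i\<in>Q. {\<theta>. \<Psi> T (l \<theta>) i < p1 i})"
  define B where "B = (\<Union>T\<in>{0..}. \<Inter>i\<in>Q. {\<theta>. p1' i < \<Psi> T (l \<theta>) i})"
  have cont: "continuous_on UNIV (\<lambda>\<theta>. \<Psi> T (l \<theta>) i)" for T i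
    using lcont by (simp add: continuous_on_eq_continuous_at)
  have "open A" "open B"
    unfolding A_def B_def
    by (intro open_UN ballI open_INT finite_pbox open_Collect_less cont continuous_on_const)+
  have Q_le: "x \<le> y" if "x \<in> E" "y \<in> E" "\<And>i. i \<in> Q \<Longrightarrow> x i \<le> y i" for x y
  proof (rule le_funI)
    fix i
    have "x (rep 0 q i) - y (rep 0 q i) = x i - y i"
      by (rule periodic_rep[OF E_diff_periodic[OF that(1,2)]])
    then show "x i \<le> y i" using that(3)[OF rep_in_pbox[OF q_pos], of i] by linarith
  qed
  \<comment> \<open>At a common later time the point would lie above \<open>p1'\<close> and below
    \<open>p1\<close>; following these two orbits to their limits would give
    \<open>b \<le> a\<close>.\<close>
  have disj: "\<theta> \<notin> B" if \<theta>A: "\<theta> \<in> A" for \<theta>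
  proof
    assume "\<theta> \<in> B"
    then obtain T' where T': "0 \<le> T'" "\<And>i. i \<in> Q \<Longrightarrow> p1' i < \<Psi> T' (l \<theta>) i" by (auto simp: B_def)
    obtain T where T: "0 \<le> T" "\<And>i. i \<in> Q \<Longrightarrow> \<Psi> T (l \<theta>) i < p1 i" using \<theta>A by (auto simp: A_def)
    define M where "M = max T T'"
    let ?y = "\<Psi> M (l \<theta>)"
    have yE: "?y \<in> E" by (rule Psi_E[OF lE])
    have "\<Psi> T (l \<theta>) \<le> p1" by (rule Q_le[OF Psi_E[OF lE] p1E(1)]) (use T in \<open>auto intro: less_imp_le\<close>)
    then have "\<Psi> (M - T) (\<Psi> T (l \<theta>)) \<le> \<Psi> (M - T) p1"
      by (intro Psi_mono Psi_E lE p1E) (auto simp: M_def)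
    also have "\<dots> \<le> p1" by (rule p1t) (simp add: M_def)
    finally have up: "?y \<le> p1" by (simp add: Psi_add_E[OF lE])
    have "p1' \<le> \<Psi> T' (l \<theta>)" by (rule Q_le[OF p1E(2) Psi_E[OF lE]]) (use T' in \<open>auto intro: less_imp_le\<close>)
    then have "\<Psi> (M - T') p1' \<le> \<Psi> (M - T') (\<Psi> T' (l \<theta>))"
      by (intro Psi_mono Psi_E lE p1E) (auto simp: M_def)
    moreover have "p1' \<le> \<Psi> (M - T') p1'" by (rule p1t) (simp add: M_def)
    ultimately have lo: "p1' \<le> ?y" by (simp add: Psi_add_E[OF lE])
    have "\<Psi> (real n) p1' \<le> \<Psi> (real n) p1" for n
      using Psi_mono[OF p1E(2,1) order_trans[OF lo up]] by simp
    then have "1 * b i \<le> 1 * a i" for i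
      by (intro limit_le[OF lim1(2,1)]) (auto simp: le_fun_def)
    then have "b \<le> a" by (simp add: le_fun_def)
    then show False using ab by (metis antisym)
  qed
  have "0 \<in> A"
    unfolding A_def by (auto intro!: bexI[of _ 0] simp: l_def Psi_0[OF aE] ap1)
  moreover have "1 \<in> B"
    unfolding B_def by (auto intro!: bexI[of _ 0] simp: l_def Psi_0[OF bE] bp1)
  ultimately have "\<not> {0..1} \<subseteq> A \<union> B"
    using connectedD[OF connected_Icc[of 0 1] \<open>open A\<close> \<open>open B\<close>] disj by fastforce
  then obtain \<theta> where \<theta>: "0 \<le> \<theta>" "\<theta> \<le> 1" "\<theta> \<notin> A" "\<theta> \<notin> B"
    unfolding subset_iff atLeastAtMost_iff Un_iff by blast
  define z where "z = l \<theta>"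
  have zE: "z \<in> E" unfolding z_def by (rule lE)
  have "a i \<le> z i \<and> z i \<le> b i" for i
  proof -
    have "0 \<le> b i - a i" using ab by (simp add: le_fun_def)
    then have "0 \<le> \<theta> * (b i - a i)" "\<theta> * (b i - a i) \<le> b i - a i"
      using \<theta> by (auto intro!: mult_left_le_one_le)
    then show ?thesis by (simp add: z_def l_def)
  qed
  then have zab: "a \<le> z" "z \<le> b" by (auto simp: le_fun_def)
  \<comment> \<open>The orbit need not converge. It suffices to choose times at which the gradient
    becomes small and to take an accumulation point.\<close>
  have "\<exists>t\<ge>0. (\<Sum>i\<in>Q. (g (\<Psi> t z) i)\<^sup>2) < 1 / real (Suc n)" for n
    by (rule action_decay[OF zE]) simp
  then obtain t where t: "\<And>n. 0 \<le> t n" "\<And>n. (\<Sum>i\<in>Q. (g (\<Psi> (t n) z) i)\<^sup>2) < 1 / real (Suc n)" by metis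
  define f where "f = (\<lambda>n. \<Psi> (t n) z)"
  have fE: "f n \<in> E" for n unfolding f_def by (rule Psi_E[OF zE])
  obtain h e where h: "strict_mono h" and lim: "(\<lambda>n. f (h n)) \<longlonglongrightarrow> e" and e: "e \<in> E" "a \<le> e" "e \<le> b"
  proof (rule subseq_in_interval[of a f b])
    show "a \<le> f n" "f n \<le> b" for n
      unfolding f_def
      by (rule fixed_point_between(1)[OF a zE t(1) zab(1)] fixed_point_between(2)[OF b zE t(1) zab(2)])+
  qed (auto intro: fE)
  have "g e i = 0" if i: "i \<in> Q" for i
  proof -
    have le: "(g (f (h n)) i)\<^sup>2 \<le> inverse (real (Suc n))" for n
    proof -
      have "(g (f (h n)) i)\<^sup>2 \<le> (\<Sum>i\<in>Q. (g (f (h n)) i)\<^sup>2)"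
        by (rule member_le_sum[OF i _ finite_pbox]) simp
      also have "\<dots> \<le> 1 / real (Suc (h n))" using t(2)[of "h n"] by (simp add: f_def)
      also have "\<dots> \<le> 1 / real (Suc n)" using seq_suble[OF h, of n] by (intro divide_left_mono) auto
      finally show ?thesis by (simp add: inverse_eq_divide)
    qed
    have "(\<lambda>n. (g (f (h n)) i)\<^sup>2) \<longlonglongrightarrow> (g e i)\<^sup>2"
      by (intro tendsto_power g_tendsto lim)
    from LIMSEQ_le[OF this LIMSEQ_inverse_real_of_nat] le have "(g e i)\<^sup>2 \<le> 0" by blast
    then show ?thesis by simp
  qed
  then have "equilibrium e" using g_Q_zero[OF e(1)] e(1) by (simp add: equilibrium_def)
  moreover have "e \<noteq> a"
  proof
    assume "e = a"
    then have "\<forall>\<^sub>F n in sequentially. f (h n) i < p1 i" for i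
      using lim ap1[of i] unfolding tendsto_config_iff by (intro order_tendstoD(2)) auto
    then have "\<forall>\<^sub>F n in sequentially. \<forall>i\<in>Q. f (h n) i < p1 i"
      by (intro eventually_ball_finite finite_pbox) auto
    then obtain n where "\<forall>i\<in>Q. f (h n) i < p1 i" unfolding eventually_sequentially by blast
    then have "\<theta> \<in> A" unfolding A_def f_def z_def using t(1)[of "h n"] by auto
    then show False using \<theta>(3) by simp
  qed
  moreover have "e \<noteq> b"
  proof
    assume "e = b"
    then have "\<forall>\<^sub>F n in sequentially. p1' i < f (h n) i" for i
      using lim bp1[of i] unfolding tendsto_config_iff by (intro order_tendstoD(1)) auto
    then have "\<forall>\<^sub>F n in sequentially. \<forall>i\<in>Q. p1' i < f (h n) i"
      by (intro eventually_ball_finite finite_pbox) auto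
    then obtain n where "\<forall>i\<in>Q. p1' i < f (h n) i" unfolding eventually_sequentially by blast
    then have "\<theta> \<in> B" unfolding B_def f_def z_def using t(1)[of "h n"] by auto
    then show False using \<theta>(4) by simp
  qed
  ultimately show ?thesis using that e by blast
qed

lemma connecting_orbit:
  assumes a: "equilibrium a" and b: "equilibrium b" and ab: "a \<le> b" "a \<noteq> b"
  obtains z where "z \<in> E" "z \<noteq> a" "z \<noteq> b" "\<And>t. a \<le> \<Psi> t z" "\<And>t. \<Psi> t z \<le> b"
    "\<And>s t. \<Psi> s z \<le> \<Psi> t z \<or> \<Psi> t z \<le> \<Psi> s z"
proof (cases "\<exists>e. equilibrium e \<and> a \<le> e \<and> e \<le> b \<and> e \<noteq> a \<and> e \<noteq> b")
  case True
  then obtain e where e: "equilibrium e" "a \<le> e" "e \<le> b" "e \<noteq> a" "e \<noteq> b" by blast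
  \<comment> \<open>An equilibrium in between already is an entire orbit of the required
    kind.\<close>
  show ?thesis
    by (rule that[of e]) (use e in \<open>auto simp: Psi_equilibrium[OF e(1)] equilibrium_def\<close>)
next
  case False
  have aE: "a \<in> E" and bE: "b \<in> E" using a b by (auto simp: equilibrium_def)
  have phiab: "\<phi> a < \<phi> b" by (rule phi_strict_mono[OF aE bE ab])
  define up where "up = (\<lambda>s x. x \<in> E \<and> a \<le> x \<and> x \<le> b \<and> \<phi> x = s \<and> (\<forall>i. g x i \<le> 0))"
  define dn where "dn = (\<lambda>s x. x \<in> E \<and> a \<le> x \<and> x \<le> b \<and> \<phi> x = s \<and> (\<forall>i. 0 \<le> g x i))"
  have up_or_dn: "(\<exists>x. up s x) \<or> (\<exists>x. dn s x)" if s: "\<phi> a < s" "s < \<phi> b" for s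
    using barrier_exists[OF a b ab(1) less_imp_le[OF s(1)] less_imp_le[OF s(2)]]
    unfolding up_def dn_def by metis
  have fup: "forward 1 x" if "up s x" for s x
    using Psi_ge_subsolution[of x] that by (auto simp: forward_def up_def le_fun_def)
  have fdn: "forward (-1) x" if "dn s x" for s x
    using Psi_le_supersolution[of x] that by (auto simp: forward_def dn_def le_fun_def)
  have limup: "(\<lambda>n. \<Psi> (real n) x) \<longlonglongrightarrow> b" if x: "up s x" and s: "\<phi> a < s" "s < \<phi> b" for s x
  proof -
    have x': "x \<in> E" "a \<le> x" "x \<le> b" "\<phi> x = s" using x by (auto simp: up_def)
    obtain e where e: "equilibrium e" "a \<le> e" "e \<le> b" "(\<lambda>n. \<Psi> (real n) x) \<longlonglongrightarrow> e" "\<And>i. 1 * x i \<le> 1 * e i"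
      by (rule forward_limit[of 1 x a b]) (use x' fup[OF x] a b in auto)
    have "x \<le> e" using e(5) by (simp add: le_fun_def)
    then have "e \<noteq> a" using phi_mono[of x e] x'(4) s by auto
    then show ?thesis using False e by blast
  qed
  have limdn: "(\<lambda>n. \<Psi> (real n) x) \<longlonglongrightarrow> a" if x: "dn s x" and s: "\<phi> a < s" "s < \<phi> b" for s x
  proof -
    have x': "x \<in> E" "a \<le> x" "x \<le> b" "\<phi> x = s" using x by (auto simp: dn_def)
    obtain e where e: "equilibrium e" "a \<le> e" "e \<le> b" "(\<lambda>n. \<Psi> (real n) x) \<longlonglongrightarrow> e" "\<And>i. -1 * x i \<le> -1 * e i"
      by (rule forward_limit[of "-1" x a b]) (use x' fdn[OF x] a b in auto)
    have "e \<le> x" using e(5) by (simp add: le_fun_def)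
    then have "e \<noteq> b" using phi_mono[of e x] x'(4) s by auto
    then show ?thesis using False e by blast
  qed
  define D where "D = \<phi> b - \<phi> a"
  have D: "0 < D" using phiab by (simp add: D_def)
  \<comment> \<open>The double successor makes \<open>d n < D\<close> strict even for
    \<open>n = 0\<close>, so every level lies strictly between those of \<open>a\<close> and
    \<open>b\<close>.\<close>
  define d where "d = (\<lambda>n::nat. D * inverse (real (Suc (Suc n))))"
  have d: "0 < d n" "d n < D" for n
  proof -
    have "0 < inverse (real (Suc (Suc n)))" "inverse (real (Suc (Suc n))) < 1" by (auto simp: field_simps)
    from mult_strict_left_mono[OF this(1) D] mult_strict_left_mono[OF this(2) D]
    show "0 < d n" "d n < D" by (simp_all add: d_def)
  qed
  have d0: "d \<longlonglongrightarrow> 0"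
    unfolding d_def using LIMSEQ_Suc[OF LIMSEQ_inverse_real_of_nat] by (rule tendsto_mult_right_zero)
  have lim_of_phi: "x \<longlonglongrightarrow> p" if "\<And>n i. \<bar>x n i - p i\<bar> \<le> d n" for x p
    unfolding tendsto_config_iff
  proof
    fix i
    have "(\<lambda>n. x n i - p i) \<longlonglongrightarrow> 0"
      by (rule Lim_null_comparison[OF _ d0]) (use that in \<open>auto intro!: always_eventually\<close>)
    then show "(\<lambda>n. x n i) \<longlonglongrightarrow> p i" by (rule LIM_zero_cancel)
  qed
  \<comment> \<open>Fixing the middle level keeps the limiting orbit away from both
    equilibria.\<close>
  define \<mu> where "\<mu> = \<phi> a + D / 2"
  have mu: "\<phi> a < \<mu>" "\<mu> < \<phi> b" using D by (auto simp: \<mu>_def D_def field_simps)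
  consider "\<And>s. \<phi> a < s \<Longrightarrow> s < \<phi> b \<Longrightarrow> \<exists>x. up s x" | "\<And>s. \<phi> a < s \<Longrightarrow> s < \<phi> b \<Longrightarrow> \<exists>x. dn s x"
    | s s' x x' where "\<phi> a < s" "s < \<phi> b" "dn s x" "\<phi> a < s'" "s' < \<phi> b" "up s' x'"
    using up_or_dn by metis
  then show ?thesis
  proof cases
    case 1
    have s: "\<phi> a < \<phi> a + d n" "\<phi> a + d n < \<phi> b" for n using d[of n] by (auto simp: D_def)
    obtain x where x: "\<And>n. up (\<phi> a + d n) (x n)" using 1[OF s] by metis
    have x': "x n \<in> E" "a \<le> x n" "x n \<le> b" "\<phi> (x n) = \<phi> a + d n" for n using x[of n] by (auto simp: up_def)
    have xlim: "x \<longlonglongrightarrow> a"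
      by (rule lim_of_phi) (use phi_bounds_diff[OF aE x'(1,2)] x'(4) in simp)
    obtain z where "z \<in> E" "\<phi> z = \<mu>" "\<And>t. a \<le> \<Psi> t z" "\<And>t. \<Psi> t z \<le> b"
       "\<And>s t. \<Psi> s z \<le> \<Psi> t z \<or> \<Psi> t z \<le> \<Psi> s z"
      by (rule entire_orbit_from_forward[where c = 1 and x = x and p = a and e = b and \<mu> = \<mu>, OF _ a b a b])
        (use x' fup[OF x] limup[OF x s] mu xlim in auto)
    then show ?thesis using that[of z] mu by auto
  next
    case 2
    have s: "\<phi> a < \<phi> b - d n" "\<phi> b - d n < \<phi> b" for n using d[of n] by (auto simp: D_def)
    obtain x where x: "\<And>n. dn (\<phi> b - d n) (x n)" using 2[OF s] by metis
    have x': "x n \<in> E" "a \<le> x n" "x n \<le> b" "\<phi> (x n) = \<phi> b - d n" for n using x[of n] by (auto simp: dn_def)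
    have xlim: "x \<longlonglongrightarrow> b"
    proof (rule lim_of_phi)
      show "\<bar>x n i - b i\<bar> \<le> d n" for n i
        using phi_bounds_diff[OF x'(1)[of n] bE x'(3)[of n], of i] x'(4)[of n] by (simp add: abs_minus_commute)
    qed
    obtain z where "z \<in> E" "\<phi> z = \<mu>" "\<And>t. a \<le> \<Psi> t z" "\<And>t. \<Psi> t z \<le> b"
       "\<And>s t. \<Psi> s z \<le> \<Psi> t z \<or> \<Psi> t z \<le> \<Psi> s z"
      by (rule entire_orbit_from_forward[where c = "-1" and x = x and p = b and e = a and \<mu> = \<mu>, OF _ a b b a])
        (use x' fdn[OF x] limdn[OF x s] mu xlim in auto)
    then show ?thesis using that[of z] mu by auto
  next
    case 3
    obtain e where "equilibrium e" "a \<le> e" "e \<le> b" "e \<noteq> a" "e \<noteq> b"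
    proof (rule third_equilibrium[OF a b ab, of x x'])
      show "x \<in> E" "a \<le> x" "x' \<in> E" "x' \<le> b" using 3 by (auto simp: up_def dn_def)
      show "x \<noteq> a" "x' \<noteq> b" using 3 by (auto simp: up_def dn_def)
      show "forward (-1) x" "forward 1 x'" using 3 fup fdn by blast+
      show "(\<lambda>n. \<Psi> (real n) x) \<longlonglongrightarrow> a" "(\<lambda>n. \<Psi> (real n) x') \<longlonglongrightarrow> b" using 3 limup limdn by blast+
    qed
    then show ?thesis using False by blast
  qed
qed

end

section \<open>Maximal invariant chains\<close>

context rational_rotation
begin

lemma rotation_vector_E: assumes "x \<in> E" shows "has_rotation_vector x \<omega>"
  unfolding has_rotation_vector_def
proof
  fix i :: "'d site"
  obtain M where M: "\<And>j. \<bar>x j - ip j\<bar> \<le> M" using E_diff_bounded[OF assms ip_in_E] by metis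
  have "(\<lambda>n. x (scale (int n) i) / real n - ip i) \<longlonglongrightarrow> 0"
  proof (rule Lim_null_comparison)
    show "(\<lambda>n. M * inverse (real n)) \<longlonglongrightarrow> 0"
      by (rule tendsto_mult_right_zero[OF lim_inverse_n])
    show "\<forall>\<^sub>F n in sequentially. norm (x (scale (int n) i) / real n - ip i) \<le> M * inverse (real n)"
      using eventually_gt_at_top[of 0]
    proof eventually_elim
      case (elim n)
      then have "x (scale (int n) i) / real n - ip i = (x (scale (int n) i) - ip (scale (int n) i)) / real n"
        by (simp add: ip_scale field_simps)
      then show ?case using M[of "scale (int n) i"] elim
        by (simp add: abs_divide divide_right_mono divide_inverse[symmetric])
    qed
  qed
  then have "(\<lambda>n. x (scale (int n) i) / real n) \<longlonglongrightarrow> ip i" by (rule LIM_zero_cancel)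
  then show "(\<lambda>n. x (\<lambda>m. int n * i m) / real n) \<longlonglongrightarrow> ip i" by (simp add: scale_def)
qed

lemma Bw_subset_Bbar: "Bw \<subseteq> Bbar \<omega>"
proof
  fix x assume x: "x \<in> Bw"
  then have "x \<in> E" using Bw_subset_E by blast
  moreover have "birkhoff x"
    unfolding birkhoff_def
  proof (intro allI)
    fix k l
    show "(\<forall>i. x i \<le> tau k l x i) \<or> (\<forall>i. tau k l x i \<le> x i)"
      using Bw_le[OF x, of k l] Bw_ge[OF x, of k l] linear[of 0 "height k l"] by (auto simp: le_fun_def)
  qed
  ultimately show "x \<in> Bbar \<omega>"
    using rotation_vector_E by (simp add: Bbar_def E_def height_def)
qed

text \<open>If the translation fixed \<open>x\<close>, then \<open>x\<close> would change by exactly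
  \<open>- l\<close> at each step along multiples of \<open>k\<close>, so its distance from
  \<open>ip\<close> would grow like \<open>n * height k l\<close>. That distance is bounded on
  \<open>E\<close>.\<close>

lemma Bw_tau_neq: assumes "x \<in> Bw" "0 < height k l" shows "tau k l x \<noteq> x"
proof
  assume eq: "tau k l x = x"
  have xE: "x \<in> E" using assms(1) Bw_subset_E by blast
  obtain M where M: "\<And>j. \<bar>x j - ip j\<bar> \<le> M" using E_diff_bounded[OF xE ip_in_E] by metis
  have iter: "x (scale (int n) k) = x origin - real n * of_int l" for n
  proof (induction n)
    case 0 then show ?case by (simp add: scale_def)
  next
    case (Suc n)
    have "scale (int (Suc n)) k = site_add (scale (int n) k) k"
      by (simp add: scale_def site_add_def algebra_simps)
    moreover have "x (site_add (scale (int n) k) k) + of_int l = x (scale (int n) k)"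
      using fun_cong[OF eq, of "scale (int n) k"] by (simp add: tau_apply)
    ultimately show ?case using Suc by (simp add: algebra_simps)
  qed
  obtain n :: nat where n: "(M + \<bar>x origin\<bar>) / height k l < real n" using reals_Archimedean2 by blast
  then have "M + \<bar>x origin\<bar> < real n * height k l" using assms(2) by (simp add: field_simps)
  also have "real n * height k l = ip (scale (int n) k) - x (scale (int n) k) + x origin"
    by (simp add: iter ip_scale height_def algebra_simps)
  also have "\<dots> \<le> M + \<bar>x origin\<bar>" using M[of "scale (int n) k"] by linarith
  finally show False by simp
qed

text \<open>Only weak order is required, so that closures and unions preserve the notion. All real
  times are included: pulling points back by the flow is what later yields strict order.\<close>

definition invariant_chain :: "'d config set \<Rightarrow> bool" where
  "invariant_chain C \<longleftrightarrow> C \<subseteq> Bw \<and> (\<forall>x\<in>C. \<forall>y\<in>C. x \<le> y \<or> y \<le> x) \<and>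
     (\<forall>x\<in>C. \<forall>k l. tau k l x \<in> C) \<and> (\<forall>x\<in>C. \<forall>t. \<Psi> t x \<in> C)"

text \<open>Being comparable to a fixed configuration is a closed condition, so comparability
  extends to the closure in one argument and then in the other. Invariance passes over by continuity
  of the translations and of the flow.\<close>

lemma invariant_chain_closure:
  assumes C: "invariant_chain C" shows "invariant_chain (closure C)"
proof -
  have CB: "C \<subseteq> Bw" using C by (simp add: invariant_chain_def)
  then have cB: "closure C \<subseteq> Bw" by (rule closure_minimal[OF _ closed_Bw])
  have comp: "closed {y. x \<le> y \<or> y \<le> x}" for x :: "'d config"
  proof -
    have "{y. x \<le> y \<or> y \<le> x} = (\<Inter>i. {y. x i \<le> y i}) \<union> (\<Inter>i. {y. y i \<le> x i})"
      by (auto simp: le_fun_def)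
    moreover have "closed (\<Inter>i. {y :: 'd config. x i \<le> y i})" "closed (\<Inter>i. {y :: 'd config. y i \<le> x i})"
      by (intro closed_INT ballI closed_Collect_le continuous_on_const continuous_on_coord)+
    ultimately show ?thesis by (simp add: closed_Un)
  qed
  have 1: "x \<le> y \<or> y \<le> x" if "x \<in> C" "y \<in> closure C" for x y
  proof -
    have "C \<subseteq> {y. x \<le> y \<or> y \<le> x}" using C that(1) by (auto simp: invariant_chain_def)
    then show ?thesis using closure_minimal[OF _ comp] that(2) by blast
  qed
  have 2: "x \<le> y \<or> y \<le> x" if "x \<in> closure C" "y \<in> closure C" for x y
  proof -
    have "C \<subseteq> {y. x \<le> y \<or> y \<le> x}" using 1 that(1) by blast
    then show ?thesis using closure_minimal[OF _ comp] that(2) by blast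
  qed
  have 3: "tau k l x \<in> closure C" if "x \<in> closure C" for k l x
  proof -
    have "continuous_on UNIV (tau k l :: 'd config \<Rightarrow> 'd config)"
      unfolding continuous_on_def tendsto_config_iff tau_apply
      by (auto intro!: tendsto_intros continuous_on_product_coordinates[unfolded continuous_on_def, rule_format])
    then have "tau k l ` closure C \<subseteq> closure C"
      by (intro image_closure_subset) (use C in \<open>auto simp: invariant_chain_def intro: continuous_on_subset closure_subset[THEN subsetD]\<close>)
    then show ?thesis using that by blast
  qed
  have 4: "\<Psi> t x \<in> closure C" if "x \<in> closure C" for t x
  proof -
    have "continuous_on (closure C) (\<Psi> t)"
      by (rule continuous_on_subset[OF Psi_continuous_on]) (use cB Bw_subset_E in blast)
    then have "\<Psi> t ` closure C \<subseteq> closure C"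
      by (intro image_closure_subset) (use C in \<open>auto simp: invariant_chain_def intro: closure_subset[THEN subsetD]\<close>)
    then show ?thesis using that by blast
  qed
  show ?thesis using cB 2 3 4 by (simp add: invariant_chain_def)
qed

text \<open>A translation of positive height moves the gap beyond itself, so the inserted translates of
  the orbit do not interleave.\<close>
lemma invariant_chain_insert_orbit:
  assumes C: "invariant_chain C" and ab: "a \<in> C" "b \<in> C" "a \<noteq> b"
    and gap: "\<And>x. x \<in> C \<Longrightarrow> x \<le> a \<or> b \<le> x"
    and z: "z \<in> E" "\<And>t. a \<le> \<Psi> t z" "\<And>t. \<Psi> t z \<le> b" "\<And>s t. \<Psi> s z \<le> \<Psi> t z \<or> \<Psi> t z \<le> \<Psi> s z"
  shows "invariant_chain (C \<union> {tau k l (\<Psi> t z) |k l t. True})"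
proof -
  have CB: "C \<subseteq> Bw" and Cch: "\<And>x y. x \<in> C \<Longrightarrow> y \<in> C \<Longrightarrow> x \<le> y \<or> y \<le> x"
    and Ct: "\<And>x k l. x \<in> C \<Longrightarrow> tau k l x \<in> C" and CP: "\<And>x t. x \<in> C \<Longrightarrow> \<Psi> t x \<in> C"
    using C by (auto simp: invariant_chain_def)
  have zE: "\<Psi> t z \<in> E" for t by (rule Psi_E[OF z(1)])
  \<comment> \<open>The translate of \<open>a\<close> belongs to the chain, lies above
    \<open>a\<close> and differs from it, so it must lie beyond the gap.\<close>
  have ahead: "b \<le> tau k l a" if "0 < height k l" for k l
  proof -
    have aB: "a \<in> Bw" using ab CB by blast
    have "a \<le> tau k l a" using Bw_le[OF aB] that by simp
    moreover have "tau k l a \<noteq> a" by (rule Bw_tau_neq[OF aB that])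
    ultimately show ?thesis using gap[OF Ct[OF ab(1)], of k l] by (metis antisym)
  qed
  have up: "\<Psi> s z \<le> tau k l (\<Psi> t z)" if "0 < height k l" for k l s t
    using order_trans[OF z(3)[of s] order_trans[OF ahead[OF that] tau_mono[OF z(2)[of t]]]] .
  have same: "tau k l (\<Psi> t z) = \<Psi> t z" if "height k l = 0" for k l t
    using zE[of t] that by (simp add: E_def)
  have shift_diff: "tau k l x = tau k' l' (tau (site_diff k k') (l - l') x)" for k l k' l' and x :: "'d config"
    by (simp add: tau_tau site_simps)
  have cmp1: "\<Psi> s z \<le> tau k l (\<Psi> t z) \<or> tau k l (\<Psi> t z) \<le> \<Psi> s z" for k l s t
  proof -
    consider "0 < height k l" | "height k l = 0" | "height k l < 0" by linarith
    then show ?thesis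
    proof cases
      case 1 then show ?thesis using up by blast
    next
      case 2 then show ?thesis using same z(4) by simp
    next
      case 3
      then have "\<Psi> t z \<le> tau (\<lambda>m. - k m) (- l) (\<Psi> s z)" by (intro up) (simp add: height_neg)
      from tau_mono[OF this, of k l] show ?thesis by (simp add: tau_inverse)
    qed
  qed
  have cmp2: "tau k l (\<Psi> s z) \<le> tau k' l' (\<Psi> t z) \<or> tau k' l' (\<Psi> t z) \<le> tau k l (\<Psi> s z)" for k l k' l' s t
    using cmp1[of s "site_diff k' k" "l' - l" t] shift_diff[of k' l' "\<Psi> t z" k l] tau_mono by metis
  have cmp3: "x \<le> tau k l (\<Psi> t z) \<or> tau k l (\<Psi> t z) \<le> x" if x: "x \<in> C" for x k l t
  proof -
    have "tau (\<lambda>m. - k m) (- l) x \<le> a \<or> b \<le> tau (\<lambda>m. - k m) (- l) x" by (rule gap[OF Ct[OF x]])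
    then have "tau (\<lambda>m. - k m) (- l) x \<le> \<Psi> t z \<or> \<Psi> t z \<le> tau (\<lambda>m. - k m) (- l) x"
      using z(2,3) order_trans by blast
    then show ?thesis using tau_mono[of _ _ k l] tau_inverse(2)[of k l x] by metis
  qed
  have zB: "\<Psi> t z \<in> Bw" for t
    unfolding Bw_def
  proof (intro CollectI allI impI)
    fix k l assume "0 \<le> height k l"
    then show "\<Psi> t z \<le> tau k l (\<Psi> t z)" using up[of k l t t] same[of k l t] by (cases "height k l = 0") auto
  qed
  show ?thesis
    unfolding invariant_chain_def
  proof (intro conjI ballI allI)
    show "C \<union> {tau k l (\<Psi> t z) |k l t. True} \<subseteq> Bw" using CB Bw_tau[OF zB] by auto
    show "x \<le> y \<or> y \<le> x" if "x \<in> C \<union> {tau k l (\<Psi> t z) |k l t. True}" "y \<in> C \<union> {tau k l (\<Psi> t z) |k l t. True}" for x y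
      using that Cch cmp2 cmp3 by blast
    fix x k l assume "x \<in> C \<union> {tau k l (\<Psi> t z) |k l t. True}"
    then show "tau k l x \<in> C \<union> {tau k l (\<Psi> t z) |k l t. True}"
      using Ct by (auto simp: tau_tau) blast+
  next
    fix x t assume "x \<in> C \<union> {tau k l (\<Psi> t z) |k l t. True}"
    then show "\<Psi> t x \<in> C \<union> {tau k l (\<Psi> t z) |k l t. True}"
      using CP Psi_tau_E[OF zE] Psi_add_E[OF z(1)] by auto metis
  qed
qed

lemma maximal_invariant_chain:
  assumes "invariant_chain C0"
  obtains C where "invariant_chain C" "C0 \<subseteq> C" "\<And>C'. invariant_chain C' \<Longrightarrow> C \<subseteq> C' \<Longrightarrow> C' = C"
proof -
  let ?A = "{C. invariant_chain C \<and> C0 \<subseteq> C}"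
  have "\<exists>M\<in>?A. \<forall>X\<in>?A. M \<subseteq> X \<longrightarrow> X = M"
  proof (rule subset_Zorn_nonempty)
    show "?A \<noteq> {}" using assms by blast
    fix \<C> assume ne: "\<C> \<noteq> {}" and ch: "subset.chain ?A \<C>"
    then have sub: "\<And>C. C \<in> \<C> \<Longrightarrow> invariant_chain C \<and> C0 \<subseteq> C" and
      cmp: "\<And>C D. C \<in> \<C> \<Longrightarrow> D \<in> \<C> \<Longrightarrow> C \<subseteq> D \<or> D \<subseteq> C"
      by (auto simp: subset_chain_def)
    have "x \<le> y \<or> y \<le> x" if xy: "x \<in> \<Union>\<C>" "y \<in> \<Union>\<C>" for x y
    proof -
      obtain X Y where XY: "X \<in> \<C>" "Y \<in> \<C>" "x \<in> X" "y \<in> Y" using xy by blast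
      then obtain Z where "Z \<in> \<C>" "x \<in> Z" "y \<in> Z" using cmp[OF XY(1,2)] by blast
      then show ?thesis using sub[of Z] by (auto simp: invariant_chain_def)
    qed
    moreover have "\<Union>\<C> \<subseteq> Bw" "C0 \<subseteq> \<Union>\<C>" using sub ne unfolding invariant_chain_def by blast+
    moreover have "tau k l x \<in> \<Union>\<C>" "\<Psi> t x \<in> \<Union>\<C>" if "x \<in> \<Union>\<C>" for x k l t
      using that sub unfolding invariant_chain_def by blast+
    ultimately show "\<Union>\<C> \<in> ?A" by (auto simp: invariant_chain_def)
  qed
  then obtain M where M: "invariant_chain M" "C0 \<subseteq> M" and
    max: "\<forall>X\<in>?A. M \<subseteq> X \<longrightarrow> X = M" by auto
  show ?thesis
  proof (rule that[OF M])
    fix X assume "invariant_chain X" "M \<subseteq> X"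
    then show "X = M" using M(2) max by auto
  qed
qed

lemma ghost_circle_exists:
  "\<exists>\<Gamma>. ghost_circle r S \<Gamma> \<and> \<Gamma> \<subseteq> Bbar \<omega> \<and> (\<exists>x\<in>\<Gamma>. global_minimizer r S x)"
proof -
  obtain x0 where x0: "x0 \<in> Bw" "global_minimizer r S x0" by (rule Bw_global_minimizer)
  have x0E: "x0 \<in> E" using x0 Bw_subset_E by blast
  have x0eq: "\<Psi> t x0 = x0" for t
    by (rule Psi_equilibrium) (simp add: equilibrium_def x0E global_minimizer_equilibrium[OF x0(2)])
  have "invariant_chain {tau k l x0 |k l. True}"
    unfolding invariant_chain_def
  proof (intro conjI ballI allI)
    show "{tau k l x0 |k l. True} \<subseteq> Bw" using Bw_tau[OF x0(1)] by auto
    fix x y assume "x \<in> {tau k l x0 |k l. True}" "y \<in> {tau k l x0 |k l. True}"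
    then obtain k l k' l' where xy: "x = tau k l x0" "y = tau k' l' x0" by blast
    then have "y = tau (site_diff k' k) (l' - l) x" by (simp add: tau_tau site_simps)
    moreover have "x \<in> Bw" using Bw_tau[OF x0(1)] xy by simp
    ultimately show "x \<le> y \<or> y \<le> x"
      using Bw_le[of x "site_diff k' k" "l' - l"] Bw_ge[of x "site_diff k' k" "l' - l"] linear by blast
  next
    fix x k l assume "x \<in> {tau k l x0 |k l. True}"
    then show "tau k l x \<in> {tau k l x0 |k l. True}" by (auto simp: tau_tau) blast
  next
    fix x t assume "x \<in> {tau k l x0 |k l. True}"
    then show "\<Psi> t x \<in> {tau k l x0 |k l. True}" by (auto simp: Psi_tau_E[OF x0E] x0eq) blast
  qed
  then obtain C where C: "invariant_chain C" "{tau k l x0 |k l. True} \<subseteq> C"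
    and max: "\<And>C'. invariant_chain C' \<Longrightarrow> C \<subseteq> C' \<Longrightarrow> C' = C"
    by (rule maximal_invariant_chain) blast
  have x0C: "tau k l x0 \<in> C" for k l using C(2) by blast
  then have x0C': "x0 \<in> C" using tau_zero by metis
  have CB: "C \<subseteq> Bw" and Cch: "\<And>x y. x \<in> C \<Longrightarrow> y \<in> C \<Longrightarrow> x \<le> y \<or> y \<le> x"
    and Ct: "\<And>x k l. x \<in> C \<Longrightarrow> tau k l x \<in> C" and CP: "\<And>x t. x \<in> C \<Longrightarrow> \<Psi> t x \<in> C"
    using C(1) by (auto simp: invariant_chain_def)
  have CE: "x \<in> E" if "x \<in> C" for x using that CB Bw_subset_E by blast
  have closedC: "closed C"
    using max[OF invariant_chain_closure[OF C(1)] closure_subset] by (metis closed_closure)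
  \<comment> \<open>Backward invariance exhibits \<open>x\<close> and \<open>y\<close> as time-one
    images of two chain elements; these inherit the order, since the opposite one would be carried
    forward to \<open>x\<close> and \<open>y\<close>.\<close>
  have strict: "strictly_less x y" if xy: "x \<in> C" "y \<in> C" "x \<le> y" "x \<noteq> y" for x y
  proof -
    let ?x = "\<Psi> (-1) x" and ?y = "\<Psi> (-1) y"
    have inv: "\<Psi> 1 ?x = x" "\<Psi> 1 ?y = y" using Psi_inverse(2)[OF CE, of _ 1] xy by simp_all
    have E: "?x \<in> E" "?y \<in> E" using CE xy by (auto intro: Psi_E)
    have "\<not> ?y \<le> ?x"
    proof
      assume "?y \<le> ?x"
      then have "y \<le> x" using Psi_mono[OF E(2,1), of 1] inv by simp
      then show False using xy by simp
    qed
    then have "?x \<le> ?y" "?x \<noteq> ?y" using Cch[OF CP[OF xy(1)] CP[OF xy(2)], of "-1" "-1"] by auto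
    then show ?thesis using Psi_strict_mono[OF E, of 1] inv by (simp add: strictly_less_def)
  qed
  have phi_order: "x \<le> y" if "x \<in> C" "y \<in> C" "\<phi> x \<le> \<phi> y" for x y
    using Cch[OF that(1,2)] phi_strict_mono[OF CE CE, of y x] that by fastforce
  \<comment> \<open>Because \<open>\<phi>\<close> is injective on the chain, a gap is the same as a
    missed value.\<close>
  have surj: "s \<in> \<phi> ` C" for s
  proof (rule ccontr)
    assume s: "s \<notin> \<phi> ` C"
    \<comment> \<open>Vertical integer translates of the minimiser reach arbitrarily low and high
      levels; between two of them the chain is compact.\<close>
    define T where "T = (\<lambda>n::int. tau origin n x0)"
    have phiT: "\<phi> (T n) = \<phi> x0 + real_of_int n * real (card Q)" for n
      by (simp add: \<phi>_def T_def tau_apply site_simps sum.distrib)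
    have cardQ: "1 \<le> real (card Q)"
      using Q_nonempty finite_pbox card_gt_0_iff[of Q] by (metis One_nat_def Suc_leI of_nat_1 of_nat_le_iff)
    define n where "n = \<lceil>\<bar>s - \<phi> x0\<bar>\<rceil>"
    have n: "\<bar>s - \<phi> x0\<bar> \<le> real_of_int n * real (card Q)"
    proof -
      have "\<bar>s - \<phi> x0\<bar> * 1 \<le> real_of_int n * real (card Q)" unfolding n_def by (intro mult_mono cardQ) auto
      then show ?thesis by simp
    qed
    have TC: "T m \<in> C" for m by (simp add: T_def x0C)
    have Tn: "\<phi> (T (- n)) \<le> s" "s \<le> \<phi> (T n)" using n by (simp_all add: phiT abs_le_iff algebra_simps)
    define Z where "Z = {x. \<forall>i. T (- n) i \<le> x i \<and> x i \<le> T n i} \<inter> C"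
    have "compact Z" unfolding Z_def by (intro compact_Int_closed compact_order_interval closedC)
    have Zmem: "x \<in> Z" if "x \<in> C" "\<phi> (T (- n)) \<le> \<phi> x" "\<phi> x \<le> \<phi> (T n)" for x
      using phi_order[OF TC that(1,2)] phi_order[OF that(1) TC that(3)] that(1)
      by (simp add: Z_def le_fun_def)
    have ord: "\<phi> (T (- n)) \<le> \<phi> (T n)" using Tn by linarith
    have "compact (Z \<inter> {x. \<phi> x \<le> s})" "compact (Z \<inter> {x. s \<le> \<phi> x})"
      by (intro compact_Int_closed \<open>compact Z\<close> closed_Collect_le phi_cont continuous_on_const)+
    moreover have "T (- n) \<in> Z \<inter> {x. \<phi> x \<le> s}" "T n \<in> Z \<inter> {x. s \<le> \<phi> x}"
      using Tn ord TC Zmem by auto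
    \<comment> \<open>The end points of the gap: the highest level below \<open>s\<close> and the
      lowest one above it, both attained by compactness.\<close>
    ultimately obtain a b where a: "a \<in> Z" "\<phi> a \<le> s" "\<And>x. x \<in> Z \<Longrightarrow> \<phi> x \<le> s \<Longrightarrow> \<phi> x \<le> \<phi> a"
      and b: "b \<in> Z" "s \<le> \<phi> b" "\<And>x. x \<in> Z \<Longrightarrow> s \<le> \<phi> x \<Longrightarrow> \<phi> b \<le> \<phi> x"
      using continuous_attains_sup[of "Z \<inter> {x. \<phi> x \<le> s}" \<phi>] continuous_attains_inf[of "Z \<inter> {x. s \<le> \<phi> x}" \<phi>] phi_cont
      by (metis (mono_tags, lifting) IntD1 IntD2 IntI empty_iff mem_Collect_eq)
    have abC: "a \<in> C" "b \<in> C" using a b by (auto simp: Z_def)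
    have ne: "\<phi> x \<noteq> s" if "x \<in> C" for x using s that by blast
    have gap: "x \<le> a \<or> b \<le> x" if x: "x \<in> C" for x
    proof (cases "\<phi> x \<le> s")
      case True
      have "\<phi> x \<le> \<phi> a"
      proof (cases "\<phi> (T (- n)) \<le> \<phi> x")
        case True' : True
        show ?thesis by (rule a(3)[OF Zmem[OF x True'] True]) (use True Tn in linarith)
      next
        case False
        then show ?thesis using a(3)[of "T (- n)"] Tn ord TC Zmem[of "T (- n)"] by force
      qed
      then show ?thesis using phi_order[OF x abC(1)] by blast
    next
      case False
      have "\<phi> b \<le> \<phi> x"
      proof (cases "\<phi> x \<le> \<phi> (T n)")
        case True
        show ?thesis by (rule b(3)[OF Zmem[OF x _ True]]) (use False Tn in linarith)+
      next
        case False
        then show ?thesis using b(3)[of "T n"] Tn ord TC Zmem[of "T n"] by force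
      qed
      then show ?thesis using phi_order[OF abC(2) x] by blast
    qed
    have phiab: "\<phi> a < s" "s < \<phi> b" using a(2) b(2) ne[OF abC(1)] ne[OF abC(2)] by auto
    have "a \<noteq> b" using phiab by auto
    have "a \<le> b" by (rule phi_order[OF abC]) (use phiab in linarith)
    text \<open>The flow preserves the chain, so by continuity in time an end point of a gap cannot move
      across it; moving only to one side in both time directions, it is at rest.\<close>
    have stay: "(\<phi> (\<Psi> t x) < s) = (\<phi> x < s)" if x: "x \<in> C" for x t
    proof -
      have "connected ((\<lambda>t. \<phi> (\<Psi> t x)) ` UNIV)"
        by (rule connected_continuous_image[OF phi_Psi_cont[OF CE[OF x]] connected_UNIV])
      then have conn: "s \<in> range (\<lambda>t. \<phi> (\<Psi> t x))"
        if "u \<in> range (\<lambda>t. \<phi> (\<Psi> t x))" "v \<in> range (\<lambda>t. \<phi> (\<Psi> t x))" "u \<le> s" "s \<le> v" for u v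
        using that connectedD_interval by blast
      have r: "\<phi> (\<Psi> t x) \<in> range (\<lambda>t. \<phi> (\<Psi> t x))" "\<phi> x \<in> range (\<lambda>t. \<phi> (\<Psi> t x))"
        using rangeI[of "\<lambda>t. \<phi> (\<Psi> t x)" 0] by (auto simp: Psi_0[OF CE[OF x]])
      have "s \<notin> range (\<lambda>t. \<phi> (\<Psi> t x))" using ne[OF CP[OF x]] by force
      then show ?thesis using conn[OF r] conn[OF r(2,1)] by force
    qed
    have "equilibrium a"
    proof (rule equilibriumI[OF CE[OF abC(1)]])
      fix t :: real assume t: "0 \<le> t"
      have le: "\<Psi> t a \<le> a" for t
      proof -
        have "\<phi> (\<Psi> t a) < s" using stay[OF abC(1), of t] phiab by simp
        then have "\<not> b \<le> \<Psi> t a" using phi_mono[of b "\<Psi> t a"] phiab by linarith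
        then show ?thesis using gap[OF CP[OF abC(1)], of t] by blast
      qed
      have "\<Psi> t (\<Psi> (- t) a) \<le> \<Psi> t a"
        by (rule Psi_mono[OF _ _ le t]) (auto intro: Psi_E CE abC)
      then have "a \<le> \<Psi> t a" by (simp add: Psi_inverse(2)[OF CE[OF abC(1)]])
      then show "\<Psi> t a = a" using le by (intro antisym)
    qed
    moreover have "equilibrium b"
    proof (rule equilibriumI[OF CE[OF abC(2)]])
      fix t :: real assume t: "0 \<le> t"
      have le: "b \<le> \<Psi> t b" for t
      proof -
        have "\<not> \<phi> (\<Psi> t b) < s" using stay[OF abC(2), of t] phiab by simp
        then have "\<not> \<Psi> t b \<le> a" using phi_mono[of "\<Psi> t b" a] phiab by linarith
        then show ?thesis using gap[OF CP[OF abC(2)], of t] by blast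
      qed
      have "\<Psi> t b \<le> \<Psi> t (\<Psi> (- t) b)"
        by (rule Psi_mono[OF _ _ le t]) (auto intro: Psi_E CE abC)
      then have "\<Psi> t b \<le> b" by (simp add: Psi_inverse(2)[OF CE[OF abC(2)]])
      then show "\<Psi> t b = b" using le by (intro antisym)
    qed
    ultimately obtain z where z: "z \<in> E" "z \<noteq> a" "z \<noteq> b" "\<And>t. a \<le> \<Psi> t z" "\<And>t. \<Psi> t z \<le> b"
        "\<And>s t. \<Psi> s z \<le> \<Psi> t z \<or> \<Psi> t z \<le> \<Psi> s z"
      using connecting_orbit[OF _ _ \<open>a \<le> b\<close> \<open>a \<noteq> b\<close>] by metis
    have "invariant_chain (C \<union> {tau k l (\<Psi> t z) |k l t. True})"
      by (rule invariant_chain_insert_orbit[OF C(1) abC \<open>a \<noteq> b\<close> gap z(1,4,5,6)])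
    then have "C \<union> {tau k l (\<Psi> t z) |k l t. True} = C" by (rule max) simp
    moreover have "z = tau origin 0 (\<Psi> 0 z)" by (simp add: tau_zero Psi_0[OF z(1)])
    then have "z \<in> {tau k l (\<Psi> t z) |k l t. True}" by blast
    ultimately have "z \<in> C" by blast
    then have "z \<le> a \<or> b \<le> z" by (rule gap)
    then show False using z(2,3) z(4,5)[of 0] Psi_0[OF z(1)] by (metis antisym)
  qed
  have "connected C"
  proof -
    \<comment> \<open>The inverse of \<open>\<phi>\<close> on the chain. By
      \<open>phi_bounds_diff\<close> each of its coordinates has Lipschitz constant one, so the
      chain is a continuous image of the real line.\<close>
    define \<sigma> where "\<sigma> = inv_into C \<phi>"
    have \<sigma>: "\<sigma> s \<in> C" "\<phi> (\<sigma> s) = s" for s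
      unfolding \<sigma>_def by (rule inv_into_into[OF surj], rule f_inv_into_f[OF surj])
    have lip: "\<bar>\<sigma> s i - \<sigma> t i\<bar> \<le> \<bar>s - t\<bar>" for s t i
    proof (cases "s \<le> t")
      case True
      then have "\<sigma> s \<le> \<sigma> t" by (intro phi_order \<sigma>) (simp add: \<sigma>)
      from phi_bounds_diff[OF CE[OF \<sigma>(1)] CE[OF \<sigma>(1)] this, of i] show ?thesis by (simp add: \<sigma> True abs_minus_commute)
    next
      case False
      then have "\<sigma> t \<le> \<sigma> s" by (intro phi_order \<sigma>) (simp add: \<sigma>)
      from phi_bounds_diff[OF CE[OF \<sigma>(1)] CE[OF \<sigma>(1)] this, of i] False show ?thesis by (simp add: \<sigma>)
    qed
    have "continuous_on UNIV \<sigma>"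
      unfolding continuous_on_def tendsto_config_iff
    proof (intro ballI allI)
      fix s i
      have "((\<lambda>t. \<sigma> t i - \<sigma> s i) \<longlongrightarrow> 0) (at s)"
      proof (rule Lim_null_comparison)
        show "((\<lambda>t. \<bar>t - s\<bar>) \<longlongrightarrow> 0) (at s)" by (auto intro!: tendsto_eq_intros)
      qed (use lip in \<open>auto intro!: always_eventually\<close>)
      then show "((\<lambda>t. \<sigma> t i) \<longlongrightarrow> \<sigma> s i) (at s)" by (rule LIM_zero_cancel)
    qed
    moreover have "C = range \<sigma>"
    proof (intro equalityI subsetI)
      fix x assume x: "x \<in> C"
      have "\<sigma> (\<phi> x) = x" by (rule antisym; rule phi_order) (simp_all add: \<sigma> x)
      then show "x \<in> range \<sigma>" by (metis rangeI)
    qed (use \<sigma> in auto)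
    ultimately show ?thesis using connected_continuous_image[of UNIV \<sigma>] connected_UNIV by simp
  qed
  have "ghost_circle r S C"
    unfolding ghost_circle_def
  proof (intro conjI ballI allI)
    show "C \<noteq> {}" using x0C' by blast
    show "strictly_less x y \<or> x = y \<or> strictly_less y x" if "x \<in> C" "y \<in> C" for x y
      using strict Cch[OF that] that by blast
    show "tau k l ` C \<subseteq> C" for k l using Ct by blast
    show "\<Psi> t ` C = C" for t
    proof (intro equalityI subsetI)
      fix x assume x: "x \<in> C"
      have "x = \<Psi> t (\<Psi> (- t) x)" by (simp add: Psi_inverse(2)[OF CE[OF x]])
      then show "x \<in> \<Psi> t ` C" using CP[OF x] by blast
    qed (use CP in blast)
  qed (fact closedC \<open>connected C\<close>)+
  moreover have "C \<subseteq> Bbar \<omega>" using CB Bw_subset_Bbar by blast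
  ultimately show ?thesis using x0C' x0(2) by blast
qed

end

theorem mainTheorem17:
  fixes S :: "('d::finite \<Rightarrow> int) \<Rightarrow> (('d \<Rightarrow> int) \<Rightarrow> real) \<Rightarrow> real"
    and r :: real
    and \<omega> :: "'d \<Rightarrow> real"
  assumes "local_potentials r S"
    and "\<forall>m. \<omega> m \<in> \<rat>"
  shows "\<exists>\<Gamma>. ghost_circle r S \<Gamma> \<and> \<Gamma> \<subseteq> Bbar \<omega> \<and> (\<exists>x\<in>\<Gamma>. global_minimizer r S x)"
proof -
  interpret rational_rotation r S \<omega>
    by unfold_locales (use assms in auto)
  show ?thesis by (rule ghost_circle_exists)
qed

end
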